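(* Let $(M,g)$ and $(N,h)$ be Riemannian manifolds with $M$ compact and with $N$ complete and of non-positive curvature. Let $(f_t)_{t\in[0,\infty)}$ be a solution to the harmonic heat flow equation $\frac{d f_t}{dt}=\tau(f_t)$ for maps from $M$ to $N$. Assume that the maps $f_t$ converge to a limiting harmonic map $f_\infty\colon M\to N$ as $t\to\infty$, and that $f_\infty$ is a non-degenerate critical point of the Dirichlet energy functional $E$. Let $b>0$ be a constant for which there exists $a>0$ such that $\left\lVert \frac{d f_t}{dt}\right\rVert_{L^2(f_t^*TN)}\le a\cdot e^{-b\cdot t}$ for all $t\ge0$. Then there exists a constant $a'>0$ such that for all $t\ge 0$ $$\lvert E(f_t)-E(f_\infty)\rvert\le a'\cdot e^{-2b\cdot t}.$$
   Context: Manifolds are smooth and without boundary; non-positive curvature means non-positive sectional curvature. For a smooth map $f\colon M\to N$, $\nabla$ denotes the connection on $f^*TN$ pulled back from the Levi-Civita connection of $N$, and also the induced connection on $T^*M\otimes f^*TN$ (tensor product with the Levi-Civita connection of $M$). Dirichlet energy: $E(f)=\frac12\int_M\lVert df\rVert^2\,\mathrm{vol}_g$, with $df$ viewed as a section of $T^*M\otimes f^*TN$ with the metric induced by $g$ and $h$. A smooth map is harmonic if it is a critical point of $E$; equivalently its tension field $\tau(f)=\operatorname{tr}_g\nabla df=\sum_{i}(\nabla_{e_i}df)(e_i)$ (with $(e_i)$ a local orthonormal frame of $TM$), a smooth section of $f^*TN$, vanishes identically. A solution of the harmonic heat flow equation is a family of smooth maps $f_t\colon M\to N$, $t\in[0,\infty)$,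 with $(m,t)\mapsto f_t(m)$ smooth on $M\times[0,\infty)$ and $\frac{df_t}{dt}=\tau(f_t)$ for all $t\geq 0$ (with initial condition $f_0=f$ a given smooth map). Convergence $f_t\to f_\infty$ means convergence in $C^k(M,N)$ for every $k$. $L^2$ inner product on sections of $f^*TN$: $\langle s,s'\rangle_{L^2(f^*TN)}=\int_M\langle s(m),s'(m)\rangle\,\mathrm{vol}_g(m)$, using the fibre metric induced by $h$; $\lVert\cdot\rVert_{L^2(f^*TN)}$ is the associated norm. Non-degeneracy: for harmonic $f$ the second variation of the energy is the bilinear form $\nabla^2E(f)(s,s')=\int_M\big[\langle\nabla s,\nabla s'\rangle-\operatorname{tr}_g\langle R^N(s,df\,\cdot)df\,\cdot,s'\rangle\big]\mathrm{vol}_g$ on $C^2$ sections $s,s'$ of $f^*TN$, where $R^N(X,Y)Z=\nabla_X\nabla_YZ-\nabla_Y\nabla_XZ-\nabla_{[X,Y]}Z$ is the curvature tensor of $(N,h)$. A harmonic map $f$ is a non-degenerate critical point of the energy if this bilinear form is non-degenerate. Equivalently, the Jacobi operator $\mathcal J_f(s)=-\sum_i\big[(\nabla^2s)(e_i,e_i)+R^N(s,df(e_i))df(e_i)\big]$ has trivial kernel. *)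

theory Defs
  imports "HOL-Analysis.Analysis"
begin

section \<open>Smooth functions between normed spaces\<close>

text \<open>On an open set \<open>S\<close> of a finite-dimensional space, \<open>Ck_on k S f\<close> says that \<open>f\<close> is of class
  \<open>C\<^sup>k\<close>: all iterated directional derivatives up to order \<open>k\<close> exist and are continuous.\<close>

primrec Ck_on :: "nat \<Rightarrow> 'a::real_normed_vector set \<Rightarrow> ('a \<Rightarrow> 'b::real_normed_vector) \<Rightarrow> bool" where
  "Ck_on 0 S f \<longleftrightarrow> continuous_on S f"
| "Ck_on (Suc k) S f \<longleftrightarrow>
     f differentiable_on S \<and> (\<forall>v. Ck_on k S (\<lambda>x. frechet_derivative f (at x) v))"

text \<open>On an arbitrary set, smooth means that there is locally a smooth extension to an open set.
  For open \<open>S\<close> this is the usual notion; for \<open>S\<close> relatively open in a half-space it is the usual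
  notion of smoothness up to the boundary.\<close>

definition smooth_on :: "'a::real_normed_vector set \<Rightarrow> ('a \<Rightarrow> 'b::real_normed_vector) \<Rightarrow> bool" where
  "smooth_on S f \<longleftrightarrow>
     (\<forall>x\<in>S. \<exists>U F. open U \<and> x \<in> U \<and> (\<forall>k. Ck_on k U F) \<and> (\<forall>y\<in>S \<inter> U. f y = F y))"

primrec iterated_derivative ::
  "'a::real_normed_vector list \<Rightarrow> ('a \<Rightarrow> 'b::real_normed_vector) \<Rightarrow> 'a \<Rightarrow> 'b" where
  "iterated_derivative [] f = f"
| "iterated_derivative (v # vs) f = (\<lambda>x. frechet_derivative (iterated_derivative vs f) (at x) v)"


section \<open>Manifolds and smooth maps\<close>

text \<open>The point set of a manifold is a whole type that is a second countable Hausdorff space.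
  A chart is a pair of an open domain and a coordinate map; only the values of the coordinate map
  on the domain matter.\<close>

type_synonym ('p, 'm) chart = "'p set \<times> ('p \<Rightarrow> real ^ 'm)"

definition chart_inv :: "('p, 'm::finite) chart \<Rightarrow> real ^ 'm \<Rightarrow> 'p" where
  "chart_inv c = inv_into (fst c) (snd c)"

definition is_chart :: "('p::topological_space, 'm::finite) chart \<Rightarrow> bool" where
  "is_chart c \<longleftrightarrow> open (fst c) \<and> open (snd c ` fst c) \<and>
     homeomorphism (fst c) (snd c ` fst c) (snd c) (chart_inv c)"

definition smooth_atlas ::
  "('p::{t2_space,second_countable_topology}, 'm::finite) chart set \<Rightarrow> bool" where
  "smooth_atlas A \<longleftrightarrow> (\<forall>c\<in>A. is_chart c) \<and> (\<Union>c\<in>A. fst c) = UNIV \<and>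
     (\<forall>c\<in>A. \<forall>d\<in>A. smooth_on (snd c ` (fst c \<inter> fst d)) (snd d \<circ> chart_inv c))"

definition smooth_map :: "('p::topological_space, 'm::finite) chart set \<Rightarrow>
    ('q::topological_space, 'n::finite) chart set \<Rightarrow> ('p \<Rightarrow> 'q) \<Rightarrow> bool" where
  "smooth_map A B f \<longleftrightarrow> continuous_on UNIV f \<and>
     (\<forall>c\<in>A. \<forall>d\<in>B. smooth_on (snd c ` (fst c \<inter> f -` fst d)) (snd d \<circ> f \<circ> chart_inv c))"

definition smooth_curve ::
  "('q::topological_space, 'n::finite) chart set \<Rightarrow> (real \<Rightarrow> 'q) \<Rightarrow> bool" where
  "smooth_curve B \<gamma> \<longleftrightarrow> continuous_on UNIV \<gamma> \<and> (\<forall>d\<in>B. smooth_on (\<gamma> -` fst d) (snd d \<circ> \<gamma>))"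

text \<open>Smoothness of \<open>(p, t) \<mapsto> f t p\<close> on the product of the manifold and \<open>T\<close>.\<close>

definition smooth_family :: "('p::topological_space, 'm::finite) chart set \<Rightarrow>
    ('q::topological_space, 'n::finite) chart set \<Rightarrow> real set \<Rightarrow> (real \<Rightarrow> 'p \<Rightarrow> 'q) \<Rightarrow> bool" where
  "smooth_family A B T f \<longleftrightarrow> continuous_on (UNIV \<times> T) (\<lambda>(p, t). f t p) \<and>
     (\<forall>c\<in>A. \<forall>d\<in>B.
        smooth_on {(x, t). x \<in> snd c ` fst c \<and> t \<in> T \<and> f t (chart_inv c x) \<in> fst d}
          (\<lambda>(x, t). snd d (f t (chart_inv c x))))"

text \<open>Convergence in the \<open>C\<^sup>k\<close> topology: uniform convergence, on compact subsets of charts, of the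
  coordinate expressions together with their partial derivatives up to order \<open>k\<close>.\<close>

definition Ck_convergent :: "nat \<Rightarrow> ('p::topological_space, 'm::finite) chart set \<Rightarrow>
    ('q::topological_space, 'n::finite) chart set \<Rightarrow> (real \<Rightarrow> 'p \<Rightarrow> 'q) \<Rightarrow> ('p \<Rightarrow> 'q) \<Rightarrow> bool" where
  "Ck_convergent k A B f f_inf \<longleftrightarrow>
     (\<forall>c\<in>A. \<forall>d\<in>B. \<forall>K. compact K \<and> K \<subseteq> fst c \<and> f_inf ` K \<subseteq> fst d \<longrightarrow>
        (\<forall>\<^sub>F t in at_top. f t ` K \<subseteq> fst d) \<and>
        (\<forall>vs. length vs \<le> k \<longrightarrow>
           uniform_limit (snd c ` K)
             (\<lambda>t. iterated_derivative vs (snd d \<circ> f t \<circ> chart_inv c))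
             (iterated_derivative vs (snd d \<circ> f_inf \<circ> chart_inv c)) at_top))"


section \<open>Tangent vectors\<close>

text \<open>A tangent vector at \<open>p\<close> is represented by its components in one fixed chart around \<open>p\<close>, so that
  every tangent space is a copy of the model space. The components in another chart \<open>c\<close> around \<open>p\<close>
  are obtained with \<open>to_chart A c p\<close>, whose inverse is \<open>from_chart A c p\<close>.\<close>

definition chart_at :: "('p, 'm::finite) chart set \<Rightarrow> 'p \<Rightarrow> ('p, 'm) chart" where
  "chart_at A p = (SOME c. c \<in> A \<and> p \<in> fst c)"

definition to_chart ::
  "('p, 'm::finite) chart set \<Rightarrow> ('p, 'm) chart \<Rightarrow> 'p \<Rightarrow> real ^ 'm \<Rightarrow> real ^ 'm" where
  "to_chart A c p =
     frechet_derivative (snd c \<circ> chart_inv (chart_at A p)) (at (snd (chart_at A p) p))"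

definition from_chart ::
  "('p, 'm::finite) chart set \<Rightarrow> ('p, 'm) chart \<Rightarrow> 'p \<Rightarrow> real ^ 'm \<Rightarrow> real ^ 'm" where
  "from_chart A c p = frechet_derivative (snd (chart_at A p) \<circ> chart_inv c) (at (snd c p))"

text \<open>The expression of \<open>f\<close> near \<open>p\<close> in the charts fixed at \<open>p\<close> and \<open>f p\<close>, and the differential of \<open>f\<close>.\<close>

definition local_rep :: "('p, 'm::finite) chart set \<Rightarrow> ('q, 'n::finite) chart set \<Rightarrow>
    ('p \<Rightarrow> 'q) \<Rightarrow> 'p \<Rightarrow> real ^ 'm \<Rightarrow> real ^ 'n" where
  "local_rep A B f p = snd (chart_at B (f p)) \<circ> f \<circ> chart_inv (chart_at A p)"

definition differential :: "('p, 'm::finite) chart set \<Rightarrow> ('q, 'n::finite) chart set \<Rightarrow>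
    ('p \<Rightarrow> 'q) \<Rightarrow> 'p \<Rightarrow> real ^ 'm \<Rightarrow> real ^ 'n" where
  "differential A B f p = frechet_derivative (local_rep A B f p) (at (snd (chart_at A p) p))"


section \<open>Riemannian metrics\<close>

definition inner_product :: "('v::real_vector \<Rightarrow> 'v \<Rightarrow> real) \<Rightarrow> bool" where
  "inner_product G \<longleftrightarrow> (\<forall>u. linear (G u)) \<and> (\<forall>u v. G u v = G v u) \<and> (\<forall>u. u \<noteq> 0 \<longrightarrow> G u u > 0)"

definition metric_in :: "('p, 'm::finite) chart set \<Rightarrow> ('p \<Rightarrow> real ^ 'm \<Rightarrow> real ^ 'm \<Rightarrow> real) \<Rightarrow>
    ('p, 'm) chart \<Rightarrow> real ^ 'm \<Rightarrow> real ^ 'm \<Rightarrow> real ^ 'm \<Rightarrow> real" where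
  "metric_in A g c x u v =
     (let p = chart_inv c x in g p (from_chart A c p u) (from_chart A c p v))"

definition riemannian_manifold :: "('p::{t2_space,second_countable_topology}, 'm::finite) chart set \<Rightarrow>
    ('p \<Rightarrow> real ^ 'm \<Rightarrow> real ^ 'm \<Rightarrow> real) \<Rightarrow> bool" where
  "riemannian_manifold A g \<longleftrightarrow> smooth_atlas A \<and> (\<forall>p. inner_product (g p)) \<and>
     (\<forall>c\<in>A. \<forall>u v. smooth_on (snd c ` fst c) (\<lambda>x. metric_in A g c x u v))"

text \<open>\<open>\<Sum>\<^sub>i F (e\<^sub>i) (e\<^sub>i)\<close> for an orthonormal basis \<open>(e\<^sub>i)\<close> of \<open>G\<close>; independent of the basis for bilinear \<open>F\<close>.\<close>

definition metric_trace :: "(real ^ 'm \<Rightarrow> real ^ 'm \<Rightarrow> real) \<Rightarrow>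
    (real ^ 'm \<Rightarrow> real ^ 'm \<Rightarrow> 'b::comm_monoid_add) \<Rightarrow> 'b" where
  "metric_trace G F =
     (let e = (SOME e :: 'm::finite \<Rightarrow> real ^ 'm. \<forall>i j. G (e i) (e j) = (if i = j then 1 else 0))
      in \<Sum>i\<in>UNIV. F (e i) (e i))"

text \<open>The Riemannian measure: the unique Borel measure with density \<open>sqrt (det (g\<^sub>i\<^sub>j))\<close> in every chart.\<close>

definition riemannian_volume :: "('p::topological_space, 'm::finite) chart set \<Rightarrow>
    ('p \<Rightarrow> real ^ 'm \<Rightarrow> real ^ 'm \<Rightarrow> real) \<Rightarrow> 'p measure" where
  "riemannian_volume A g = (THE \<mu>. sets \<mu> = sets borel \<and>
     (\<forall>c\<in>A. \<forall>S\<in>sets borel. S \<subseteq> fst c \<longrightarrow>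
        emeasure \<mu> S = (\<integral>\<^sup>+x\<in>snd c ` S.
          ennreal (sqrt (det (\<chi> i j. metric_in A g c x (axis i 1) (axis j 1)))) \<partial>lborel)))"


section \<open>Levi-Civita connection and curvature\<close>

text \<open>Let \<open>G\<close> be a metric on an open subset of the model space. \<open>christoffel G x u v\<close> is the
  Levi-Civita derivative at \<open>x\<close> of the constant field \<open>v\<close> in direction \<open>u\<close>, determined by the Koszul
  formula for constant fields.\<close>

definition christoffel :: "(real ^ 'n \<Rightarrow> real ^ 'n \<Rightarrow> real ^ 'n \<Rightarrow> real) \<Rightarrow>
    real ^ 'n::finite \<Rightarrow> real ^ 'n \<Rightarrow> real ^ 'n \<Rightarrow> real ^ 'n" where
  "christoffel G x u v = (THE z. \<forall>w. 2 * G x z w =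
     frechet_derivative (\<lambda>y. G y v w) (at x) u +
     frechet_derivative (\<lambda>y. G y u w) (at x) v -
     frechet_derivative (\<lambda>y. G y u v) (at x) w)"

text \<open>The pulled back connection: the derivative in direction \<open>u\<close> of a section \<open>\<sigma>\<close> along a map \<open>\<phi>\<close>
  into an open subset of the model space.\<close>

definition pullback_nabla :: "(real ^ 'n \<Rightarrow> real ^ 'n \<Rightarrow> real ^ 'n \<Rightarrow> real) \<Rightarrow>
    ('a::real_normed_vector \<Rightarrow> real ^ 'n::finite) \<Rightarrow> ('a \<Rightarrow> real ^ 'n) \<Rightarrow> 'a \<Rightarrow> 'a \<Rightarrow> real ^ 'n" where
  "pullback_nabla G \<phi> \<sigma> x u = frechet_derivative \<sigma> (at x) u +
     christoffel G (\<phi> x) (frechet_derivative \<phi> (at x) u) (\<sigma> x)"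

definition nabla_field :: "(real ^ 'n \<Rightarrow> real ^ 'n \<Rightarrow> real ^ 'n \<Rightarrow> real) \<Rightarrow>
    (real ^ 'n::finite \<Rightarrow> real ^ 'n) \<Rightarrow> (real ^ 'n \<Rightarrow> real ^ 'n) \<Rightarrow> real ^ 'n \<Rightarrow> real ^ 'n" where
  "nabla_field G X Y x = pullback_nabla G (\<lambda>y. y) Y x (X x)"

definition lie_bracket ::
  "(real ^ 'n::finite \<Rightarrow> real ^ 'n) \<Rightarrow> (real ^ 'n \<Rightarrow> real ^ 'n) \<Rightarrow> real ^ 'n \<Rightarrow> real ^ 'n" where
  "lie_bracket X Y x = frechet_derivative Y (at x) (X x) - frechet_derivative X (at x) (Y x)"

definition curvature_field :: "(real ^ 'n \<Rightarrow> real ^ 'n \<Rightarrow> real ^ 'n \<Rightarrow> real) \<Rightarrow>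
    (real ^ 'n::finite \<Rightarrow> real ^ 'n) \<Rightarrow> (real ^ 'n \<Rightarrow> real ^ 'n) \<Rightarrow> (real ^ 'n \<Rightarrow> real ^ 'n) \<Rightarrow>
    real ^ 'n \<Rightarrow> real ^ 'n" where
  "curvature_field G X Y Z x = nabla_field G X (nabla_field G Y Z) x -
     nabla_field G Y (nabla_field G X Z) x - nabla_field G (lie_bracket X Y) Z x"

text \<open>The curvature tensor \<open>R(u,v)w\<close> at a point; being a tensor, it may be evaluated on the constant
  extensions of \<open>u\<close>, \<open>v\<close> and \<open>w\<close>.\<close>

definition curvature :: "('q, 'n::finite) chart set \<Rightarrow> ('q \<Rightarrow> real ^ 'n \<Rightarrow> real ^ 'n \<Rightarrow> real) \<Rightarrow>
    'q \<Rightarrow> real ^ 'n \<Rightarrow> real ^ 'n \<Rightarrow> real ^ 'n \<Rightarrow> real ^ 'n" where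
  "curvature B h q u v w =
     (let d = chart_at B q
      in curvature_field (metric_in B h d) (\<lambda>_. u) (\<lambda>_. v) (\<lambda>_. w) (snd d q))"

definition sectional_curvature :: "('q, 'n::finite) chart set \<Rightarrow>
    ('q \<Rightarrow> real ^ 'n \<Rightarrow> real ^ 'n \<Rightarrow> real) \<Rightarrow> 'q \<Rightarrow> real ^ 'n \<Rightarrow> real ^ 'n \<Rightarrow> real" where
  "sectional_curvature B h q u v =
     h q (curvature B h q u v v) u / (h q u u * h q v v - (h q u v)\<^sup>2)"

definition nonpositively_curved ::
  "('q, 'n::finite) chart set \<Rightarrow> ('q \<Rightarrow> real ^ 'n \<Rightarrow> real ^ 'n \<Rightarrow> real) \<Rightarrow> bool" where
  "nonpositively_curved B h \<longleftrightarrow>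
     (\<forall>q u v. u \<noteq> v \<and> independent {u, v} \<longrightarrow> sectional_curvature B h q u v \<le> 0)"

definition geodesic :: "('q::topological_space, 'n::finite) chart set \<Rightarrow>
    ('q \<Rightarrow> real ^ 'n \<Rightarrow> real ^ 'n \<Rightarrow> real) \<Rightarrow> (real \<Rightarrow> 'q) \<Rightarrow> bool" where
  "geodesic B h \<gamma> \<longleftrightarrow> smooth_curve B \<gamma> \<and>
     (\<forall>t. let d = chart_at B (\<gamma> t); \<phi> = snd d \<circ> \<gamma>
          in pullback_nabla (metric_in B h d) \<phi> (\<lambda>s. vector_derivative \<phi> (at s)) t 1 = 0)"

text \<open>Geodesic completeness; by Hopf and Rinow this is the same as metric completeness.\<close>

definition complete_riemannian :: "('q::topological_space, 'n::finite) chart set \<Rightarrow>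
    ('q \<Rightarrow> real ^ 'n \<Rightarrow> real ^ 'n \<Rightarrow> real) \<Rightarrow> bool" where
  "complete_riemannian B h \<longleftrightarrow> (\<forall>q v. \<exists>\<gamma>. geodesic B h \<gamma> \<and> \<gamma> 0 = q \<and>
     vector_derivative (snd (chart_at B q) \<circ> \<gamma>) (at 0) = v)"


section \<open>Energy, tension field and heat flow\<close>

definition energy :: "('p::topological_space, 'm::finite) chart set \<Rightarrow>
    ('p \<Rightarrow> real ^ 'm \<Rightarrow> real ^ 'm \<Rightarrow> real) \<Rightarrow> ('q, 'n::finite) chart set \<Rightarrow>
    ('q \<Rightarrow> real ^ 'n \<Rightarrow> real ^ 'n \<Rightarrow> real) \<Rightarrow> ('p \<Rightarrow> 'q) \<Rightarrow> real" where
  "energy A g B h f = 1/2 * (\<integral>p. metric_trace (g p)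
     (\<lambda>u v. h (f p) (differential A B f p u) (differential A B f p v)) \<partial>riemannian_volume A g)"

text \<open>\<open>(\<nabla>\<^sub>u df)(v) = \<nabla>\<^sub>u (df(V)) - df(\<nabla>\<^sub>u V)\<close>, where \<open>V\<close> is the extension of \<open>v\<close> that is constant in
  the chart fixed at \<open>p\<close>.\<close>

definition nabla_differential :: "('p, 'm::finite) chart set \<Rightarrow>
    ('p \<Rightarrow> real ^ 'm \<Rightarrow> real ^ 'm \<Rightarrow> real) \<Rightarrow> ('q, 'n::finite) chart set \<Rightarrow>
    ('q \<Rightarrow> real ^ 'n \<Rightarrow> real ^ 'n \<Rightarrow> real) \<Rightarrow> ('p \<Rightarrow> 'q) \<Rightarrow> 'p \<Rightarrow>
    real ^ 'm \<Rightarrow> real ^ 'm \<Rightarrow> real ^ 'n" where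
  "nabla_differential A g B h f p u v =
     (let c = chart_at A p; d = chart_at B (f p); x = snd c p; \<phi> = local_rep A B f p
      in pullback_nabla (metric_in B h d) \<phi> (\<lambda>y. frechet_derivative \<phi> (at y) v) x u -
         frechet_derivative \<phi> (at x) (nabla_field (metric_in A g c) (\<lambda>_. u) (\<lambda>_. v) x))"

definition tension :: "('p, 'm::finite) chart set \<Rightarrow>
    ('p \<Rightarrow> real ^ 'm \<Rightarrow> real ^ 'm \<Rightarrow> real) \<Rightarrow> ('q, 'n::finite) chart set \<Rightarrow>
    ('q \<Rightarrow> real ^ 'n \<Rightarrow> real ^ 'n \<Rightarrow> real) \<Rightarrow> ('p \<Rightarrow> 'q) \<Rightarrow> 'p \<Rightarrow> real ^ 'n" where
  "tension A g B h f p = metric_trace (g p) (nabla_differential A g B h f p)"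

text \<open>A harmonic map is a critical point of the energy: the energy is stationary along every smooth
  variation.\<close>

definition harmonic :: "('p::topological_space, 'm::finite) chart set \<Rightarrow>
    ('p \<Rightarrow> real ^ 'm \<Rightarrow> real ^ 'm \<Rightarrow> real) \<Rightarrow> ('q::topological_space, 'n::finite) chart set \<Rightarrow>
    ('q \<Rightarrow> real ^ 'n \<Rightarrow> real ^ 'n \<Rightarrow> real) \<Rightarrow> ('p \<Rightarrow> 'q) \<Rightarrow> bool" where
  "harmonic A g B h f \<longleftrightarrow> smooth_map A B f \<and>
     (\<forall>F. smooth_family A B UNIV F \<and> F 0 = f \<longrightarrow>
        ((\<lambda>s. energy A g B h (F s)) has_real_derivative 0) (at 0))"

text \<open>The section \<open>df\<^sub>t/dt\<close> along \<open>f\<^sub>t\<close>, one-sided at \<open>t = 0\<close>.\<close>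

definition velocity ::
  "('q, 'n::finite) chart set \<Rightarrow> (real \<Rightarrow> 'p \<Rightarrow> 'q) \<Rightarrow> real \<Rightarrow> 'p \<Rightarrow> real ^ 'n" where
  "velocity B f t p =
     vector_derivative (\<lambda>s. snd (chart_at B (f t p)) (f s p)) (at t within {0..})"

definition harmonic_heat_flow :: "('p::topological_space, 'm::finite) chart set \<Rightarrow>
    ('p \<Rightarrow> real ^ 'm \<Rightarrow> real ^ 'm \<Rightarrow> real) \<Rightarrow> ('q::topological_space, 'n::finite) chart set \<Rightarrow>
    ('q \<Rightarrow> real ^ 'n \<Rightarrow> real ^ 'n \<Rightarrow> real) \<Rightarrow> (real \<Rightarrow> 'p \<Rightarrow> 'q) \<Rightarrow> bool" where
  "harmonic_heat_flow A g B h f \<longleftrightarrow> smooth_family A B {0..} f \<and>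
     (\<forall>t\<ge>0. \<forall>p. velocity B f t p = tension A g B h (f t) p)"


section \<open>Sections along a map and the second variation\<close>

text \<open>A section of the pulled back tangent bundle assigns to \<open>p\<close> a tangent vector at \<open>f p\<close>.
  \<open>section_in\<close> is its expression in arbitrary charts \<open>c\<close> and \<open>d\<close>.\<close>

definition section_in :: "('q, 'n::finite) chart set \<Rightarrow> ('p \<Rightarrow> 'q) \<Rightarrow> ('p \<Rightarrow> real ^ 'n) \<Rightarrow>
    ('p, 'm::finite) chart \<Rightarrow> ('q, 'n) chart \<Rightarrow> real ^ 'm \<Rightarrow> real ^ 'n" where
  "section_in B f s c d x = (let p = chart_inv c x in to_chart B d (f p) (s p))"

definition C2_section :: "('p, 'm::finite) chart set \<Rightarrow> ('q, 'n::finite) chart set \<Rightarrow>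
    ('p \<Rightarrow> 'q) \<Rightarrow> ('p \<Rightarrow> real ^ 'n) \<Rightarrow> bool" where
  "C2_section A B f s \<longleftrightarrow>
     (\<forall>c\<in>A. \<forall>d\<in>B. Ck_on 2 (snd c ` (fst c \<inter> f -` fst d)) (section_in B f s c d))"

definition nabla_section :: "('p, 'm::finite) chart set \<Rightarrow> ('q, 'n::finite) chart set \<Rightarrow>
    ('q \<Rightarrow> real ^ 'n \<Rightarrow> real ^ 'n \<Rightarrow> real) \<Rightarrow> ('p \<Rightarrow> 'q) \<Rightarrow> ('p \<Rightarrow> real ^ 'n) \<Rightarrow>
    'p \<Rightarrow> real ^ 'm \<Rightarrow> real ^ 'n" where
  "nabla_section A B h f s p u =
     (let c = chart_at A p; d = chart_at B (f p)
      in pullback_nabla (metric_in B h d) (local_rep A B f p) (section_in B f s c d) (snd c p) u)"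

definition L2_inner :: "('p::topological_space, 'm::finite) chart set \<Rightarrow>
    ('p \<Rightarrow> real ^ 'm \<Rightarrow> real ^ 'm \<Rightarrow> real) \<Rightarrow> ('q \<Rightarrow> real ^ 'n \<Rightarrow> real ^ 'n \<Rightarrow> real) \<Rightarrow>
    ('p \<Rightarrow> 'q) \<Rightarrow> ('p \<Rightarrow> real ^ 'n::finite) \<Rightarrow> ('p \<Rightarrow> real ^ 'n) \<Rightarrow> real" where
  "L2_inner A g h f s s' = (\<integral>p. h (f p) (s p) (s' p) \<partial>riemannian_volume A g)"

definition L2_norm :: "('p::topological_space, 'm::finite) chart set \<Rightarrow>
    ('p \<Rightarrow> real ^ 'm \<Rightarrow> real ^ 'm \<Rightarrow> real) \<Rightarrow> ('q \<Rightarrow> real ^ 'n \<Rightarrow> real ^ 'n \<Rightarrow> real) \<Rightarrow>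
    ('p \<Rightarrow> 'q) \<Rightarrow> ('p \<Rightarrow> real ^ 'n::finite) \<Rightarrow> real" where
  "L2_norm A g h f s = sqrt (L2_inner A g h f s s)"

definition second_variation :: "('p::topological_space, 'm::finite) chart set \<Rightarrow>
    ('p \<Rightarrow> real ^ 'm \<Rightarrow> real ^ 'm \<Rightarrow> real) \<Rightarrow> ('q, 'n::finite) chart set \<Rightarrow>
    ('q \<Rightarrow> real ^ 'n \<Rightarrow> real ^ 'n \<Rightarrow> real) \<Rightarrow> ('p \<Rightarrow> 'q) \<Rightarrow>
    ('p \<Rightarrow> real ^ 'n) \<Rightarrow> ('p \<Rightarrow> real ^ 'n) \<Rightarrow> real" where
  "second_variation A g B h f s s' = (\<integral>p.
     metric_trace (g p)
       (\<lambda>u v. h (f p) (nabla_section A B h f s p u) (nabla_section A B h f s' p v)) -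
     h (f p)
       (metric_trace (g p) (\<lambda>u v.
          curvature B h (f p) (s p) (differential A B f p u) (differential A B f p v)))
       (s' p)
     \<partial>riemannian_volume A g)"

definition nondegenerate_critical_point :: "('p::topological_space, 'm::finite) chart set \<Rightarrow>
    ('p \<Rightarrow> real ^ 'm \<Rightarrow> real ^ 'm \<Rightarrow> real) \<Rightarrow> ('q::topological_space, 'n::finite) chart set \<Rightarrow>
    ('q \<Rightarrow> real ^ 'n \<Rightarrow> real ^ 'n \<Rightarrow> real) \<Rightarrow> ('p \<Rightarrow> 'q) \<Rightarrow> bool" where
  "nondegenerate_critical_point A g B h f \<longleftrightarrow> harmonic A g B h f \<and>
     (\<forall>s. C2_section A B f s \<and>
          (\<forall>s'. C2_section A B f s' \<longrightarrow> second_variation A g B h f s s' = 0) \<longrightarrow>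
        (\<forall>p. s p = 0))"

end

theory Submission
  imports Defs "HOL-Real_Asymp.Real_Asymp"
begin

text \<open>Let \<open>\<omega> v = \<langle>df\<^sub>t v, \<partial>\<^sub>t f\<^sub>t\<rangle>\<close>, a 1-form on \<open>M\<close>. Pointwise, the time derivative of the energy density is
  \<open>div \<omega> - \<langle>\<tau>(f\<^sub>t), \<partial>\<^sub>t f\<^sub>t\<rangle>\<close>, so by the divergence theorem the energy has derivative \<open>- \<parallel>\<partial>\<^sub>t f\<^sub>t\<parallel>\<^sup>2\<close> along
  the flow for \<open>t > 0\<close>. Since \<open>E(f\<^sub>t)\<close> tends to \<open>E(f\<^sub>\<infinity>)\<close>, integrating the bound \<open>a\<^sup>2 exp (- 2 b t)\<close> over
  \<open>[t, \<infinity>)\<close> gives the claim for \<open>t > 0\<close>; the value at \<open>t = 0\<close> is absorbed into the constant.\<close>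

section \<open>Continuously differentiable functions\<close>

text \<open>The components of a tangent vector refer to the chart that \<open>chart_at\<close>
  selects, and this selection has no continuity in the point. Hence nothing global can be
  differentiated directly: regularity is always asserted in arbitrary charts, and
  \<open>differential\<close>, \<open>velocity\<close>, the energy density and the divergence each
  receive a formula valid in every chart around a point. The divergence theorem is the costly
  ingredient. It requires that the THE in \<open>riemannian_volume\<close> denotes a measure, hence
  a change of variables; the identity sqrt(det g) div Z = \<Sum> \<partial>_a (sqrt(det g) Z^a); and
  a partition of unity. All of this lives in class C^1, because \<omega> and the metrics are
  differentiated once. Times t > 0 are singled out because \<open>fd\<close> is a two-sided
  derivative, while smoothness of the flow stops at t = 0. The limit of the energy comes from
  uniform convergence of the coordinate expressions and of their first derivatives, on finitely many
  compact coordinate balls.\<close>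

abbreviation fd :: "('a::real_normed_vector \<Rightarrow> 'b::real_normed_vector) \<Rightarrow> 'a \<Rightarrow> 'a \<Rightarrow> 'b" where
  "fd f x \<equiv> frechet_derivative f (at x)"

text \<open>Differentiability is meant in a full neighbourhood of each point, to match
  \<open>fd\<close>, so even on a closed coordinate ball no one-sided derivative occurs. Continuity
  is asked direction by direction, as in \<open>Ck_on\<close>; in finite dimension this is
  continuity of the derivative.\<close>

definition C1_on :: "'a::real_normed_vector set \<Rightarrow> ('a \<Rightarrow> 'b::real_normed_vector) \<Rightarrow> bool" where
  "C1_on S f \<longleftrightarrow> (\<forall>x\<in>S. f differentiable (at x)) \<and> (\<forall>v. continuous_on S (\<lambda>x. fd f x v))"

lemma C1_onI:
  assumes "\<And>x. x \<in> S \<Longrightarrow> (f has_derivative f' x) (at x)" "\<And>v. continuous_on S (\<lambda>x. f' x v)"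
  shows "C1_on S f"
proof -
  have "fd f x = f' x" if "x \<in> S" for x
    using frechet_derivative_at[OF assms(1)[OF that]] by simp
  then show ?thesis
    unfolding C1_on_def using assms by (auto simp: differentiable_def cong: continuous_on_cong)
qed

lemma fd_unique: "(f has_derivative f') (at x) \<Longrightarrow> fd f x = f'"
  using frechet_derivative_at by metis

lemma C1_on_has_derivative: "C1_on S f \<Longrightarrow> x \<in> S \<Longrightarrow> (f has_derivative fd f x) (at x)"
  by (simp add: C1_on_def frechet_derivative_works)

lemma C1_on_continuous_fd: "C1_on S f \<Longrightarrow> continuous_on S (\<lambda>x. fd f x v)"
  by (simp add: C1_on_def)

lemma C1_on_continuous_on: "C1_on S f \<Longrightarrow> continuous_on S f"
  by (meson C1_on_has_derivative continuous_at_imp_continuous_on has_derivative_continuous)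

lemma C1_on_linear_fd: "C1_on S f \<Longrightarrow> x \<in> S \<Longrightarrow> linear (fd f x)"
  using C1_on_has_derivative has_derivative_linear by blast

lemma C1_on_subset: "C1_on S f \<Longrightarrow> T \<subseteq> S \<Longrightarrow> C1_on T f"
  unfolding C1_on_def by (blast intro: continuous_on_subset)

lemma fd_cong_open:
  assumes "open S" "x \<in> S" "\<And>y. y \<in> S \<Longrightarrow> f y = g y"
  shows "fd f x = fd g x"
proof -
  have "(f has_derivative F) (at x) \<longleftrightarrow> (g has_derivative F) (at x)" for F
    using has_derivative_transform_within_open[OF _ assms(1,2)] assms(3) by metis
  then show ?thesis by (simp add: frechet_derivative_def)
qed

lemma differentiable_cong_open:
  assumes "open S" "x \<in> S" "\<And>y. y \<in> S \<Longrightarrow> f y = g y" "f differentiable (at x)"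
  shows "g differentiable (at x)"
  using has_derivative_transform_within_open[OF _ assms(1,2)] assms(3,4)
  unfolding differentiable_def by metis

text \<open>Both clauses of \<open>C1_on\<close> depend only on the germ of \<open>f\<close>.
  Functions whose formula changes from chart to chart, or that are cut off by zero, are shown to be
  C^1 this way.\<close>

lemma C1_on_local:
  assumes "\<And>x. x \<in> S \<Longrightarrow> \<exists>U g. open U \<and> x \<in> U \<and> C1_on U g \<and> (\<forall>y\<in>U. f y = g y)"
  shows "C1_on S f"
  unfolding C1_on_def
proof (intro conjI ballI allI)
  fix x assume "x \<in> S"
  then obtain U g where U: "open U" "x \<in> U" "C1_on U g" "\<forall>y\<in>U. f y = g y"
    using assms by blast
  then show "f differentiable (at x)"
    using differentiable_cong_open[of U x g f] by (auto simp: C1_on_def)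
next
  fix v
  show "continuous_on S (\<lambda>x. fd f x v)"
  proof (rule continuous_at_imp_continuous_on, rule ballI)
    fix x assume "x \<in> S"
    then obtain U g where U: "open U" "x \<in> U" "C1_on U g" "\<forall>y\<in>U. f y = g y"
      using assms by blast
    have "isCont (\<lambda>x. fd g x v) x"
      using U C1_on_continuous_fd continuous_on_eq_continuous_at by blast
    moreover have "\<forall>\<^sub>F y in nhds x. fd g y v = fd f y v"
      using U fd_cong_open[of U _ f g] by (auto simp: eventually_nhds)
    ultimately show "isCont (\<lambda>x. fd f x v) x"
      using isCont_cong by fastforce
  qed
qed

lemma C1_on_cong:
  assumes "open S" "C1_on S g" "\<And>x. x \<in> S \<Longrightarrow> f x = g x"
  shows "C1_on S f"
  by (rule C1_on_local) (use assms in blast)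

lemma C1_on_const [simp]: "C1_on S (\<lambda>x. c)"
  by (rule C1_onI[where f' = "\<lambda>_ _. 0"]) auto

lemma C1_on_linear:
  fixes L :: "'a::euclidean_space \<Rightarrow> 'b::real_normed_vector"
  assumes "linear L" shows "C1_on S L"
proof (rule C1_onI[where f' = "\<lambda>_. L"])
  show "(L has_derivative L) (at x)" for x
    using assms linear_conv_bounded_linear bounded_linear_imp_has_derivative by blast
qed auto

lemma C1_on_ident: "C1_on S (\<lambda>x. x)"
  by (rule C1_onI[where f' = "\<lambda>_ v. v"]) auto

lemma C1_on_bounded_linear:
  assumes "bounded_linear L" "C1_on S f"
  shows "C1_on S (\<lambda>x. L (f x))"
  by (rule C1_onI[OF bounded_linear.has_derivative[OF assms(1) C1_on_has_derivative[OF assms(2)]]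
        bounded_linear.continuous_on[OF assms(1) C1_on_continuous_fd[OF assms(2)]]])

lemma C1_on_add:
  assumes "C1_on S f" "C1_on S g"
  shows "C1_on S (\<lambda>x. f x + g x)"
  by (rule C1_onI[OF has_derivative_add[OF assms[THEN C1_on_has_derivative]]
        continuous_on_add[OF assms[THEN C1_on_continuous_fd]]])

lemma C1_on_minus: "C1_on S f \<Longrightarrow> C1_on S (\<lambda>x. - f x)"
  by (rule C1_on_bounded_linear[OF bounded_linear_minus[OF bounded_linear_ident]])

lemma C1_on_diff: "C1_on S f \<Longrightarrow> C1_on S g \<Longrightarrow> C1_on S (\<lambda>x. f x - g x)"
  using C1_on_add[of S f "\<lambda>x. - g x"] C1_on_minus by auto

lemma C1_on_sum: "(\<And>i. i \<in> I \<Longrightarrow> C1_on S (f i)) \<Longrightarrow> C1_on S (\<lambda>x. \<Sum>i\<in>I. f i x)"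
  by (induction I rule: infinite_finite_induct) (auto intro: C1_on_add)

lemma C1_on_scaleR:
  assumes "C1_on S f" "C1_on S g"
  shows "C1_on S (\<lambda>x. f x *\<^sub>R g x)"
  by (rule C1_onI[OF has_derivative_scaleR[OF assms[THEN C1_on_has_derivative]]])
    (assumption | intro continuous_on_add continuous_on_scaleR assms[THEN C1_on_continuous_fd]
      assms[THEN C1_on_continuous_on])+

lemma C1_on_mult:
  fixes f g :: "'a::real_normed_vector \<Rightarrow> real"
  shows "C1_on S f \<Longrightarrow> C1_on S g \<Longrightarrow> C1_on S (\<lambda>x. f x * g x)"
  using C1_on_scaleR[of S f g] by simp

lemma C1_on_prod:
  fixes f :: "'i \<Rightarrow> 'a::real_normed_vector \<Rightarrow> real"
  shows "(\<And>i. i \<in> I \<Longrightarrow> C1_on S (f i)) \<Longrightarrow> C1_on S (\<lambda>x. \<Prod>i\<in>I. f i x)"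
  by (induction I rule: infinite_finite_induct) (auto intro: C1_on_mult)

lemma fd_compose:
  assumes "C1_on S f" "C1_on T g" "x \<in> S" "f x \<in> T"
  shows "fd (\<lambda>x. g (f x)) x = (\<lambda>v. fd g (f x) (fd f x v))"
  by (rule fd_unique[OF has_derivative_compose[OF C1_on_has_derivative[OF assms(1,3)]
        C1_on_has_derivative[OF assms(2,4)]]])

text \<open>The chain rule evaluates the derivative of \<open>g\<close> in a direction that moves
  with \<open>x\<close>, whereas continuity is known for fixed directions only. Expanding the moving
  direction in \<open>Basis\<close> closes the gap, which is why the middle space is
  Euclidean.\<close>

lemma C1_on_compose:
  fixes f :: "'a::real_normed_vector \<Rightarrow> 'b::euclidean_space"
  assumes "C1_on S f" "C1_on T g" "f ` S \<subseteq> T"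
  shows "C1_on S (\<lambda>x. g (f x))"
proof (rule C1_onI)
  fix x assume "x \<in> S"
  then show "((\<lambda>x. g (f x)) has_derivative (\<lambda>v. fd g (f x) (fd f x v))) (at x)"
    using has_derivative_compose[OF C1_on_has_derivative[OF assms(1)] C1_on_has_derivative[OF assms(2)]]
      assms(3) by blast
next
  fix v
  have "fd g (f x) (fd f x v) = (\<Sum>b\<in>Basis. (fd f x v \<bullet> b) *\<^sub>R fd g (f x) b)" if "x \<in> S" for x
  proof -
    have l: "linear (fd g (f x))" using C1_on_linear_fd assms that by blast
    show ?thesis
      by (subst (1) euclidean_representation[symmetric]) (simp add: linear_sum[OF l] linear_cmul[OF l])
  qed
  moreover have "continuous_on S (\<lambda>x. \<Sum>b\<in>Basis. (fd f x v \<bullet> b) *\<^sub>R fd g (f x) b)"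
    by (intro continuous_intros C1_on_continuous_fd[OF assms(1)]
        continuous_on_compose2[OF C1_on_continuous_fd[OF assms(2)]] C1_on_continuous_on[OF assms(1)] assms)
  ultimately show "continuous_on S (\<lambda>x. fd g (f x) (fd f x v))"
    by (simp cong: continuous_on_cong)
qed

lemma C1_on_inverse:
  fixes f :: "'a::real_normed_vector \<Rightarrow> real"
  assumes "C1_on S f" and nz: "\<And>x. x \<in> S \<Longrightarrow> f x \<noteq> 0"
  shows "C1_on S (\<lambda>x. inverse (f x))"
proof (rule C1_onI)
  show "((\<lambda>x. inverse (f x)) has_derivative (\<lambda>v. - (inverse (f x) * fd f x v * inverse (f x)))) (at x)"
    if "x \<in> S" for x
    by (rule Deriv.has_derivative_inverse[OF nz[OF that] C1_on_has_derivative[OF assms(1) that]])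
  show "continuous_on S (\<lambda>x. - (inverse (f x) * fd f x v * inverse (f x)))" for v
    using C1_on_continuous_on[OF assms(1)] C1_on_continuous_fd[OF assms(1)] nz
    by (intro continuous_intros) auto
qed

lemma C1_on_divide:
  fixes f g :: "'a::real_normed_vector \<Rightarrow> real"
  assumes "C1_on S f" "C1_on S g" "\<And>x. x \<in> S \<Longrightarrow> g x \<noteq> 0"
  shows "C1_on S (\<lambda>x. f x / g x)"
  unfolding divide_inverse by (intro C1_on_mult C1_on_inverse assms)

lemma C1_on_sqrt:
  fixes f :: "'a::real_normed_vector \<Rightarrow> real"
  assumes "C1_on S f" "\<And>x. x \<in> S \<Longrightarrow> f x > 0"
  shows "C1_on S (\<lambda>x. sqrt (f x))"
proof -
  have "C1_on {0<..} sqrt"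
    by (rule C1_onI[where f' = "\<lambda>x v. v * (inverse (sqrt x) / 2)"])
      (auto intro!: derivative_eq_intros continuous_intros simp: field_simps)
  then show ?thesis using C1_on_compose[OF assms(1)] assms(2) by (metis greaterThan_iff image_subsetI)
qed

lemma C1_on_vec_nth: "C1_on S f \<Longrightarrow> C1_on S (\<lambda>x. f x $ i)"
  using C1_on_bounded_linear[OF bounded_linear_vec_nth] .

lemma C1_on_inner_right:
  "C1_on S f \<Longrightarrow> C1_on S (\<lambda>x. f x \<bullet> c)"
  using C1_on_bounded_linear[OF bounded_linear_inner_left] .

lemma C1_on_componentwise:
  fixes f :: "'a::real_normed_vector \<Rightarrow> 'b::euclidean_space"
  assumes "\<And>b. b \<in> Basis \<Longrightarrow> C1_on S (\<lambda>x. f x \<bullet> b)"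
  shows "C1_on S f"
proof -
  have "f = (\<lambda>x. \<Sum>b\<in>Basis. (f x \<bullet> b) *\<^sub>R b)" by (simp add: euclidean_representation)
  moreover have "C1_on S (\<lambda>x. \<Sum>b\<in>Basis. (f x \<bullet> b) *\<^sub>R b)"
    by (intro C1_on_sum C1_on_scaleR assms C1_on_const)
  ultimately show ?thesis by simp
qed

lemma C1_on_det:
  fixes M :: "'a::real_normed_vector \<Rightarrow> real ^ 'n ^ 'n::finite"
  assumes "\<And>i j. C1_on S (\<lambda>x. M x $ i $ j)"
  shows "C1_on S (\<lambda>x. det (M x))"
  unfolding det_def by (intro C1_on_sum C1_on_mult C1_on_prod assms C1_on_const)

section \<open>From iterated derivatives and smoothness to class C^1\<close>

lemma Ck_on_imp_continuous_on: "Ck_on k S f \<Longrightarrow> continuous_on S f"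
  by (cases k) (auto intro: differentiable_imp_continuous_on)

lemma Ck_on_Suc_imp: "open S \<Longrightarrow> Ck_on (Suc k) S f \<Longrightarrow> C1_on S f"
  unfolding C1_on_def Ck_on.simps differentiable_on_def
  using at_within_open Ck_on_imp_continuous_on by metis

lemma Ck_on_fd: "Ck_on (Suc k) S f \<Longrightarrow> Ck_on k S (\<lambda>x. fd f x v)"
  by simp

lemma Ck_on_subset: "Ck_on k S f \<Longrightarrow> T \<subseteq> S \<Longrightarrow> Ck_on k T f"
  by (induction k arbitrary: f)
    (auto intro: continuous_on_subset differentiable_on_subset)

text \<open>\<open>Ck_on\<close> combines the derivative within \<open>S\<close> with the derivative
  at a point. On an open set the two agree and depend on the germ only, so the induction on
  \<open>k\<close> may replace \<open>f\<close> by its local model at every level.\<close>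

lemma Ck_on_local:
  assumes "open S" "\<And>x. x \<in> S \<Longrightarrow> \<exists>U g. open U \<and> x \<in> U \<and> Ck_on k U g \<and> (\<forall>y\<in>U. f y = g y)"
  shows "Ck_on k S f"
  using assms(2)
proof (induction k arbitrary: f)
  case 0
  show ?case
    unfolding Ck_on.simps
  proof (rule continuous_at_imp_continuous_on, rule ballI)
    fix x assume "x \<in> S"
    then obtain U g where U: "open U" "x \<in> U" "continuous_on U g" "\<forall>y\<in>U. f y = g y"
      using 0 unfolding Ck_on.simps by metis
    then have "isCont g x" using continuous_on_eq_continuous_at by blast
    moreover have "\<forall>\<^sub>F y in nhds x. g y = f y"
      using U by (auto simp: eventually_nhds)
    ultimately show "isCont f x" using isCont_cong by fastforce
  qed
next
  case (Suc k)
  have *: "f differentiable (at x)" if x: "x \<in> S" for x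
  proof -
    obtain U g where U: "open U" "x \<in> U" "Ck_on (Suc k) U g" "\<forall>y\<in>U. f y = g y"
      using Suc.prems[OF x] by blast
    have "g differentiable_on U" using U(3) by simp
    then have "g differentiable (at x)"
      using U(1,2) at_within_open unfolding differentiable_on_def by metis
    then show ?thesis using differentiable_cong_open[of U x g f] U by auto
  qed
  have "Ck_on k S (\<lambda>x. fd f x v)" for v
  proof (rule Suc.IH)
    fix x assume "x \<in> S"
    then obtain U g where U: "open U" "x \<in> U" "Ck_on (Suc k) U g" "\<forall>y\<in>U. f y = g y"
      using Suc.prems by blast
    have "fd f y v = fd g y v" if "y \<in> U" for y
      using fd_cong_open[OF U(1) that, of f g] U(4) by simp
    moreover have "Ck_on k U (\<lambda>x. fd g x v)" using U(3) by simp
    ultimately show "\<exists>U g. open U \<and> x \<in> U \<and> Ck_on k U g \<and> (\<forall>y\<in>U. fd f y v = g y)"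
      using U(1,2) by (intro exI[of _ U] exI[of _ "\<lambda>y. fd g y v"]) simp
  qed
  moreover have "f differentiable_on S"
    using * by (rule differentiable_at_imp_differentiable_on)
  ultimately show ?case by simp
qed

text \<open>Near a point of the open set \<open>T\<close> the smooth extension coincides with
  \<open>f\<close> in a full neighbourhood, so it is a local model of \<open>f\<close> itself. This
  removes extensions from the picture for t > 0.\<close>

lemma smooth_on_imp_Ck_on:
  assumes "smooth_on S f" "open T" "T \<subseteq> S"
  shows "Ck_on k T f"
proof (rule Ck_on_local[OF assms(2)])
  fix x assume x: "x \<in> T"
  then have "x \<in> S" using assms(3) by auto
  with assms(1) have "\<exists>U F. open U \<and> x \<in> U \<and> (\<forall>k. Ck_on k U F) \<and> (\<forall>y\<in>S \<inter> U. f y = F y)"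
    unfolding smooth_on_def by (rule bspec)
  then obtain U F where U: "open U" "x \<in> U" "Ck_on k U F" "\<forall>y\<in>S \<inter> U. f y = F y"
    by (elim exE conjE) blast
  show "\<exists>U g. open U \<and> x \<in> U \<and> Ck_on k U g \<and> (\<forall>y\<in>U. f y = g y)"
    using Ck_on_subset[OF U(3), of "U \<inter> T"] x U(1,2,4) assms(2,3)
    by (intro exI[of _ "U \<inter> T"] exI[of _ F]) (simp add: open_Int subset_eq)
qed

lemma smooth_on_imp_C1_on: "smooth_on S f \<Longrightarrow> open T \<Longrightarrow> T \<subseteq> S \<Longrightarrow> C1_on T f"
  by (rule Ck_on_Suc_imp[OF _ smooth_on_imp_Ck_on])

lemma smooth_on_imp_C1_on_fd: "smooth_on S f \<Longrightarrow> open T \<Longrightarrow> T \<subseteq> S \<Longrightarrow> C1_on T (\<lambda>x. fd f x v)"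
  by (rule Ck_on_Suc_imp[OF _ Ck_on_fd[OF smooth_on_imp_Ck_on]])

text \<open>Both mixed derivatives are limits of the second difference quotient, by two applications of
  the mean value theorem.\<close>

lemma second_difference_mvt:
  fixes f :: "'a::real_normed_vector \<Rightarrow> real"
  assumes "C1_on S f" "C1_on S (\<lambda>x. fd f x u)" "h > 0"
    and S: "\<And>s t. 0 \<le> s \<Longrightarrow> s \<le> h \<Longrightarrow> 0 \<le> t \<Longrightarrow> t \<le> h \<Longrightarrow> x + s *\<^sub>R u + t *\<^sub>R v \<in> S"
  obtains s t where "0 < s" "s < h" "0 < t" "t < h"
    "f (x + h *\<^sub>R u + h *\<^sub>R v) - f (x + h *\<^sub>R u) - f (x + h *\<^sub>R v) + f x =
     h * h * fd (\<lambda>y. fd f y u) (x + s *\<^sub>R u + t *\<^sub>R v) v"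
proof -
  \<comment> \<open>The increment in direction \<open>v\<close> as a function of the step along
    \<open>u\<close>. The first mean value theorem acts on \<open>F\<close>; the second acts on the
    increment of the \<open>u\<close>-derivative that remains.\<close>
  define F where "F = (\<lambda>s. f (x + s *\<^sub>R u + h *\<^sub>R v) - f (x + s *\<^sub>R u))"
  have d1: "((\<lambda>s. f (x + s *\<^sub>R u + t *\<^sub>R v)) has_real_derivative fd f (x + s *\<^sub>R u + t *\<^sub>R v) u) (at s)"
    if "0 \<le> s" "s \<le> h" "0 \<le> t" "t \<le> h" for s t
  proof -
    have A: "x + s *\<^sub>R u + t *\<^sub>R v \<in> S" using S that by blast
    have L: "linear (fd f (x + s *\<^sub>R u + t *\<^sub>R v))" by (rule C1_on_linear_fd[OF assms(1) A])
    have "((\<lambda>s. f (x + s *\<^sub>R u + t *\<^sub>R v)) has_derivative (\<lambda>r. fd f (x + s *\<^sub>R u + t *\<^sub>R v) (r *\<^sub>R u))) (at s)"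
      by (rule has_derivative_compose[where f = "\<lambda>s. x + s *\<^sub>R u + t *\<^sub>R v",
            OF _ C1_on_has_derivative[OF assms(1) A]])
        (auto intro!: derivative_eq_intros)
    then show ?thesis
      by (simp add: has_field_derivative_def linear_cmul[OF L] mult_commute_abs)
  qed
  have dF: "(F has_real_derivative fd f (x + s *\<^sub>R u + h *\<^sub>R v) u - fd f (x + s *\<^sub>R u) u) (at s)"
    if "0 \<le> s" "s \<le> h" for s
    unfolding F_def using DERIV_diff[OF d1[of s h] d1[of s 0]] that assms(3) by simp
  obtain s where s: "0 < s" "s < h"
    "F h - F 0 = (h - 0) * (fd f (x + s *\<^sub>R u + h *\<^sub>R v) u - fd f (x + s *\<^sub>R u) u)"
    using MVT2[OF assms(3) dF] by blast
  have d2: "((\<lambda>t. fd f (x + s *\<^sub>R u + t *\<^sub>R v) u) has_real_derivative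
      fd (\<lambda>y. fd f y u) (x + s *\<^sub>R u + t *\<^sub>R v) v) (at t)"
    if "0 \<le> t" "t \<le> h" for t
  proof -
    have A: "x + s *\<^sub>R u + t *\<^sub>R v \<in> S" using S that s by simp
    have L: "linear (fd (\<lambda>y. fd f y u) (x + s *\<^sub>R u + t *\<^sub>R v))"
      by (rule C1_on_linear_fd[OF assms(2) A])
    have "((\<lambda>t. fd f (x + s *\<^sub>R u + t *\<^sub>R v) u) has_derivative
        (\<lambda>r. fd (\<lambda>y. fd f y u) (x + s *\<^sub>R u + t *\<^sub>R v) (r *\<^sub>R v))) (at t)"
      by (rule has_derivative_compose[where f = "\<lambda>t. x + s *\<^sub>R u + t *\<^sub>R v", OF _ C1_on_has_derivative[OF assms(2) A]])
        (auto intro!: derivative_eq_intros)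
    then show ?thesis
      by (simp add: has_field_derivative_def linear_cmul[OF L] mult_commute_abs)
  qed
  obtain t where t: "0 < t" "t < h"
    "fd f (x + s *\<^sub>R u + h *\<^sub>R v) u - fd f (x + s *\<^sub>R u + 0 *\<^sub>R v) u =
      (h - 0) * fd (\<lambda>y. fd f y u) (x + s *\<^sub>R u + t *\<^sub>R v) v"
    using MVT2[OF assms(3) d2] by blast
  show ?thesis
    using that[OF s(1,2) t(1,2)] s(3) t(3) by (simp add: F_def algebra_simps)
qed

lemma fd_fd_commute_real:
  fixes f :: "'a::real_normed_vector \<Rightarrow> real"
  assumes "open S" "x \<in> S" "C1_on S f" "\<And>v. C1_on S (\<lambda>x. fd f x v)"
  shows "fd (\<lambda>y. fd f y u) x v = fd (\<lambda>y. fd f y v) x u"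
proof -
  let ?a = "\<lambda>z. fd (\<lambda>y. fd f y u) z v" and ?b = "\<lambda>z. fd (\<lambda>y. fd f y v) z u"
  have ca: "isCont ?a x" and cb: "isCont ?b x"
    using assms C1_on_continuous_fd continuous_on_eq_continuous_at by blast+
  have "\<bar>?a x - ?b x\<bar> \<le> e" if "e > 0" for e
  proof -
    obtain d1 where d1: "d1 > 0" "\<And>z. dist z x < d1 \<Longrightarrow> dist (?a z) (?a x) < e/2"
      using ca \<open>e > 0\<close> unfolding continuous_at_eps_delta by (metis half_gt_zero)
    obtain d2 where d2: "d2 > 0" "\<And>z. dist z x < d2 \<Longrightarrow> dist (?b z) (?b x) < e/2"
      using cb \<open>e > 0\<close> unfolding continuous_at_eps_delta by (metis half_gt_zero)
    obtain d3 where d3: "d3 > 0" "ball x d3 \<subseteq> S" using assms open_contains_ball by blast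
    define d where "d = min d1 (min d2 d3)"
    \<comment> \<open>Small enough that the whole parallelogram spanned by
      \<open>h *\<^sub>R u\<close> and \<open>h *\<^sub>R v\<close> stays within distance
      \<open>d\<close> of \<open>x\<close>; the summand 1 keeps the denominator positive when both
      vectors vanish.\<close>
    define h where "h = d / (2 * (norm u + norm v + 1))"
    have "d > 0" using d1 d2 d3 by (simp add: d_def)
    then have h: "h > 0" unfolding h_def by (simp add: add_nonneg_pos)
    have near: "norm (s *\<^sub>R u + t *\<^sub>R v) < d" if "0 \<le> s" "s \<le> h" "0 \<le> t" "t \<le> h" for s t
    proof -
      have "norm (s *\<^sub>R u + t *\<^sub>R v) \<le> s * norm u + t * norm v"
        using norm_triangle_ineq[of "s *\<^sub>R u" "t *\<^sub>R v"] that by simp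
      also have "\<dots> \<le> h * norm u + h * norm v" using that by (intro add_mono mult_right_mono) auto
      also have "\<dots> \<le> h * (norm u + norm v + 1)" using h by (simp add: algebra_simps)
      also have "\<dots> = d / 2" unfolding h_def by (simp add: add_nonneg_pos add_nonneg_eq_0_iff field_simps)
      finally show ?thesis using \<open>d > 0\<close> by simp
    qed
    have inS: "x + s *\<^sub>R u + t *\<^sub>R v \<in> S" if "0 \<le> s" "s \<le> h" "0 \<le> t" "t \<le> h" for s t
    proof -
      have "dist (x + s *\<^sub>R u + t *\<^sub>R v) x < d3"
        using near[OF that] by (simp add: dist_norm d_def add.assoc)
      then show ?thesis using d3 by (auto simp: dist_commute)
    qed
    have inS': "x + s *\<^sub>R v + t *\<^sub>R u \<in> S" if "0 \<le> s" "s \<le> h" "0 \<le> t" "t \<le> h" for s t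
      using inS[of t s] that by (simp add: algebra_simps)
    obtain s t where st: "0 < s" "s < h" "0 < t" "t < h"
      "f (x + h *\<^sub>R u + h *\<^sub>R v) - f (x + h *\<^sub>R u) - f (x + h *\<^sub>R v) + f x = h * h * ?a (x + s *\<^sub>R u + t *\<^sub>R v)"
      by (rule second_difference_mvt[of S f u h x v, OF assms(3,4) h inS])
    obtain s' t' where st': "0 < s'" "s' < h" "0 < t'" "t' < h"
      "f (x + h *\<^sub>R v + h *\<^sub>R u) - f (x + h *\<^sub>R v) - f (x + h *\<^sub>R u) + f x = h * h * ?b (x + s' *\<^sub>R v + t' *\<^sub>R u)"
      by (rule second_difference_mvt[of S f v h x u, OF assms(3,4) h inS'])
    have e: "x + h *\<^sub>R v + h *\<^sub>R u = x + h *\<^sub>R u + h *\<^sub>R v" by simp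
    have "h * h * ?a (x + s *\<^sub>R u + t *\<^sub>R v) = h * h * ?b (x + s' *\<^sub>R v + t' *\<^sub>R u)"
      using st(5) st'(5)[unfolded e] by linarith
    then have eq: "?a (x + s *\<^sub>R u + t *\<^sub>R v) = ?b (x + s' *\<^sub>R v + t' *\<^sub>R u)" using h by simp
    have "dist (x + s *\<^sub>R u + t *\<^sub>R v) x < d1" "dist (x + s' *\<^sub>R v + t' *\<^sub>R u) x < d2"
      using near[of s t] near[of t' s'] st st'
      by (auto simp: dist_norm d_def add.assoc add.commute[of "t' *\<^sub>R u"])
    then have "dist (?a (x + s *\<^sub>R u + t *\<^sub>R v)) (?a x) < e/2"
      "dist (?b (x + s' *\<^sub>R v + t' *\<^sub>R u)) (?b x) < e/2" using d1 d2 by blast+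
    then show ?thesis unfolding eq dist_real_def by linarith
  qed
  then have "\<bar>?a x - ?b x\<bar> \<le> 0" by (rule field_le_epsilon) simp
  then show ?thesis by simp
qed

lemma fd_fd_commute:
  fixes f :: "'a::real_normed_vector \<Rightarrow> 'b::euclidean_space"
  assumes "open S" "x \<in> S" "C1_on S f" "\<And>v. C1_on S (\<lambda>x. fd f x v)"
  shows "fd (\<lambda>y. fd f y u) x v = fd (\<lambda>y. fd f y v) x u"
proof (rule euclidean_eqI)
  fix b :: 'b assume "b \<in> Basis"
  have i: "fd (\<lambda>x. g x \<bullet> b) y v = fd g y v \<bullet> b" if "C1_on S g" "y \<in> S" for g :: "'a \<Rightarrow> 'b" and y v
    using fd_unique[OF has_derivative_inner_left[OF C1_on_has_derivative[OF that]]] by simp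
  have ii: "fd (\<lambda>y. fd (\<lambda>x. f x \<bullet> b) y v) x u = fd (\<lambda>y. fd f y v) x u \<bullet> b" for u v
    using fd_cong_open[OF assms(1,2), of "\<lambda>y. fd (\<lambda>x. f x \<bullet> b) y v" "\<lambda>y. fd f y v \<bullet> b"] i assms by simp
  have "C1_on S (\<lambda>y. fd (\<lambda>x. f x \<bullet> b) y v)" for v
    by (rule C1_on_cong[OF assms(1)]) (use i[OF assms(3)] C1_on_inner_right[OF assms(4)] in auto)
  then have "fd (\<lambda>y. fd (\<lambda>x. f x \<bullet> b) y u) x v = fd (\<lambda>y. fd (\<lambda>x. f x \<bullet> b) y v) x u"
    using fd_fd_commute_real[OF assms(1,2) C1_on_inner_right[OF assms(3)]] by blast
  then show "fd (\<lambda>y. fd f y u) x v \<bullet> b = fd (\<lambda>y. fd f y v) x u \<bullet> b" by (simp add: ii)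
qed

section \<open>Inner products and traces\<close>

definition gram :: "(real ^ 'm \<Rightarrow> real ^ 'm \<Rightarrow> real) \<Rightarrow> real ^ 'm ^ 'm::finite" where
  "gram G = (\<chi> i j. G (axis i 1) (axis j 1))"

definition orthonormal :: "(real ^ 'm \<Rightarrow> real ^ 'm \<Rightarrow> real) \<Rightarrow> ('m::finite \<Rightarrow> real ^ 'm) \<Rightarrow> bool" where
  "orthonormal G e \<longleftrightarrow> (\<forall>i j. G (e i) (e j) = (if i = j then 1 else 0))"

lemma inner_product_sym: "inner_product G \<Longrightarrow> G u v = G v u"
  by (simp add: inner_product_def)

lemma inner_product_linear: "inner_product G \<Longrightarrow> linear (G u)"
  by (simp add: inner_product_def)

lemma inner_product_bilinear: "inner_product G \<Longrightarrow> bilinear G"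
proof -
  assume G: "inner_product G"
  then have "(\<lambda>u. G u v) = G v" for v using inner_product_sym[OF G] by (intro ext) metis
  then show ?thesis using G by (simp add: inner_product_def bilinear_def)
qed

lemma inner_product_pos: "inner_product G \<Longrightarrow> u \<noteq> 0 \<Longrightarrow> G u u > 0"
  by (simp add: inner_product_def)

lemma inner_product_eqI:
  assumes "inner_product G" "\<And>w. G u w = G v w"
  shows "u = v"
proof -
  have "G (u - v) (u - v) = 0"
    using assms(2)[of "u - v"] bilinear_lsub[OF inner_product_bilinear[OF assms(1)], of u v "u - v"] by simp
  then show ?thesis using inner_product_pos[OF assms(1), of "u - v"] by force
qed

lemma linear_sum_scaleR:
  assumes "linear L" shows "L (\<Sum>i\<in>I. c i *\<^sub>R x i) = (\<Sum>i\<in>I. c i *\<^sub>R L (x i))"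
  by (simp add: linear_sum[OF assms] linear_cmul[OF assms])

lemma linear_axis:
  fixes L :: "real ^ 'm::finite \<Rightarrow> 'b::real_vector"
  assumes "linear L" shows "L u = (\<Sum>a\<in>UNIV. u $ a *\<^sub>R L (axis a 1))"
proof -
  have "u = (\<Sum>a\<in>UNIV. u $ a *\<^sub>R axis a 1)"
    using basis_expansion[of u] by (simp add: scalar_mult_eq_scaleR)
  then show ?thesis using linear_sum_scaleR[OF assms] by metis
qed

lemma bilinear_axis:
  fixes F :: "real ^ 'm::finite \<Rightarrow> real ^ 'k::finite \<Rightarrow> 'b::real_vector"
  assumes "bilinear F"
  shows "F u v = (\<Sum>a\<in>UNIV. \<Sum>b\<in>UNIV. (u $ a * v $ b) *\<^sub>R F (axis a 1) (axis b 1))"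
proof -
  have l: "linear (\<lambda>u. F u v)" and r: "linear (F w)" for w
    using assms by (auto simp: bilinear_def)
  have "F u v = (\<Sum>a\<in>UNIV. u $ a *\<^sub>R F (axis a 1) v)" by (rule linear_axis[OF l])
  also have "\<dots> = (\<Sum>a\<in>UNIV. u $ a *\<^sub>R (\<Sum>b\<in>UNIV. v $ b *\<^sub>R F (axis a 1) (axis b 1)))"
    by (subst linear_axis[OF r]) simp
  finally show ?thesis by (simp add: scaleR_sum_right)
qed

text \<open>Gram-Schmidt, adding one index at a time. The induction runs over subsets of the index
  type so that the family ends up indexed by coordinates, as \<open>metric_trace\<close>
  expects.\<close>

lemma orthonormal_exists:
  fixes G :: "real ^ 'm::finite \<Rightarrow> real ^ 'm \<Rightarrow> real"
  assumes G: "inner_product G"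
  shows "\<exists>e. orthonormal G e"
proof -
  have bl: "bilinear G" by (rule inner_product_bilinear[OF G])
  have "\<exists>e :: 'm \<Rightarrow> real ^ 'm. \<forall>i\<in>S. \<forall>j\<in>S. G (e i) (e j) = (if i = j then 1 else 0)" for S :: "'m set"
  proof (induction S rule: finite_induct[OF finite])
    case 1
    show ?case by simp
  next
    case (2 k S)
    obtain e :: "'m \<Rightarrow> real ^ 'm" where e: "\<forall>i\<in>S. \<forall>j\<in>S. G (e i) (e j) = (if i = j then 1 else 0)"
      using 2 by blast
    \<comment> \<open>Fewer vectors than the dimension cannot span, so some \<open>v\<close> lies
      outside and its component orthogonal to the span is nonzero.\<close>
    have "dim (e ` S) \<le> card S"
      using dim_le_card'[of "e ` S"] card_image_le[of S e] by simp
    also have "card S < CARD('m)"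
      using 2 by (intro psubset_card_mono) auto
    finally have "dim (e ` S) < dim (UNIV :: (real ^ 'm) set)" by (simp add: dim_UNIV)
    then have "span (e ` S) \<noteq> UNIV"
      by (metis dim_span less_irrefl)
    then obtain v where v: "v \<notin> span (e ` S)" by blast
    define w where "w = v - (\<Sum>i\<in>S. G v (e i) *\<^sub>R e i)"
    have "(\<Sum>i\<in>S. G v (e i) *\<^sub>R e i) \<in> span (e ` S)"
      by (intro span_sum span_scale span_base) auto
    then have "w \<noteq> 0" using v by (auto simp: w_def)
    then have pos: "G w w > 0" using inner_product_pos[OF G] by blast
    have orth: "G w (e j) = 0" if "j \<in> S" for j
    proof -
      have "G w (e j) = G v (e j) - (\<Sum>i\<in>S. G v (e i) * G (e i) (e j))"
        unfolding w_def using bl linear_sum_scaleR[of "\<lambda>u. G u (e j)" "\<lambda>i. G v (e i)" e S]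
        by (simp add: bilinear_lsub bilinear_def)
      also have "(\<Sum>i\<in>S. G v (e i) * G (e i) (e j)) = (\<Sum>i\<in>S. if i = j then G v (e j) else 0)"
        using e that by (intro sum.cong) auto
      finally show ?thesis using that by simp
    qed
    define e' where "e' = e(k := (1 / sqrt (G w w)) *\<^sub>R w)"
    have "G (e' i) (e' j) = (if i = j then 1 else 0)" if ij: "i \<in> insert k S" "j \<in> insert k S" for i j
    proof -
      have kk: "G (e' k) (e' k) = 1"
        using pos by (simp add: e'_def bilinear_lmul[OF bl] bilinear_rmul[OF bl] real_sqrt_mult[symmetric])
      have kj: "G (e' k) (e' j) = 0" if "j \<in> S" for j
        using orth[OF that] that 2(2) by (auto simp: e'_def bilinear_lmul[OF bl])
      have jk: "G (e' j) (e' k) = 0" if "j \<in> S" for j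
        using kj[OF that] inner_product_sym[OF G] by metis
      have ij': "G (e' i) (e' j) = (if i = j then 1 else 0)" if "i \<in> S" "j \<in> S" for i j
        using e that 2(2) by (auto simp: e'_def)
      show ?thesis using ij kk kj jk ij' 2(2) by (cases "i = k"; cases "j = k") auto
    qed
    then show ?case by blast
  qed
  from this[of UNIV] show ?thesis unfolding orthonormal_def by auto
qed

text \<open>The vectors are the columns of \<open>E\<close>. Positivity of the determinant and the
  formula for the inverse Gram matrix are both read off this matrix equation.\<close>

lemma orthonormal_matrix:
  assumes G: "inner_product G" and e: "orthonormal G e"
  defines "E \<equiv> (\<chi> a i. e i $ a)"
  shows "transpose E ** gram G ** E = mat 1"
proof -
  have "(transpose E ** gram G ** E) $ i $ j = G (e i) (e j)" for i j
  proof -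
    have "(transpose E ** gram G ** E) $ i $ j =
        (\<Sum>b\<in>UNIV. (\<Sum>a\<in>UNIV. e i $ a * G (axis a 1) (axis b 1)) * e j $ b)"
      by (simp add: matrix_matrix_mult_def transpose_def E_def gram_def)
    also have "\<dots> = (\<Sum>b\<in>UNIV. \<Sum>a\<in>UNIV. (e i $ a * e j $ b) *\<^sub>R G (axis a 1) (axis b 1))"
      by (simp add: sum_distrib_left sum_distrib_right mult_ac)
    also have "\<dots> = G (e i) (e j)"
      by (subst sum.swap) (rule bilinear_axis[OF inner_product_bilinear[OF G], symmetric])
    finally show ?thesis .
  qed
  then show ?thesis using e by (simp add: vec_eq_iff mat_def orthonormal_def)
qed

text \<open>For \<open>E\<close> built from an orthonormal basis, taking determinants gives det(E)^2
  det(gram G) = 1.\<close>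

lemma det_gram_pos:
  assumes G: "inner_product G"
  shows "det (gram G) > 0"
proof -
  obtain e where e: "orthonormal G e" using orthonormal_exists[OF G] by blast
  define E where "E = (\<chi> a i. e i $ a)"
  have "det (transpose E ** gram G ** E) = 1"
    using orthonormal_matrix[OF G e] unfolding E_def[symmetric] by (simp add: det_I)
  then have "det E * det E * det (gram G) = 1" by (simp add: det_mul det_transpose mult_ac)
  then show ?thesis by (smt (verit) mult_nonneg_nonpos zero_le_square)
qed

lemma matrix_inv_left: "invertible A \<Longrightarrow> matrix_inv A ** A = mat 1"
  unfolding matrix_inv_def invertible_def by (rule someI2_ex) auto

text \<open>For square matrices a one-sided inverse is two-sided, so E^T (gram G) E = 1 forces E E^T
  to be the inverse of the Gram matrix.\<close>

lemma orthonormal_sum: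
  assumes G: "inner_product G" and e: "orthonormal G e"
  shows "(\<Sum>i\<in>UNIV. e i $ a * e i $ b) = matrix_inv (gram G) $ a $ b"
proof -
  define E where "E = (\<chi> a i. e i $ a)"
  have "(transpose E ** gram G) ** E = mat 1"
    using orthonormal_matrix[OF G e] unfolding E_def[symmetric] .
  then have "E ** (transpose E ** gram G) = mat 1"
    using matrix_left_right_inverse by blast
  then have 1: "(E ** transpose E) ** gram G = mat 1" by (simp add: matrix_mul_assoc)
  then have 2: "gram G ** (E ** transpose E) = mat 1" using matrix_left_right_inverse by blast
  have "invertible (gram G)" using 1 2 unfolding invertible_def by blast
  then have "matrix_inv (gram G) ** gram G = mat 1" by (rule matrix_inv_left)
  then have "matrix_inv (gram G) = E ** transpose E"
    using 2 by (metis matrix_mul_assoc matrix_mul_lid matrix_mul_rid)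
  then show ?thesis by (simp add: matrix_matrix_mult_def transpose_def E_def)
qed

text \<open>The right-hand side does not mention \<open>e\<close>. This is the basis independence
  behind the SOME in \<open>metric_trace\<close>, and at the same time the coordinate formula g^{ab}
  F_{ab}.\<close>

lemma orthonormal_trace_eq:
  fixes F :: "real ^ 'm::finite \<Rightarrow> real ^ 'm \<Rightarrow> 'b::real_vector"
  assumes G: "inner_product G" and e: "orthonormal G e" and F: "bilinear F"
  shows "(\<Sum>i\<in>UNIV. F (e i) (e i)) = (\<Sum>a\<in>UNIV. \<Sum>b\<in>UNIV. matrix_inv (gram G) $ a $ b *\<^sub>R F (axis a 1) (axis b 1))"
proof -
  have "(\<Sum>i\<in>UNIV. F (e i) (e i)) =
      (\<Sum>i\<in>UNIV. \<Sum>a\<in>UNIV. \<Sum>b\<in>UNIV. (e i $ a * e i $ b) *\<^sub>R F (axis a 1) (axis b 1))"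
    by (intro sum.cong refl bilinear_axis[OF F])
  also have "\<dots> = (\<Sum>a\<in>UNIV. \<Sum>b\<in>UNIV. \<Sum>i\<in>UNIV. (e i $ a * e i $ b) *\<^sub>R F (axis a 1) (axis b 1))"
    by (subst sum.swap) (rule sum.cong[OF refl], rule sum.swap)
  also have "\<dots> = (\<Sum>a\<in>UNIV. \<Sum>b\<in>UNIV. matrix_inv (gram G) $ a $ b *\<^sub>R F (axis a 1) (axis b 1))"
    by (simp add: scaleR_sum_left[symmetric] orthonormal_sum[OF G e])
  finally show ?thesis .
qed

text \<open>A name for the basis that \<open>metric_trace\<close> selects, so that a trace can be
  unfolded into a sum without knowing that its argument is bilinear.\<close>

definition onb :: "(real ^ 'm \<Rightarrow> real ^ 'm \<Rightarrow> real) \<Rightarrow> 'm::finite \<Rightarrow> real ^ 'm" where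
  "onb G = (SOME e. \<forall>i j. G (e i) (e j) = (if i = j then 1 else 0))"

lemma metric_trace_onb: "metric_trace G F = (\<Sum>i\<in>UNIV. F (onb G i) (onb G i))"
  unfolding metric_trace_def onb_def Let_def ..

lemma orthonormal_onb:
  assumes G: "inner_product G" shows "orthonormal G (onb G)"
  using someI_ex[OF orthonormal_exists[OF G, unfolded orthonormal_def]]
  unfolding orthonormal_def onb_def .

lemma metric_trace_coords:
  fixes F :: "real ^ 'm::finite \<Rightarrow> real ^ 'm \<Rightarrow> 'b::real_vector"
  assumes G: "inner_product G" and F: "bilinear F"
  shows "metric_trace G F = (\<Sum>a\<in>UNIV. \<Sum>b\<in>UNIV. matrix_inv (gram G) $ a $ b *\<^sub>R F (axis a 1) (axis b 1))"
  unfolding metric_trace_onb by (rule orthonormal_trace_eq[OF G orthonormal_onb[OF G] F])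

lemma metric_trace_orthonormal:
  fixes F :: "real ^ 'm::finite \<Rightarrow> real ^ 'm \<Rightarrow> 'b::real_vector"
  assumes "inner_product G" "orthonormal G e" "bilinear F"
  shows "metric_trace G F = (\<Sum>i\<in>UNIV. F (e i) (e i))"
  using metric_trace_coords[OF assms(1,3)] orthonormal_trace_eq[OF assms] by simp

lemma inner_product_pullback:
  fixes G :: "real ^ 'm::finite \<Rightarrow> real ^ 'm \<Rightarrow> real" and L :: "real ^ 'm \<Rightarrow> real ^ 'm"
  assumes G: "inner_product G" and L: "linear L" "inj L"
  shows "inner_product (\<lambda>u v. G (L u) (L v))"
  unfolding inner_product_def
proof (intro conjI allI impI)
  show "linear (\<lambda>v. G (L u) (L v))" for u
    using linear_compose[OF L(1) inner_product_linear[OF G, of "L u"]] by (simp add: o_def)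
  show "G (L u) (L v) = G (L v) (L u)" for u v by (rule inner_product_sym[OF G])
  fix u assume "u \<noteq> (0 :: real ^ 'm)"
  then have "L u \<noteq> 0" using L by (metis injD linear_0)
  then show "G (L u) (L u) > 0" by (rule inner_product_pos[OF G])
qed

lemma bilinear_pullback: "bilinear F \<Longrightarrow> linear L \<Longrightarrow> linear K \<Longrightarrow> bilinear (\<lambda>u v. F (L u) (K v))"
  unfolding bilinear_def
  using linear_compose[of K "F _"] linear_compose[of L "\<lambda>x. F x _"] by (auto simp: o_def)

text \<open>\<open>L\<close> carries an orthonormal basis of the pulled back product to an
  orthonormal basis of \<open>G\<close>.\<close>

lemma metric_trace_pullback:
  fixes F :: "real ^ 'm::finite \<Rightarrow> real ^ 'm \<Rightarrow> 'b::real_vector" and L :: "real ^ 'm \<Rightarrow> real ^ 'm"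
  assumes G: "inner_product G" and L: "linear L" "inj L" and F: "bilinear F"
  shows "metric_trace (\<lambda>u v. G (L u) (L v)) (\<lambda>u v. F (L u) (L v)) = metric_trace G F"
proof -
  have G': "inner_product (\<lambda>u v. G (L u) (L v))" by (rule inner_product_pullback[OF G L])
  obtain e where e: "orthonormal (\<lambda>u v. G (L u) (L v)) e" using orthonormal_exists[OF G'] by blast
  then have "orthonormal G (\<lambda>i. L (e i))" by (simp add: orthonormal_def)
  then show ?thesis
    using metric_trace_orthonormal[OF G' e bilinear_pullback[OF F L(1) L(1)]] metric_trace_orthonormal[OF G _ F]
    by simp
qed

lemma gram_pullback:
  fixes L :: "real ^ 'm::finite \<Rightarrow> real ^ 'm"
  assumes G: "inner_product G" and L: "linear L"
  shows "gram (\<lambda>u v. G (L u) (L v)) = transpose (matrix L) ** gram G ** matrix L"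
proof -
  have "G (L (axis i 1)) (L (axis j 1)) = (transpose (matrix L) ** gram G ** matrix L) $ i $ j" for i j
  proof -
    have "G (L (axis i 1)) (L (axis j 1)) =
      (\<Sum>b\<in>UNIV. \<Sum>a\<in>UNIV. (L (axis i 1) $ a * L (axis j 1) $ b) *\<^sub>R G (axis a 1) (axis b 1))"
      by (subst sum.swap) (rule bilinear_axis[OF inner_product_bilinear[OF G]])
    also have "\<dots> = (transpose (matrix L) ** gram G ** matrix L) $ i $ j"
      by (simp add: matrix_matrix_mult_def transpose_def matrix_def gram_def sum_distrib_left sum_distrib_right mult_ac)
    finally show ?thesis .
  qed
  then show ?thesis by (simp add: vec_eq_iff gram_def)
qed

text \<open>This is the transformation law of the Riemannian density: the factor is the one that
  appears in the change of variables formula.\<close>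

lemma sqrt_det_gram_pullback:
  fixes L :: "real ^ 'm::finite \<Rightarrow> real ^ 'm"
  assumes G: "inner_product G" and L: "linear L"
  shows "sqrt (det (gram (\<lambda>u v. G (L u) (L v)))) = \<bar>det (matrix L)\<bar> * sqrt (det (gram G))"
proof -
  have "det (gram (\<lambda>u v. G (L u) (L v))) = (det (matrix L))\<^sup>2 * det (gram G)"
    by (simp add: gram_pullback[OF assms] det_mul det_transpose power2_eq_square)
  then show ?thesis by (simp add: real_sqrt_mult)
qed

text \<open>The Riesz representative of \<open>K\<close>, given by Cramer's rule so that its regularity is apparent.\<close>

definition sharp :: "(real ^ 'm \<Rightarrow> real ^ 'm \<Rightarrow> real) \<Rightarrow> (real ^ 'm \<Rightarrow> real) \<Rightarrow> real ^ 'm::finite" where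
  "sharp G K = (\<chi> k. det (\<chi> i j. if j = k then K (axis i 1) else gram G $ i $ j) / det (gram G))"

lemma sharp:
  assumes G: "inner_product G" and K: "linear K"
  shows "G (sharp G K) w = K w"
proof -
  have d: "det (gram G) \<noteq> 0" using det_gram_pos[OF G] by simp
  have "gram G *v sharp G K = (\<chi> i. K (axis i 1))"
    unfolding cramer[OF d] by (simp add: sharp_def cong: if_cong)
  then have *: "(\<Sum>j\<in>UNIV. G (axis i 1) (axis j 1) * sharp G K $ j) = K (axis i 1)" for i
    by (simp add: vec_eq_iff matrix_vector_mult_def gram_def)
  have "G (axis i 1) (sharp G K) = K (axis i 1)" for i
    using linear_axis[OF inner_product_linear[OF G], of "axis i 1" "sharp G K"] *[of i] by (simp add: mult.commute)
  then have "G w (sharp G K) = K w"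
    using linear_axis[OF K, of w] linear_axis[of "\<lambda>w. G w (sharp G K)" w] inner_product_bilinear[OF G]
    by (simp add: bilinear_def)
  then show ?thesis using inner_product_sym[OF G] by metis
qed

lemma gram_mult_sharp:
  assumes G: "inner_product G" and K: "linear K"
  shows "gram G *v sharp G K = (\<chi> i. K (axis i 1))"
proof -
  have "(\<Sum>j\<in>UNIV. gram G $ i $ j * sharp G K $ j) = G (axis i 1) (sharp G K)" for i
    by (subst linear_axis[OF inner_product_linear[OF G]]) (simp add: gram_def mult.commute)
  then show ?thesis
    using sharp[OF G K] inner_product_sym[OF G] by (simp add: vec_eq_iff matrix_vector_mult_def)
qed

text \<open>The columns of the inverse Gram matrix are the Riesz representatives of the coordinate
  functionals, so regularity of the inverse metric is inherited from \<open>sharp\<close>.\<close>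

lemma matrix_inv_gram_sharp:
  assumes G: "inner_product G"
  shows "matrix_inv (gram G) $ a $ b = sharp G (\<lambda>w. w $ b) $ a"
proof -
  have inv: "invertible (gram G)" using det_gram_pos[OF G] by (simp add: invertible_det_nz)
  have "linear (\<lambda>w :: real ^ 'a. w $ b)" by (rule bounded_linear.linear[OF bounded_linear_vec_nth])
  from gram_mult_sharp[OF G this]
  have "matrix_inv (gram G) *v (gram G *v sharp G (\<lambda>w. w $ b)) = matrix_inv (gram G) *v (\<chi> i. axis i 1 $ b)"
    by simp
  then have "sharp G (\<lambda>w. w $ b) = matrix_inv (gram G) *v (\<chi> i. axis i 1 $ b)"
    by (simp add: matrix_vector_mul_assoc matrix_inv_left[OF inv])
  then have "sharp G (\<lambda>w. w $ b) $ a = (\<Sum>i\<in>UNIV. matrix_inv (gram G) $ a $ i * axis i 1 $ b)"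
    by (simp add: matrix_vector_mult_def)
  also have "\<dots> = (\<Sum>i\<in>UNIV. if i = b then matrix_inv (gram G) $ a $ b else 0)"
    by (intro sum.cong) (auto simp: axis_def)
  finally show ?thesis by simp
qed

text \<open>The trace over \<open>e\<close> is contracted with the inverse Gram matrix, which meets
  the Gram matrix and leaves a Kronecker delta. It turns the coordinate sum \<Sum> \<partial>_a Z^a
  into a sum over an orthonormal basis.\<close>

lemma trace_eq_orthonormal:
  fixes L :: "real ^ 'm::finite \<Rightarrow> real ^ 'm"
  assumes G: "inner_product G" and e: "orthonormal G e" and L: "linear L"
  shows "(\<Sum>a\<in>UNIV. L (axis a 1) $ a) = (\<Sum>i\<in>UNIV. G (L (e i)) (e i))"
proof -
  have inv: "invertible (gram G)" using det_gram_pos[OF G] by (simp add: invertible_det_nz)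
  have bl: "bilinear (\<lambda>u v. G (L u) v)"
    using bilinear_pullback[OF inner_product_bilinear[OF G] L linear_id] by simp
  have inv1: "(\<Sum>b\<in>UNIV. matrix_inv (gram G) $ a $ b * gram G $ b $ c) = (if a = c then 1 else 0)" for a c
    using matrix_inv_left[OF inv] by (simp add: vec_eq_iff matrix_matrix_mult_def mat_def)
  have "(\<Sum>i\<in>UNIV. G (L (e i)) (e i)) =
      (\<Sum>a\<in>UNIV. \<Sum>b\<in>UNIV. matrix_inv (gram G) $ a $ b * G (L (axis a 1)) (axis b 1))"
    using orthonormal_trace_eq[OF G e bl] by simp
  also have "\<dots> = (\<Sum>a\<in>UNIV. \<Sum>b\<in>UNIV. matrix_inv (gram G) $ a $ b *
      (\<Sum>c\<in>UNIV. L (axis a 1) $ c * gram G $ b $ c))"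
  proof (intro sum.cong refl)
    fix a b
    have "G (L (axis a 1)) (axis b 1) = G (axis b 1) (L (axis a 1))" by (rule inner_product_sym[OF G])
    also have "\<dots> = (\<Sum>c\<in>UNIV. L (axis a 1) $ c * gram G $ b $ c)"
      by (subst linear_axis[OF inner_product_linear[OF G]]) (simp add: gram_def)
    finally show "matrix_inv (gram G) $ a $ b * G (L (axis a 1)) (axis b 1) =
       matrix_inv (gram G) $ a $ b * (\<Sum>c\<in>UNIV. L (axis a 1) $ c * gram G $ b $ c)" by simp
  qed
  also have "\<dots> = (\<Sum>a\<in>UNIV. \<Sum>c\<in>UNIV. L (axis a 1) $ c * (\<Sum>b\<in>UNIV. matrix_inv (gram G) $ a $ b * gram G $ b $ c))"
    by (simp add: sum_distrib_left mult_ac) (intro sum.cong refl sum.swap)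
  also have "\<dots> = (\<Sum>a\<in>UNIV. L (axis a 1) $ a)" by (simp add: inv1 if_distrib cong: if_cong)
  finally show ?thesis by simp
qed

text \<open>In the expansion of the determinant, the derivative of one factor at the identity matrix leaves
  only the identity permutation.\<close>

lemma det_has_derivative_identity:
  fixes M :: "'a::real_normed_vector \<Rightarrow> real ^ 'n ^ 'n::finite"
  assumes M: "\<And>i j. ((\<lambda>x. M x $ i $ j) has_derivative M' i j) (at x)" and "M x = mat 1"
  shows "((\<lambda>x. det (M x)) has_derivative (\<lambda>v. \<Sum>i\<in>UNIV. M' i i v)) (at x)"
proof -
  let ?P = "{p. p permutes (UNIV :: 'n set)}"
  have "((\<lambda>x. \<Prod>i\<in>UNIV. M x $ i $ p i) has_derivative
      (\<lambda>v. \<Sum>i\<in>UNIV. M' i (p i) v * (\<Prod>j\<in>UNIV - {i}. M x $ j $ p j))) (at x)" for p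
    by (rule has_derivative_prod) (rule M)
  then have *: "((\<lambda>x. det (M x)) has_derivative
      (\<lambda>v. \<Sum>p\<in>?P. of_int (sign p) * (\<Sum>i\<in>UNIV. M' i (p i) v * (\<Prod>j\<in>UNIV - {i}. M x $ j $ p j)))) (at x)"
    unfolding det_def by (intro has_derivative_sum has_derivative_mult_right)
  have zero: "(\<Prod>j\<in>UNIV - {i}. M x $ j $ p j) = 0" if p: "p permutes UNIV" "p \<noteq> id" for p i
  proof -
    \<comment> \<open>A permutation other than the identity moves at least two points, so even after
      the factor \<open>i\<close> is removed an off-diagonal entry of the identity matrix
      remains.\<close>
    have "\<exists>j. j \<noteq> i \<and> p j \<noteq> j"
    proof (rule ccontr)
      assume "\<not> ?thesis"
      then have j: "p j = j" if "j \<noteq> i" for j using that by blast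
      have "p i = i" using permutes_inj[OF p(1)] j by (metis injD)
      then show False using j p(2) by (metis eq_id_iff)
    qed
    then obtain j where "j \<noteq> i" "p j \<noteq> j" by blast
    then show ?thesis by (intro prod_zero) (auto simp: assms(2) mat_def intro!: bexI[of _ j])
  qed
  have one: "(\<Prod>j\<in>UNIV - {i}. M x $ j $ id j) = 1" for i
    by (intro prod.neutral) (auto simp: assms(2) mat_def)
  have "(\<Sum>p\<in>?P. of_int (sign p) * (\<Sum>i\<in>UNIV. M' i (p i) v * (\<Prod>j\<in>UNIV - {i}. M x $ j $ p j))) =
      (\<Sum>p\<in>?P. if p = id then (\<Sum>i\<in>UNIV. M' i i v) else 0)" for v
  proof (rule sum.cong[OF refl])
    fix p assume "p \<in> ?P"
    then have "(\<Sum>i\<in>UNIV. M' i (p i) v * (\<Prod>j\<in>UNIV - {i}. M x $ j $ p j)) = 0" if "p \<noteq> id"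
      by (intro sum.neutral ballI) (simp only: zero[OF _ that] mem_Collect_eq mult_zero_right)
    then show "of_int (sign p) * (\<Sum>i\<in>UNIV. M' i (p i) v * (\<Prod>j\<in>UNIV - {i}. M x $ j $ p j)) =
        (if p = id then (\<Sum>i\<in>UNIV. M' i i v) else 0)"
      using one by (cases "p = id") (simp_all add: sign_id)
  qed
  also have "(\<Sum>p\<in>?P. if p = id then (\<Sum>i\<in>UNIV. M' i i v) else 0) = (\<Sum>i\<in>UNIV. M' i i v)" for v
    by (simp add: sum.delta[OF finite_permutations[OF finite]] permutes_id)
  finally show ?thesis using * by simp
qed

section \<open>Local Riemannian calculus\<close>

text \<open>The Koszul formula differentiates the coefficients once, hence class C^1. Regularity is
  stated for fixed arguments; \<open>C1_metric_comp\<close> passes to varying ones.\<close>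

definition C1_metric :: "(real ^ 'n) set \<Rightarrow> (real ^ 'n \<Rightarrow> real ^ 'n \<Rightarrow> real ^ 'n \<Rightarrow> real) \<Rightarrow> bool" where
  "C1_metric V G \<longleftrightarrow> open V \<and> (\<forall>x\<in>V. inner_product (G x)) \<and> (\<forall>u v. C1_on V (\<lambda>x. G x u v))"

definition C1_form :: "(real ^ 'n) set \<Rightarrow> (real ^ 'n \<Rightarrow> real ^ 'n \<Rightarrow> real) \<Rightarrow> bool" where
  "C1_form V \<omega> \<longleftrightarrow> open V \<and> (\<forall>x\<in>V. linear (\<omega> x)) \<and> (\<forall>v. C1_on V (\<lambda>x. \<omega> x v))"

lemma C1_metricD:
  assumes "C1_metric V G"
  shows "open V" "x \<in> V \<Longrightarrow> inner_product (G x)" "C1_on V (\<lambda>x. G x u v)"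
    "x \<in> V \<Longrightarrow> bilinear (G x)" "x \<in> V \<Longrightarrow> G x u v = G x v u"
  using assms inner_product_sym[of "G x" u v] unfolding C1_metric_def
  by (simp_all add: inner_product_bilinear)

lemma C1_formD:
  assumes "C1_form V \<omega>"
  shows "open V" "x \<in> V \<Longrightarrow> linear (\<omega> x)" "C1_on V (\<lambda>x. \<omega> x v)"
  using assms unfolding C1_form_def by simp_all

text \<open>Leibniz rule along a map, with the base point and both arguments varying. Only
  coefficients at fixed arguments are known to be C^1, so the expression is expanded over pairs of
  basis vectors and reassembled after differentiating. The map \<open>\<phi>\<close> will be a
  transition map as well as the flow in space-time coordinates.\<close>

lemma C1_metric_comp:
  fixes \<phi> :: "'a::real_normed_vector \<Rightarrow> real ^ 'n::finite" and a b :: "'a \<Rightarrow> real ^ 'n"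
  assumes G: "C1_metric V G" and S: "open S" and \<phi>: "C1_on S \<phi>" "\<phi> ` S \<subseteq> V" and a: "C1_on S a" and b: "C1_on S b"
  shows "C1_on S (\<lambda>z. G (\<phi> z) (a z) (b z))"
    and "z \<in> S \<Longrightarrow> fd (\<lambda>z. G (\<phi> z) (a z) (b z)) z w =
      fd (\<lambda>y. G y (a z) (b z)) (\<phi> z) (fd \<phi> z w) + G (\<phi> z) (fd a z w) (b z) + G (\<phi> z) (a z) (fd b z w)"
proof -
  let ?g = "\<lambda>i j z. G (\<phi> z) (axis i 1) (axis j 1)"
  let ?f = "\<lambda>z. \<Sum>i\<in>UNIV. \<Sum>j\<in>UNIV. (a z $ i * b z $ j) * ?g i j z"
  have eq: "G (\<phi> z) u v = (\<Sum>i\<in>UNIV. \<Sum>j\<in>UNIV. (u $ i * v $ j) * ?g i j z)" if "z \<in> S" for z u v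
    using bilinear_axis[OF C1_metricD(4)[OF G, of "\<phi> z"], of u v] \<phi>(2) that by (simp add: image_subset_iff)
  have eqy: "G y u v = (\<Sum>i\<in>UNIV. \<Sum>j\<in>UNIV. (u $ i * v $ j) * G y (axis i 1) (axis j 1))" if "y \<in> V" for y u v
    using bilinear_axis[OF C1_metricD(4)[OF G that], of u v] by simp
  have g: "C1_on S (?g i j)" for i j
    by (rule C1_on_compose[OF \<phi>(1) C1_metricD(3)[OF G] \<phi>(2)])
  show "C1_on S (\<lambda>z. G (\<phi> z) (a z) (b z))"
    by (rule C1_on_cong[OF S, where g = ?f])
      (intro C1_on_sum C1_on_mult C1_on_vec_nth a b g, rule eq)
  assume z: "z \<in> S"
  have y: "\<phi> z \<in> V" using z \<phi> by auto
  have da: "((\<lambda>z. a z $ i) has_derivative (\<lambda>w. fd a z w $ i)) (at z)" for i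
    by (rule bounded_linear.has_derivative[OF bounded_linear_vec_nth C1_on_has_derivative[OF a z]])
  have db: "((\<lambda>z. b z $ i) has_derivative (\<lambda>w. fd b z w $ i)) (at z)" for i
    by (rule bounded_linear.has_derivative[OF bounded_linear_vec_nth C1_on_has_derivative[OF b z]])
  have dg: "(?g i j has_derivative (\<lambda>w. fd (\<lambda>y. G y (axis i 1) (axis j 1)) (\<phi> z) (fd \<phi> z w))) (at z)" for i j
    using C1_on_has_derivative[OF g z] fd_compose[OF \<phi>(1) C1_metricD(3)[OF G] z y] by metis
  have df: "(?f has_derivative (\<lambda>w. \<Sum>i\<in>UNIV. \<Sum>j\<in>UNIV. (a z $ i * b z $ j) * fd (\<lambda>y. G y (axis i 1) (axis j 1)) (\<phi> z) (fd \<phi> z w)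
      + (a z $ i * fd b z w $ j + fd a z w $ i * b z $ j) * ?g i j z)) (at z)"
    by (intro has_derivative_sum has_derivative_mult da db dg)
  have "fd (\<lambda>z. G (\<phi> z) (a z) (b z)) z = fd ?f z"
    by (rule fd_cong_open[OF S z]) (rule eq)
  then have 1: "fd (\<lambda>z. G (\<phi> z) (a z) (b z)) z w = (\<Sum>i\<in>UNIV. \<Sum>j\<in>UNIV. (a z $ i * b z $ j) * fd (\<lambda>y. G y (axis i 1) (axis j 1)) (\<phi> z) (fd \<phi> z w)
      + (a z $ i * fd b z w $ j + fd a z w $ i * b z $ j) * ?g i j z)"
    using fd_unique[OF df] by simp
  have dG: "((\<lambda>y. \<Sum>i\<in>UNIV. \<Sum>j\<in>UNIV. (a z $ i * b z $ j) * G y (axis i 1) (axis j 1)) has_derivative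
     (\<lambda>w. \<Sum>i\<in>UNIV. \<Sum>j\<in>UNIV. (a z $ i * b z $ j) * fd (\<lambda>y. G y (axis i 1) (axis j 1)) (\<phi> z) w)) (at (\<phi> z))"
    by (intro has_derivative_sum has_derivative_mult_right C1_on_has_derivative[OF C1_metricD(3)[OF G] y])
  have "fd (\<lambda>y. G y (a z) (b z)) (\<phi> z) =
      fd (\<lambda>y. \<Sum>i\<in>UNIV. \<Sum>j\<in>UNIV. (a z $ i * b z $ j) * G y (axis i 1) (axis j 1)) (\<phi> z)"
    by (rule fd_cong_open[OF C1_metricD(1)[OF G] y]) (rule eqy)
  then have 2: "fd (\<lambda>y. G y (a z) (b z)) (\<phi> z) (fd \<phi> z w) =
      (\<Sum>i\<in>UNIV. \<Sum>j\<in>UNIV. (a z $ i * b z $ j) * fd (\<lambda>y. G y (axis i 1) (axis j 1)) (\<phi> z) (fd \<phi> z w))"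
    using fd_unique[OF dG] by simp
  show "fd (\<lambda>z. G (\<phi> z) (a z) (b z)) z w =
      fd (\<lambda>y. G y (a z) (b z)) (\<phi> z) (fd \<phi> z w) + G (\<phi> z) (fd a z w) (b z) + G (\<phi> z) (a z) (fd b z w)"
    unfolding 1 2 eq[OF z, of "fd a z w"] eq[OF z, of "a z"]
    by (simp add: sum.distrib distrib_right)
qed

text \<open>The identities of bilinearity hold at all points of an open set, so they may be
  differentiated.\<close>

lemma C1_metric_fd_bilinear:
  assumes G: "C1_metric V G" and x: "x \<in> V"
  shows "bilinear (\<lambda>u v. fd (\<lambda>y. G y u v) x w)"
proof -
  note hd = C1_on_has_derivative[OF C1_metricD(3)[OF G] x]
  have c: "fd (\<lambda>y. G y u v) x w = d w"
    if "\<And>y. y \<in> V \<Longrightarrow> G y u v = g y" "(g has_derivative d) (at x)" for u v g d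
    using fd_cong_open[OF C1_metricD(1)[OF G] x, of "\<lambda>y. G y u v" g] that fd_unique by metis
  note B = C1_metricD(4)[OF G]
  show ?thesis
    unfolding bilinear_def
  proof (intro conjI allI linearI)
    fix u v v' :: "real ^ 'a" and r :: real
    show "fd (\<lambda>y. G y u (v + v')) x w = fd (\<lambda>y. G y u v) x w + fd (\<lambda>y. G y u v') x w"
      by (rule c[OF _ has_derivative_add[OF hd hd]]) (rule bilinear_radd[OF B])
    show "fd (\<lambda>y. G y (v + v') u) x w = fd (\<lambda>y. G y v u) x w + fd (\<lambda>y. G y v' u) x w"
      by (rule c[OF _ has_derivative_add[OF hd hd]]) (rule bilinear_ladd[OF B])
    show "fd (\<lambda>y. G y u (r *\<^sub>R v)) x w = r *\<^sub>R fd (\<lambda>y. G y u v) x w"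
      by (rule c[OF _ has_derivative_scaleR_right[OF hd]]) (simp add: bilinear_rmul[OF B])
    show "fd (\<lambda>y. G y (r *\<^sub>R v) u) x w = r *\<^sub>R fd (\<lambda>y. G y v u) x w"
      by (rule c[OF _ has_derivative_scaleR_right[OF hd]]) (simp add: bilinear_lmul[OF B])
  qed
qed

lemma C1_metric_fd_sym:
  assumes G: "C1_metric V G" and x: "x \<in> V"
  shows "fd (\<lambda>y. G y u v) x = fd (\<lambda>y. G y v u) x"
  by (rule fd_cong_open[OF C1_metricD(1)[OF G] x]) (rule C1_metricD(5)[OF G])

lemma C1_metric_fd_linear:
  assumes G: "C1_metric V G" and x: "x \<in> V"
  shows "linear (fd (\<lambda>y. G y u v) x)"
  by (rule C1_on_linear_fd[OF C1_metricD(3)[OF G] x])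

lemma C1_form_comp:
  fixes \<phi> :: "'a::real_normed_vector \<Rightarrow> real ^ 'n::finite" and a :: "'a \<Rightarrow> real ^ 'n"
  assumes \<omega>: "C1_form V \<omega>" and S: "open S" and \<phi>: "C1_on S \<phi>" "\<phi> ` S \<subseteq> V" and a: "C1_on S a"
  shows "C1_on S (\<lambda>z. \<omega> (\<phi> z) (a z))"
    and "z \<in> S \<Longrightarrow> fd (\<lambda>z. \<omega> (\<phi> z) (a z)) z w = fd (\<lambda>y. \<omega> y (a z)) (\<phi> z) (fd \<phi> z w) + \<omega> (\<phi> z) (fd a z w)"
proof -
  let ?g = "\<lambda>i z. \<omega> (\<phi> z) (axis i 1)"
  let ?f = "\<lambda>z. \<Sum>i\<in>UNIV. a z $ i * ?g i z"
  have eqy: "\<omega> y u = (\<Sum>i\<in>UNIV. u $ i * \<omega> y (axis i 1))" if "y \<in> V" for y u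
    using linear_axis[OF C1_formD(2)[OF \<omega> that], of u] by simp
  have eq: "\<omega> (\<phi> z) u = (\<Sum>i\<in>UNIV. u $ i * ?g i z)" if "z \<in> S" for z u
    by (rule eqy) (use \<phi>(2) that in auto)
  have g: "C1_on S (?g i)" for i
    by (rule C1_on_compose[OF \<phi>(1) C1_formD(3)[OF \<omega>] \<phi>(2)])
  show "C1_on S (\<lambda>z. \<omega> (\<phi> z) (a z))"
    by (rule C1_on_cong[OF S, where g = ?f])
      (intro C1_on_sum C1_on_mult C1_on_vec_nth a g, rule eq)
  assume z: "z \<in> S"
  have y: "\<phi> z \<in> V" using z \<phi> by auto
  have da: "((\<lambda>z. a z $ i) has_derivative (\<lambda>w. fd a z w $ i)) (at z)" for i
    by (rule bounded_linear.has_derivative[OF bounded_linear_vec_nth C1_on_has_derivative[OF a z]])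
  have dg: "(?g i has_derivative (\<lambda>w. fd (\<lambda>y. \<omega> y (axis i 1)) (\<phi> z) (fd \<phi> z w))) (at z)" for i
    using C1_on_has_derivative[OF g z] fd_compose[OF \<phi>(1) C1_formD(3)[OF \<omega>] z y] by metis
  have df: "(?f has_derivative (\<lambda>w. \<Sum>i\<in>UNIV. a z $ i * fd (\<lambda>y. \<omega> y (axis i 1)) (\<phi> z) (fd \<phi> z w)
      + fd a z w $ i * ?g i z)) (at z)"
    by (intro has_derivative_sum has_derivative_mult da dg)
  have "fd (\<lambda>z. \<omega> (\<phi> z) (a z)) z = fd ?f z"
    by (rule fd_cong_open[OF S z]) (rule eq)
  then have 1: "fd (\<lambda>z. \<omega> (\<phi> z) (a z)) z w = (\<Sum>i\<in>UNIV. a z $ i * fd (\<lambda>y. \<omega> y (axis i 1)) (\<phi> z) (fd \<phi> z w)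
      + fd a z w $ i * ?g i z)"
    using fd_unique[OF df] by simp
  have dG: "((\<lambda>y. \<Sum>i\<in>UNIV. a z $ i * \<omega> y (axis i 1)) has_derivative
     (\<lambda>w. \<Sum>i\<in>UNIV. a z $ i * fd (\<lambda>y. \<omega> y (axis i 1)) (\<phi> z) w)) (at (\<phi> z))"
    by (intro has_derivative_sum has_derivative_mult_right C1_on_has_derivative[OF C1_formD(3)[OF \<omega>] y])
  have "fd (\<lambda>y. \<omega> y (a z)) (\<phi> z) = fd (\<lambda>y. \<Sum>i\<in>UNIV. a z $ i * \<omega> y (axis i 1)) (\<phi> z)"
    by (rule fd_cong_open[OF C1_formD(1)[OF \<omega>] y]) (rule eqy)
  then have 2: "fd (\<lambda>y. \<omega> y (a z)) (\<phi> z) (fd \<phi> z w) =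
      (\<Sum>i\<in>UNIV. a z $ i * fd (\<lambda>y. \<omega> y (axis i 1)) (\<phi> z) (fd \<phi> z w))"
    using fd_unique[OF dG] by simp
  show "fd (\<lambda>z. \<omega> (\<phi> z) (a z)) z w = fd (\<lambda>y. \<omega> y (a z)) (\<phi> z) (fd \<phi> z w) + \<omega> (\<phi> z) (fd a z w)"
    unfolding 1 2 eq[OF z, of "fd a z w"] by (simp add: sum.distrib)
qed

text \<open>The right side is linear in \<open>w\<close>, so half of it has a Riesz representative,
  unique because an inner product separates vectors. This resolves the THE in the
  definition.\<close>

lemma christoffel:
  assumes G: "C1_metric V G" and x: "x \<in> V"
  shows "2 * G x (christoffel G x u v) w =
     fd (\<lambda>y. G y v w) x u + fd (\<lambda>y. G y u w) x v - fd (\<lambda>y. G y u v) x w"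
proof -
  let ?K = "\<lambda>w. fd (\<lambda>y. G y v w) x u + fd (\<lambda>y. G y u w) x v - fd (\<lambda>y. G y u v) x w"
  note ip = C1_metricD(2)[OF G x]
  have "linear (\<lambda>w. fd (\<lambda>y. G y v w) x u)" for u v
    using C1_metric_fd_bilinear[OF G x] by (simp add: bilinear_def)
  then have "linear ?K"
    by (intro linear_compose_sub linear_compose_add C1_metric_fd_linear[OF G x])
  then have K: "linear (\<lambda>w. ?K w / 2)"
    using linear_compose_scale_right[of ?K "1/2"] by simp
  have "\<exists>!z. \<forall>w. 2 * G x z w = ?K w"
  proof (rule ex1I)
    show "\<forall>w. 2 * G x (sharp (G x) (\<lambda>w. ?K w / 2)) w = ?K w"
      using sharp[OF ip K] by (simp add: mult.commute)
    fix z assume z: "\<forall>w. 2 * G x z w = ?K w"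
    show "z = sharp (G x) (\<lambda>w. ?K w / 2)"
    proof (rule inner_product_eqI[OF ip])
      fix w
      show "G x z w = G x (sharp (G x) (\<lambda>w. ?K w / 2)) w"
        unfolding sharp[OF ip K] using spec[OF z, of w] by simp
    qed
  qed
  from theI'[OF this] show ?thesis unfolding christoffel_def by blast
qed

text \<open>Tested against every \<open>w\<close>, the claim becomes additivity and homogeneity of
  the Koszul expression.\<close>

lemma bilinear_christoffel:
  assumes G: "C1_metric V G" and x: "x \<in> V"
  shows "bilinear (christoffel G x)"
proof -
  note ip = C1_metricD(2)[OF G x] and ch = christoffel[OF G x] and B = C1_metricD(4)[OF G x]
    and D = C1_metric_fd_bilinear[OF G x] and L = C1_metric_fd_linear[OF G x]
  have eqI: "z = z'" if "\<And>w. 2 * G x z w = 2 * G x z' w" for z z'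
    by (rule inner_product_eqI[OF ip]) (use that in simp)
  show ?thesis
    unfolding bilinear_def
  proof (intro conjI allI linearI)
    fix u v v' :: "real ^ 'a" and r :: real
    show "christoffel G x u (v + v') = christoffel G x u v + christoffel G x u v'"
      by (rule eqI) (simp add: bilinear_ladd[OF B] distrib_left ch bilinear_ladd[OF D] bilinear_radd[OF D] linear_add[OF L])
    show "christoffel G x (v + v') u = christoffel G x v u + christoffel G x v' u"
      by (rule eqI) (simp add: bilinear_ladd[OF B] distrib_left ch bilinear_ladd[OF D] bilinear_radd[OF D] linear_add[OF L])
    have *: "2 * (r * c) = r * (2 * c)" for c :: real by simp
    show "christoffel G x u (r *\<^sub>R v) = r *\<^sub>R christoffel G x u v"
      by (rule eqI) (simp only: bilinear_lmul[OF B] * ch real_scaleR_def, simp add: bilinear_lmul[OF D] bilinear_rmul[OF D] linear_cmul[OF L] algebra_simps)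
    show "christoffel G x (r *\<^sub>R v) u = r *\<^sub>R christoffel G x v u"
      by (rule eqI) (simp only: bilinear_lmul[OF B] * ch real_scaleR_def, simp add: bilinear_lmul[OF D] bilinear_rmul[OF D] linear_cmul[OF L] algebra_simps)
  qed
qed

text \<open>Differentiating the isometry relation adds second derivatives of \<open>\<theta>\<close>
  to the Koszul expression; their net effect is the inhomogeneous term of the classical
  transformation law.\<close>

lemma christoffel_transform:
  fixes \<theta> :: "real ^ 'n::finite \<Rightarrow> real ^ 'n"
  assumes G: "C1_metric V G" and G': "C1_metric V' G'"
    and \<theta>: "C1_on V \<theta>" "\<theta> ` V \<subseteq> V'" "\<And>v. C1_on V (\<lambda>x. fd \<theta> x v)"
    and iso: "\<And>x u v. x \<in> V \<Longrightarrow> G x u v = G' (\<theta> x) (fd \<theta> x u) (fd \<theta> x v)"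
    and x: "x \<in> V" and surj: "surj (fd \<theta> x)"
  shows "fd \<theta> x (christoffel G x u v) = christoffel G' (\<theta> x) (fd \<theta> x u) (fd \<theta> x v) + fd (\<lambda>y. fd \<theta> y v) x u"
proof -
  have V: "open V" by (rule C1_metricD(1)[OF G])
  have y: "\<theta> x \<in> V'" using x \<theta> by auto
  note B = C1_metricD(4)[OF G' y]
  have D: "fd (\<lambda>y. G y a b) x c = fd (\<lambda>y. G' y (fd \<theta> x a) (fd \<theta> x b)) (\<theta> x) (fd \<theta> x c)
      + G' (\<theta> x) (fd (\<lambda>y. fd \<theta> y a) x c) (fd \<theta> x b) + G' (\<theta> x) (fd \<theta> x a) (fd (\<lambda>y. fd \<theta> y b) x c)" for a b c
    using fd_cong_open[OF V x, of "\<lambda>y. G y a b" "\<lambda>x. G' (\<theta> x) (fd \<theta> x a) (fd \<theta> x b)"] iso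
      C1_metric_comp(2)[OF G' V \<theta>(1,2) \<theta>(3) \<theta>(3) x] by simp
  have C: "fd (\<lambda>y. fd \<theta> y a) x c = fd (\<lambda>y. fd \<theta> y c) x a" for a c
    by (rule fd_fd_commute[OF V x \<theta>(1,3)])
  have S: "G' (\<theta> x) a b = G' (\<theta> x) b a" for a b by (rule C1_metricD(5)[OF G' y])
  have "2 * G' (\<theta> x) (fd \<theta> x (christoffel G x u v)) (fd \<theta> x w) =
      2 * G' (\<theta> x) (christoffel G' (\<theta> x) (fd \<theta> x u) (fd \<theta> x v) + fd (\<lambda>y. fd \<theta> y v) x u) (fd \<theta> x w)" for w
  proof -
    have "2 * G' (\<theta> x) (fd \<theta> x (christoffel G x u v)) (fd \<theta> x w) = 2 * G x (christoffel G x u v) w"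
      using iso[OF x] by simp
    also have "\<dots> = 2 * G' (\<theta> x) (christoffel G' (\<theta> x) (fd \<theta> x u) (fd \<theta> x v)) (fd \<theta> x w)
        + 2 * G' (\<theta> x) (fd (\<lambda>y. fd \<theta> y v) x u) (fd \<theta> x w)"
      \<comment> \<open>Six terms contain second derivatives of \<open>\<theta>\<close>. By symmetry
        of second derivatives and of the metric four of them cancel, and the other two are equal,
        which yields the factor 2.\<close>
      unfolding christoffel[OF G x] christoffel[OF G' y] D
      using C[of u v] C[of u w] C[of v w] S[of "fd \<theta> x v"] S[of "fd \<theta> x u"] by simp
    finally show ?thesis by (simp add: bilinear_ladd[OF B])
  qed
  note eq = this
  show ?thesis
  proof (intro inner_product_eqI[OF C1_metricD(2)[OF G' y]])
    fix w' obtain w where "w' = fd \<theta> x w" using surjD[OF surj] by blast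
    then show "G' (\<theta> x) (fd \<theta> x (christoffel G x u v)) w' =
      G' (\<theta> x) (christoffel G' (\<theta> x) (fd \<theta> x u) (fd \<theta> x v) + fd (\<lambda>y. fd \<theta> y v) x u) w'"
      using eq[of w] by simp
  qed
qed

section \<open>Covariant derivative and divergence of one-forms\<close>

definition nabla_form :: "(real ^ 'n \<Rightarrow> real ^ 'n \<Rightarrow> real ^ 'n \<Rightarrow> real) \<Rightarrow> (real ^ 'n \<Rightarrow> real ^ 'n \<Rightarrow> real) \<Rightarrow>
    real ^ 'n::finite \<Rightarrow> real ^ 'n \<Rightarrow> real ^ 'n \<Rightarrow> real" where
  "nabla_form G \<omega> x u v = fd (\<lambda>y. \<omega> y v) x u - \<omega> x (christoffel G x u v)"

text \<open>This is the divergence of the vector field metrically dual to \<omega>, since the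
  connection commutes with raising an index. Forms are preferred to fields because they pull back
  along a coordinate change without inverting its derivative.\<close>

definition div_form :: "(real ^ 'n \<Rightarrow> real ^ 'n \<Rightarrow> real ^ 'n \<Rightarrow> real) \<Rightarrow> (real ^ 'n \<Rightarrow> real ^ 'n \<Rightarrow> real) \<Rightarrow>
    real ^ 'n::finite \<Rightarrow> real" where
  "div_form G \<omega> x = metric_trace (G x) (nabla_form G \<omega> x)"

lemma C1_form_fd_linear:
  assumes \<omega>: "C1_form V \<omega>" and x: "x \<in> V"
  shows "linear (\<lambda>v. fd (\<lambda>y. \<omega> y v) x u)"
proof -
  note hd = C1_on_has_derivative[OF C1_formD(3)[OF \<omega>] x] and L = C1_formD(2)[OF \<omega>]
  have c: "fd (\<lambda>y. \<omega> y v) x w = d w"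
    if "\<And>y. y \<in> V \<Longrightarrow> \<omega> y v = g y" "(g has_derivative d) (at x)" for v g d w
    using fd_cong_open[OF C1_formD(1)[OF \<omega>] x, of "\<lambda>y. \<omega> y v" g] that fd_unique by metis
  show ?thesis
  proof (rule linearI)
    fix v v' :: "real ^ 'a" and r :: real
    show "fd (\<lambda>y. \<omega> y (v + v')) x u = fd (\<lambda>y. \<omega> y v) x u + fd (\<lambda>y. \<omega> y v') x u"
      by (rule c[OF _ has_derivative_add[OF hd hd]]) (rule linear_add[OF L])
    show "fd (\<lambda>y. \<omega> y (r *\<^sub>R v)) x u = r *\<^sub>R fd (\<lambda>y. \<omega> y v) x u"
      by (rule c[OF _ has_derivative_scaleR_right[OF hd]]) (simp add: linear_cmul[OF L])
  qed
qed

lemma bilinear_nabla_form: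
  assumes G: "C1_metric V G" and \<omega>: "C1_form V \<omega>" and x: "x \<in> V"
  shows "bilinear (nabla_form G \<omega> x)"
proof -
  have "linear (\<lambda>u. \<omega> x (christoffel G x u v))" "linear (\<lambda>v. \<omega> x (christoffel G x u v))" for u v
    using bilinear_christoffel[OF G x] C1_formD(2)[OF \<omega> x]
      linear_compose[of "\<lambda>u. christoffel G x u v" "\<omega> x"] linear_compose[of "christoffel G x u" "\<omega> x"]
    by (auto simp: bilinear_def o_def)
  then show ?thesis
    unfolding bilinear_def nabla_form_def
    by (auto intro!: linear_compose_sub C1_form_fd_linear[OF \<omega> x] C1_on_linear_fd[OF C1_formD(3)[OF \<omega>] x])
qed

text \<open>The second derivative of \<open>\<theta>\<close> arising from the pulled back form
  cancels against the inhomogeneous term of \<open>christoffel_transform\<close>. So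
  \<open>nabla_form\<close> is tensorial, and its trace is invariant.\<close>

lemma div_form_transform:
  fixes \<theta> :: "real ^ 'n::finite \<Rightarrow> real ^ 'n"
  assumes G: "C1_metric V G" and G': "C1_metric V' G'" and \<omega>': "C1_form V' \<omega>'"
    and \<theta>: "C1_on V \<theta>" "\<theta> ` V \<subseteq> V'" "\<And>v. C1_on V (\<lambda>x. fd \<theta> x v)"
    and iso: "\<And>x u v. x \<in> V \<Longrightarrow> G x u v = G' (\<theta> x) (fd \<theta> x u) (fd \<theta> x v)"
    and \<omega>: "\<And>x v. x \<in> V \<Longrightarrow> \<omega> x v = \<omega>' (\<theta> x) (fd \<theta> x v)"
    and x: "x \<in> V" and bij: "inj (fd \<theta> x)"
  shows "div_form G \<omega> x = div_form G' \<omega>' (\<theta> x)"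
proof -
  have V: "open V" by (rule C1_metricD(1)[OF G])
  have y: "\<theta> x \<in> V'" using x \<theta> by auto
  have lin: "linear (fd \<theta> x)" by (rule C1_on_linear_fd[OF \<theta>(1) x])
  have surj: "surj (fd \<theta> x)" by (rule linear_injective_imp_surjective[OF lin bij]) simp
  have "nabla_form G \<omega> x u v = nabla_form G' \<omega>' (\<theta> x) (fd \<theta> x u) (fd \<theta> x v)" for u v
  proof -
    have "fd (\<lambda>y. \<omega> y v) x u = fd (\<lambda>y. \<omega>' y (fd \<theta> x v)) (\<theta> x) (fd \<theta> x u) + \<omega>' (\<theta> x) (fd (\<lambda>y. fd \<theta> y v) x u)"
      using fd_cong_open[OF V x, of "\<lambda>y. \<omega> y v" "\<lambda>x. \<omega>' (\<theta> x) (fd \<theta> x v)"] \<omega>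
        C1_form_comp(2)[OF \<omega>' V \<theta>(1,2) \<theta>(3) x] by simp
    moreover have "\<omega> x (christoffel G x u v) = \<omega>' (\<theta> x) (christoffel G' (\<theta> x) (fd \<theta> x u) (fd \<theta> x v))
        + \<omega>' (\<theta> x) (fd (\<lambda>y. fd \<theta> y v) x u)"
      using \<omega>[OF x, of "christoffel G x u v"] christoffel_transform[OF G G' \<theta> iso x surj, of u v]
        linear_add[OF C1_formD(2)[OF \<omega>' y]] by metis
    ultimately show ?thesis unfolding nabla_form_def by simp
  qed
  then have "nabla_form G \<omega> x = (\<lambda>u v. nabla_form G' \<omega>' (\<theta> x) (fd \<theta> x u) (fd \<theta> x v))"
    by (intro ext)
  moreover have "G x = (\<lambda>u v. G' (\<theta> x) (fd \<theta> x u) (fd \<theta> x v))" by (intro ext iso[OF x])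
  ultimately show ?thesis
    unfolding div_form_def
    using metric_trace_pullback[OF C1_metricD(2)[OF G' y] lin bij bilinear_nabla_form[OF G' \<omega>' y]] by simp
qed

lemma C1_on_det_gram:
  assumes G: "C1_metric V G"
  shows "C1_on V (\<lambda>x. det (gram (G x)))"
  by (rule C1_on_det) (simp add: gram_def C1_metricD(3)[OF G])

lemma C1_on_sharp:
  assumes G: "C1_metric V G" and \<omega>: "C1_form V \<omega>"
  shows "C1_on V (\<lambda>x. sharp (G x) (\<omega> x))"
proof (rule C1_on_componentwise)
  fix b :: "real ^ 'a" assume "b \<in> Basis"
  then obtain k where b: "b = axis k 1" by (auto simp: Basis_vec_def)
  have "C1_on V (\<lambda>x. det (\<chi> i j. if j = k then \<omega> x (axis i 1) else gram (G x) $ i $ j) / det (gram (G x)))"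
  proof (intro C1_on_divide C1_on_det)
    show "C1_on V (\<lambda>x. gram (G x) $ i $ j)" for i j by (simp add: gram_def C1_metricD(3)[OF G])
    show "C1_on V (\<lambda>x. (\<chi> i j. if j = k then \<omega> x (axis i 1) else gram (G x) $ i $ j) $ i $ j)" for i j
      by (cases "j = k") (simp_all add: gram_def C1_metricD(3)[OF G] C1_formD(3)[OF \<omega>])
    show "det (gram (G x)) \<noteq> 0" if "x \<in> V" for x
      using det_gram_pos[OF C1_metricD(2)[OF G that]] by simp
  qed
  then show "C1_on V (\<lambda>x. sharp (G x) (\<omega> x) \<bullet> b)"
    by (simp add: b inner_axis sharp_def)
qed

text \<open>Jacobi's formula in an orthonormal frame. The basis \<open>e\<close> is frozen at
  \<open>x\<close>, so the matrix of \<open>G y\<close> in that basis is the identity at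
  \<open>y = x\<close>, and its determinant differs from that of the standard Gram matrix by a
  constant factor.\<close>

lemma fd_det_gram:
  assumes G: "C1_metric V G" and x: "x \<in> V" and e: "orthonormal (G x) e"
  shows "fd (\<lambda>y. det (gram (G y))) x w = det (gram (G x)) * (\<Sum>i\<in>UNIV. fd (\<lambda>y. G y (e i) (e i)) x w)"
proof -
  define L where "L = (*v) (\<chi> a i. e i $ a)"
  have L: "linear L" by (simp add: L_def)
  have Le: "L (axis i 1) = e i" for i
    by (simp add: L_def matrix_vector_mul_component vec_eq_iff matrix_vector_mult_basis column_def)
  define M where "M = (\<lambda>y. gram (\<lambda>u v. G y (L u) (L v)))"
  have Mij: "M y $ i $ j = G y (e i) (e j)" for y i j by (simp add: M_def gram_def Le)
  have detM: "det (M y) = (det (matrix L))\<^sup>2 * det (gram (G y))" if "y \<in> V" for y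
    unfolding M_def gram_pullback[OF C1_metricD(2)[OF G that] L]
    by (simp add: det_mul det_transpose power2_eq_square)
  have Mx: "M x = mat 1" using e by (simp add: vec_eq_iff Mij orthonormal_def mat_def)
  then have 1: "(det (matrix L))\<^sup>2 * det (gram (G x)) = 1" using detM[OF x] by (simp add: det_I)
  have eq: "det (gram (G y)) = det (gram (G x)) * det (M y)" if "y \<in> V" for y
    unfolding detM[OF that] using 1 by (simp add: algebra_simps)
  have "((\<lambda>y. det (M y)) has_derivative (\<lambda>v. \<Sum>i\<in>UNIV. fd (\<lambda>y. G y (e i) (e i)) x v)) (at x)"
    by (rule det_has_derivative_identity[of M "\<lambda>i j. fd (\<lambda>y. G y (e i) (e j)) x", OF _ Mx])
      (simp add: Mij C1_on_has_derivative[OF C1_metricD(3)[OF G] x])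
  from has_derivative_mult_right[OF this, of "det (gram (G x))"]
  show ?thesis
    using fd_cong_open[OF C1_metricD(1)[OF G] x eq] fd_unique by fastforce
qed

text \<open>The classical formula for the divergence of Z = \<open>sharp (G x) (\<omega> x)\<close>,
  multiplied by the density. Differentiating the density contributes half the trace of the
  derivative of the metric along Z; the same term comes out of the Christoffel symbols by the Koszul
  formula.\<close>

lemma div_form_eq_divergence:
  fixes G :: "real ^ 'n::finite \<Rightarrow> real ^ 'n \<Rightarrow> real ^ 'n \<Rightarrow> real"
  assumes G: "C1_metric V G" and \<omega>: "C1_form V \<omega>"
  defines "W \<equiv> \<lambda>x. sqrt (det (gram (G x))) *\<^sub>R sharp (G x) (\<omega> x)"
  shows "C1_on V W"
    and "x \<in> V \<Longrightarrow> (\<Sum>a\<in>UNIV. fd W x (axis a 1) $ a) = sqrt (det (gram (G x))) * div_form G \<omega> x"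
proof -
  note pos = det_gram_pos[OF C1_metricD(2)[OF G]]
  define Z where "Z = (\<lambda>x. sharp (G x) (\<omega> x))"
  define s where "s = (\<lambda>x. sqrt (det (gram (G x))))"
  have Z: "C1_on V Z" unfolding Z_def by (rule C1_on_sharp[OF G \<omega>])
  have s: "C1_on V s" unfolding s_def by (rule C1_on_sqrt[OF C1_on_det_gram[OF G] pos])
  have W: "W = (\<lambda>x. s x *\<^sub>R Z x)" by (simp add: W_def Z_def s_def)
  show "C1_on V W" unfolding W by (rule C1_on_scaleR[OF s Z])
  assume x: "x \<in> V"
  note ip = C1_metricD(2)[OF G x]
  define e where "e = onb (G x)"
  have e: "orthonormal (G x) e" unfolding e_def by (rule orthonormal_onb[OF ip])
  have sx: "s x > 0" "s x * s x = det (gram (G x))" using pos[OF x] by (auto simp: s_def)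
  \<comment> \<open>From \<open>s * s\<close> being the determinant: half its logarithmic
    derivative, multiplied by \<open>s x\<close>.\<close>
  have ds: "fd s x w = s x * (\<Sum>i\<in>UNIV. fd (\<lambda>y. G y (e i) (e i)) x w) / 2" for w
  proof -
    have "((\<lambda>y. s y * s y) has_derivative (\<lambda>w. s x * fd s x w + fd s x w * s x)) (at x)"
      by (intro has_derivative_mult C1_on_has_derivative[OF s x])
    moreover have "fd (\<lambda>y. s y * s y) x = fd (\<lambda>y. det (gram (G y))) x"
      by (rule fd_cong_open[OF C1_metricD(1)[OF G] x]) (use pos in \<open>auto simp: s_def less_imp_le\<close>)
    ultimately have "fd (\<lambda>y. det (gram (G y))) x w = s x * fd s x w + fd s x w * s x"
      using fd_unique[of "\<lambda>y. s y * s y"] by metis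
    then have "s x * fd s x w + fd s x w * s x = s x * s x * (\<Sum>i\<in>UNIV. fd (\<lambda>y. G y (e i) (e i)) x w)"
      unfolding fd_det_gram[OF G x e] sx(2) by simp
    then have "s x * (2 * fd s x w) = s x * (s x * (\<Sum>i\<in>UNIV. fd (\<lambda>y. G y (e i) (e i)) x w))"
      by (simp add: algebra_simps)
    then have "2 * fd s x w = s x * (\<Sum>i\<in>UNIV. fd (\<lambda>y. G y (e i) (e i)) x w)"
      using sx(1) by simp
    then show ?thesis by simp
  qed
  have dW: "fd W x w = s x *\<^sub>R fd Z x w + fd s x w *\<^sub>R Z x" for w
    unfolding W using fd_unique[OF has_derivative_scaleR[OF C1_on_has_derivative[OF s x] C1_on_has_derivative[OF Z x]]] by simp
  \<comment> \<open>Differentiate the defining relation between \<open>Z\<close> and \<omega> with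
    \<open>v\<close> constant, and move the derivative of the metric to the right.\<close>
  have dZ: "G x (fd Z x w) v = fd (\<lambda>y. \<omega> y v) x w - fd (\<lambda>y. G y (Z x) v) x w" for w v
  proof -
    have "fd (\<lambda>y. G y (Z y) v) x w = fd (\<lambda>y. G y (Z x) v) x (fd (\<lambda>y. y) x w) + G x (fd Z x w) v + G x (Z x) (fd (\<lambda>y. v) x w)"
      by (rule C1_metric_comp(2)[OF G C1_metricD(1)[OF G] C1_on_ident _ Z C1_on_const x]) simp
    moreover have "fd (\<lambda>y. G y (Z y) v) x = fd (\<lambda>y. \<omega> y v) x"
      by (rule fd_cong_open[OF C1_metricD(1)[OF G] x])
        (simp add: Z_def sharp[OF C1_metricD(2)[OF G] C1_formD(2)[OF \<omega>]])
    ultimately show ?thesis using bilinear_rzero[OF C1_metricD(4)[OF G x]] by simp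
  qed
  \<comment> \<open>The Koszul formula tested against \<open>Z x\<close>, where the metric turns the
    Christoffel vector into a value of \<omega>.\<close>
  have \<Gamma>: "2 * \<omega> x (christoffel G x u u) = 2 * fd (\<lambda>y. G y (Z x) u) x u - fd (\<lambda>y. G y u u) x (Z x)" for u
  proof -
    have "\<omega> x (christoffel G x u u) = G x (Z x) (christoffel G x u u)"
      by (simp add: Z_def sharp[OF ip C1_formD(2)[OF \<omega> x]])
    also have "\<dots> = G x (christoffel G x u u) (Z x)" by (rule C1_metricD(5)[OF G x])
    finally show ?thesis using christoffel[OF G x, of u u "Z x"] C1_metric_fd_sym[OF G x, of u "Z x"] by simp
  qed
  have "(\<Sum>a\<in>UNIV. fd W x (axis a 1) $ a) =
      s x * (\<Sum>a\<in>UNIV. fd Z x (axis a 1) $ a) + (\<Sum>a\<in>UNIV. Z x $ a * fd s x (axis a 1))"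
    unfolding dW by (simp add: sum.distrib sum_distrib_left mult.commute)
  also have "(\<Sum>a\<in>UNIV. Z x $ a * fd s x (axis a 1)) = fd s x (Z x)"
    using linear_axis[OF C1_on_linear_fd[OF s x], of "Z x"] by simp
  also have "(\<Sum>a\<in>UNIV. fd Z x (axis a 1) $ a) = (\<Sum>i\<in>UNIV. G x (fd Z x (e i)) (e i))"
    by (rule trace_eq_orthonormal[OF ip e C1_on_linear_fd[OF Z x]])
  also have "s x * (\<Sum>i\<in>UNIV. G x (fd Z x (e i)) (e i)) + fd s x (Z x) =
      s x * (\<Sum>i\<in>UNIV. fd (\<lambda>y. \<omega> y (e i)) x (e i) - fd (\<lambda>y. G y (Z x) (e i)) x (e i) + fd (\<lambda>y. G y (e i) (e i)) x (Z x) / 2)"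
    unfolding dZ ds by (simp add: sum.distrib distrib_left sum_divide_distrib[symmetric])
  also have "\<dots> = s x * (\<Sum>i\<in>UNIV. nabla_form G \<omega> x (e i) (e i))"
  proof (intro arg_cong[where f = "\<lambda>c. s x * c"] sum.cong refl)
    fix i
    show "fd (\<lambda>y. \<omega> y (e i)) x (e i) - fd (\<lambda>y. G y (Z x) (e i)) x (e i) + fd (\<lambda>y. G y (e i) (e i)) x (Z x) / 2 =
      nabla_form G \<omega> x (e i) (e i)"
      unfolding nabla_form_def using \<Gamma>[of "e i"] by linarith
  qed
  finally show "(\<Sum>a\<in>UNIV. fd W x (axis a 1) $ a) = sqrt (det (gram (G x))) * div_form G \<omega> x"
    by (simp add: div_form_def metric_trace_onb e_def s_def)
qed

section \<open>Differentiation under the integral sign and integrals of derivatives\<close>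

text \<open>By the mean value theorem each difference quotient is a value of the derivative in
  between, so \<open>g\<close> dominates all of them and dominated convergence applies along
  sequences.\<close>

lemma has_real_derivative_integral:
  fixes f :: "real \<Rightarrow> 'a \<Rightarrow> real"
  assumes d: "d > 0"
    and int: "\<And>t. \<bar>t - t0\<bar> < d \<Longrightarrow> integrable M (f t)"
    and der: "\<And>x t. x \<in> space M \<Longrightarrow> \<bar>t - t0\<bar> < d \<Longrightarrow> ((\<lambda>t. f t x) has_real_derivative f' t x) (at t)"
    and bound: "\<And>x t. x \<in> space M \<Longrightarrow> \<bar>t - t0\<bar> < d \<Longrightarrow> \<bar>f' t x\<bar> \<le> g x"
    and g: "integrable M g"
  shows "integrable M (f' t0)" "((\<lambda>t. \<integral>x. f t x \<partial>M) has_real_derivative (\<integral>x. f' t0 x \<partial>M)) (at t0)"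
proof -
  let ?q = "\<lambda>t x. (f t x - f t0 x) / (t - t0)"
  have lip: "\<bar>?q t x\<bar> \<le> g x" if x: "x \<in> space M" and t: "\<bar>t - t0\<bar> < d" "t \<noteq> t0" for t x
  proof -
    have "\<exists>z. \<bar>z - t0\<bar> < d \<and> ?q t x = f' z x"
    proof (cases "t < t0")
      case True
      have "\<exists>z. t < z \<and> z < t0 \<and> f t0 x - f t x = (t0 - t) * f' z x"
        by (rule MVT2[OF True], rule der[OF x]) (use t in auto)
      then obtain z where "t < z" "z < t0" "f t0 x - f t x = (t0 - t) * f' z x" by blast
      then show ?thesis using t True by (intro exI[of _ z]) (auto simp: field_simps)
    next
      case False
      then have less: "t0 < t" using t by simp
      have "\<exists>z. t0 < z \<and> z < t \<and> f t x - f t0 x = (t - t0) * f' z x"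
        by (rule MVT2[OF less], rule der[OF x]) (use t in auto)
      then obtain z where "t0 < z" "z < t" "f t x - f t0 x = (t - t0) * f' z x" by blast
      then show ?thesis using t less by (intro exI[of _ z]) (auto simp: field_simps)
    qed
    then obtain z where z: "\<bar>z - t0\<bar> < d" "?q t x = f' z x" by blast
    show ?thesis unfolding z(2) by (rule bound[OF x z(1)])
  qed
  have lim: "(\<lambda>n. ?q (X n) x) \<longlonglongrightarrow> f' t0 x"
    if X: "\<forall>n. X n \<in> {t0 - d<..<t0 + d} - {t0}" "X \<longlonglongrightarrow> t0" and x: "x \<in> space M" for X x
  proof -
    have "((\<lambda>t. ?q t x) \<longlongrightarrow> f' t0 x) (at t0)"
      using der[OF x, of t0] d by (simp add: has_field_derivative_iff)
    moreover have "filterlim X (at t0) sequentially"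
      using X by (auto simp: filterlim_at)
    ultimately show ?thesis by (rule filterlim_compose)
  qed
  have meas: "(\<lambda>x. ?q t x) \<in> borel_measurable M" if "\<bar>t - t0\<bar> < d" for t
    using borel_measurable_integrable[OF int[OF that]] borel_measurable_integrable[OF int[of t0]] d by simp
  \<comment> \<open>A concrete sequence tending to \<open>t0\<close>, used to obtain measurability
    of \<open>f' t0\<close> as a limit of quotients. The offset 2 keeps already the term for n = 0
    strictly within distance \<open>d\<close>.\<close>
  define X where "X = (\<lambda>n. t0 + d / (real n + 2))"
  have X: "\<forall>n. X n \<in> {t0 - d<..<t0 + d} - {t0}"
    using d by (auto simp: X_def field_simps add_pos_nonneg intro: order_less_le_trans)
  have "(\<lambda>n. d / (real n + 2)) \<longlonglongrightarrow> 0" by real_asymp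
  then have "X \<longlonglongrightarrow> t0" unfolding X_def by (auto intro: tendsto_eq_intros)
  have m': "f' t0 \<in> borel_measurable M"
  proof (rule borel_measurable_LIMSEQ_real)
    show "(\<lambda>n. ?q (X n) x) \<longlonglongrightarrow> f' t0 x" if "x \<in> space M" for x by (rule lim[OF X \<open>X \<longlonglongrightarrow> t0\<close> that])
    show "(\<lambda>x. ?q (X n) x) \<in> borel_measurable M" for n using spec[OF X, of n] by (intro meas) (auto simp: abs_less_iff)
  qed
  show "integrable M (f' t0)"
    by (rule Bochner_Integration.integrable_bound[OF g m']) (use bound[of _ t0] d in \<open>auto intro!: AE_I2 intro: order_trans[OF _ abs_ge_self]\<close>)
  have "((\<lambda>t. ((\<integral>x. f t x \<partial>M) - (\<integral>x. f t0 x \<partial>M)) / (t - t0)) \<longlongrightarrow> (\<integral>x. f' t0 x \<partial>M)) (at t0 within {t0 - d<..<t0 + d})"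
    unfolding tendsto_at_iff_sequentially comp_def
  proof (intro allI impI)
    fix X assume X: "\<forall>n. X n \<in> {t0 - d<..<t0 + d} - {t0}" "X \<longlonglongrightarrow> t0"
    have Xd: "\<bar>X n - t0\<bar> < d" "X n \<noteq> t0" for n
    proof -
      have "X n \<in> {t0 - d<..<t0 + d} - {t0}" using X(1) by blast
      then show "\<bar>X n - t0\<bar> < d" "X n \<noteq> t0" by (auto simp: abs_less_iff)
    qed
    have "(\<lambda>n. \<integral>x. ?q (X n) x \<partial>M) \<longlonglongrightarrow> (\<integral>x. f' t0 x \<partial>M)"
    proof (rule integral_dominated_convergence[OF m' _ g])
      show "(\<lambda>x. ?q (X n) x) \<in> borel_measurable M" for n by (rule meas[OF Xd(1)])
      show "AE x in M. (\<lambda>n. ?q (X n) x) \<longlonglongrightarrow> f' t0 x" using lim[OF X] by (intro AE_I2)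
      show "AE x in M. norm (?q (X n) x) \<le> g x" for n using lip[OF _ Xd] by (intro AE_I2) simp
    qed
    moreover have "(\<integral>x. ?q (X n) x \<partial>M) = ((\<integral>x. f (X n) x \<partial>M) - (\<integral>x. f t0 x \<partial>M)) / (X n - t0)" for n
      using int[OF Xd(1)] int[of t0] d by simp
    ultimately show "(\<lambda>n. ((\<integral>x. f (X n) x \<partial>M) - (\<integral>x. f t0 x \<partial>M)) / (X n - t0)) \<longlonglongrightarrow> (\<integral>x. f' t0 x \<partial>M)"
      using Xd(2) by simp
  qed
  then show "((\<lambda>t. \<integral>x. f t x \<partial>M) has_real_derivative (\<integral>x. f' t0 x \<partial>M)) (at t0)"
    unfolding has_field_derivative_iff using at_within_open[of t0 "{t0 - d<..<t0 + d}"] d by simp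
qed

text \<open>By translation invariance, the integral of \<open>W (x + t *\<^sub>R v)\<close> does not depend on \<open>t\<close>.\<close>

lemma integral_fd_compact_support:
  fixes W :: "'a::euclidean_space \<Rightarrow> real"
  assumes W: "C1_on UNIV W" and K: "compact K" and out: "\<And>x. x \<notin> K \<Longrightarrow> W x = 0"
  shows "integrable lborel (\<lambda>x. fd W x v)" "(\<integral>x. fd W x v \<partial>lborel) = 0"
proof -
  have fd0: "fd W x v = 0" if "x \<notin> K" for x
  proof -
    have "fd W x = fd (\<lambda>x. 0) x"
      by (rule fd_cong_open[of "- K"]) (use that out compact_imp_closed[OF K] in \<open>auto simp: open_Compl\<close>)
    then show ?thesis by simp
  qed
  have cont: "continuous_on UNIV (\<lambda>x. fd W x v)" "continuous_on UNIV W"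
    using C1_on_continuous_fd[OF W] C1_on_continuous_on[OF W] by auto
  have bdd: "\<exists>C. \<forall>x. \<bar>u x\<bar> \<le> C" if "continuous_on UNIV u" "\<And>x. x \<notin> K \<Longrightarrow> u x = 0" for u :: "'a \<Rightarrow> real"
  proof -
    have "compact (u ` K)" by (rule compact_continuous_image[OF continuous_on_subset[OF that(1)] K]) simp
    then obtain C where "\<forall>y\<in>u ` K. norm y \<le> C" using compact_imp_bounded bounded_iff by metis
    then have "\<bar>u x\<bar> \<le> max C 0" for x using that(2)[of x] by (cases "x \<in> K") force+
    then show ?thesis by blast
  qed
  obtain C0 where C0: "\<And>x. \<bar>W x\<bar> \<le> C0" using bdd[OF cont(2) out] by blast
  obtain C where C: "\<And>x. \<bar>fd W x v\<bar> \<le> C" using bdd[OF cont(1) fd0] by blast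
  obtain R where R: "\<And>x. x \<in> K \<Longrightarrow> norm x \<le> R" using compact_imp_bounded[OF K] bounded_iff by metis
  \<comment> \<open>A fixed ball containing the supports of all translates with parameter below 1 in
    absolute value, so that a constant times its indicator dominates them simultaneously.\<close>
  define S where "S = cball (0::'a) (R + norm v)"
  have S: "x \<in> S" if "x + t *\<^sub>R v \<in> K" "\<bar>t\<bar> < 1" for x t
  proof -
    have "norm x \<le> norm (x + t *\<^sub>R v) + norm (t *\<^sub>R v)"
      by (metis add_diff_cancel_right' norm_triangle_ineq4)
    also have "norm (t *\<^sub>R v) \<le> norm v" using that(2) mult_right_mono[of "\<bar>t\<bar>" 1 "norm v"] by simp
    finally show ?thesis using R[OF that(1)] by (simp add: S_def)
  qed
  have iS: "integrable lborel (\<lambda>x. c * indicator S x)" for c :: real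
    by (intro integrable_mult_right integrable_real_indicator) (simp_all add: S_def emeasure_bounded_finite[OF bounded_cball, simplified])
  have der: "((\<lambda>t. W (x + t *\<^sub>R v)) has_real_derivative fd W (x + t *\<^sub>R v) v) (at t)" for x t
  proof -
    have "((\<lambda>t. W (x + t *\<^sub>R v)) has_derivative (\<lambda>r. fd W (x + t *\<^sub>R v) (r *\<^sub>R v))) (at t)"
      by (rule has_derivative_compose[where f = "\<lambda>t. x + t *\<^sub>R v", OF _ C1_on_has_derivative[OF W UNIV_I]])
        (auto intro!: derivative_eq_intros)
    then show ?thesis
      by (simp add: has_field_derivative_def linear_cmul[OF C1_on_linear_fd[OF W]] mult_commute_abs)
  qed
  have int: "integrable lborel (\<lambda>x. W (x + t *\<^sub>R v))" if "\<bar>t - 0\<bar> < 1" for t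
  proof (rule Bochner_Integration.integrable_bound[OF iS[of C0]])
    have "continuous_on UNIV (\<lambda>x. W (x + t *\<^sub>R v))"
      by (rule continuous_on_compose2[OF cont(2)]) (auto intro!: continuous_intros)
    then show "(\<lambda>x. W (x + t *\<^sub>R v)) \<in> borel_measurable lborel"
      by (simp add: borel_measurable_continuous_onI)
    show "AE x in lborel. norm (W (x + t *\<^sub>R v)) \<le> norm (C0 * indicator S x)"
      using C0 out S that by (intro AE_I2) (fastforce simp: indicator_def intro: order_trans[OF _ abs_ge_self])
  qed
  have bound: "\<bar>fd W (x + t *\<^sub>R v) v\<bar> \<le> C * indicator S x" if "\<bar>t - 0\<bar> < 1" for x t
    using C fd0 S that by (cases "x + t *\<^sub>R v \<in> K") (auto simp: indicator_def intro: order_trans[OF abs_ge_zero])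
  have "integrable lborel (\<lambda>x. fd W (x + 0 *\<^sub>R v) v)"
    using int der bound iS
    by (intro has_real_derivative_integral(1)[of 1 0 lborel "\<lambda>t x. W (x + t *\<^sub>R v)" "\<lambda>t x. fd W (x + t *\<^sub>R v) v" "\<lambda>x. C * indicator S x"]) auto
  then show "integrable lborel (\<lambda>x. fd W x v)" by simp
  have "((\<lambda>t. \<integral>x. W (x + t *\<^sub>R v) \<partial>lborel) has_real_derivative (\<integral>x. fd W (x + 0 *\<^sub>R v) v \<partial>lborel)) (at 0)"
    using int der bound iS
    by (intro has_real_derivative_integral(2)[of 1 0 lborel "\<lambda>t x. W (x + t *\<^sub>R v)" "\<lambda>t x. fd W (x + t *\<^sub>R v) v" "\<lambda>x. C * indicator S x"]) auto
  moreover have "(\<integral>x. W (x + t *\<^sub>R v) \<partial>lborel) = (\<integral>x. W x \<partial>lborel)" for t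
  proof -
    have m: "W \<in> borel_measurable borel" by (rule borel_measurable_continuous_onI[OF cont(2)])
    have "(\<integral>x. W x \<partial>lborel) = (\<integral>x. W x \<partial>(distr lborel borel ((+) (t *\<^sub>R v))))"
      by (simp add: lborel_distr_plus)
    also have "\<dots> = (\<integral>x. W (t *\<^sub>R v + x) \<partial>lborel)" by (rule integral_distr) (use m in auto)
    finally show ?thesis by (simp add: add.commute)
  qed
  ultimately have "((\<lambda>t. \<integral>x. W x \<partial>lborel) has_real_derivative (\<integral>x. fd W x v \<partial>lborel)) (at 0)" by simp
  then show "(\<integral>x. fd W x v \<partial>lborel) = 0" using DERIV_unique DERIV_const by blast
qed

section \<open>Change of variables\<close>

text \<open>Bridge between the gauge integral, in which the change of variables formula is stated,
  and the nonnegative Lebesgue integral that defines the volume. Borel measurability of the function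
  cut off to \<open>S\<close> allows passing between Lebesgue measure and
  \<open>lborel\<close>.\<close>

lemma absolutely_integrable_nonneg_iff:
  fixes u :: "'a::euclidean_space \<Rightarrow> real"
  assumes m: "(\<lambda>x. u x * indicator S x) \<in> borel_measurable borel" and nn: "\<And>x. x \<in> S \<Longrightarrow> 0 \<le> u x"
  shows "u absolutely_integrable_on S \<and> integral S u = b \<longleftrightarrow> (\<integral>\<^sup>+x\<in>S. ennreal (u x) \<partial>lborel) = ennreal b \<and> 0 \<le> b"
proof -
  let ?v = "\<lambda>x. u x * indicator S x"
  have v: "(\<lambda>x. indicator S x *\<^sub>R u x) = ?v" by (auto simp: mult.commute)
  have m': "?v \<in> borel_measurable lborel" using m by simp
  have nn': "0 \<le> ?v x" for x using nn by (simp add: indicator_def)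
  have ai: "u absolutely_integrable_on S \<longleftrightarrow> integrable lborel ?v"
    unfolding set_integrable_def v by (rule integrable_completion[OF m'])
  have eq: "integral S u = integral\<^sup>L lborel ?v" if "u absolutely_integrable_on S"
    using set_lebesgue_integral_eq_integral(2)[OF that] integral_completion[OF m']
    unfolding set_lebesgue_integral_def v by simp
  have nni: "(\<integral>\<^sup>+x\<in>S. ennreal (u x) \<partial>lborel) = (\<integral>\<^sup>+x. ennreal (?v x) \<partial>lborel)"
    by (intro nn_integral_cong) (auto simp: indicator_def)
  show ?thesis
  proof
    assume *: "u absolutely_integrable_on S \<and> integral S u = b"
    then have "(\<integral>\<^sup>+x. ennreal (?v x) \<partial>lborel) = ennreal b" "0 \<le> b"
      using nn_integral_eq_integral[of lborel ?v] ai eq nn' by (auto intro: integral_nonneg_AE)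
    then show "(\<integral>\<^sup>+x\<in>S. ennreal (u x) \<partial>lborel) = ennreal b \<and> 0 \<le> b" using nni by simp
  next
    assume *: "(\<integral>\<^sup>+x\<in>S. ennreal (u x) \<partial>lborel) = ennreal b \<and> 0 \<le> b"
    then have e: "(\<integral>\<^sup>+x. ennreal (?v x) \<partial>lborel) = ennreal b" using nni by simp
    have i: "integrable lborel ?v"
      by (rule integrableI_nn_integral_finite[OF m' _ e]) (use nn' in auto)
    have "integral\<^sup>L lborel ?v = b"
      using integral_eq_nn_integral[OF m'] nn' e * by simp
    then show "u absolutely_integrable_on S \<and> integral S u = b" using ai eq i by simp
  qed
qed

lemma nn_integral_change_of_variables_wellorder:
  fixes \<theta> :: "real ^ 'm::{finite,wellorder} \<Rightarrow> real ^ 'm::_"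
  assumes S: "S \<in> sets borel"
    and der: "\<And>x. x \<in> S \<Longrightarrow> (\<theta> has_derivative \<theta>' x) (at x)" and inj: "inj_on \<theta> S"
    and m1: "(\<lambda>y. w y * indicator (\<theta> ` S) y) \<in> borel_measurable borel"
    and m2: "(\<lambda>x. (\<bar>det (matrix (\<theta>' x))\<bar> * w (\<theta> x)) * indicator S x) \<in> borel_measurable borel"
    and nn: "\<And>y. y \<in> \<theta> ` S \<Longrightarrow> 0 \<le> w y"
  shows "(\<integral>\<^sup>+y\<in>\<theta> ` S. ennreal (w y) \<partial>lborel) = (\<integral>\<^sup>+x\<in>S. ennreal (\<bar>det (matrix (\<theta>' x))\<bar> * w (\<theta> x)) \<partial>lborel)"
    (is "?L = ?R")
proof -
  have S': "S \<in> sets lebesgue" using S by (simp add: sets_completionI_sets)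
  have "(\<lambda>x. \<bar>det (matrix (\<theta>' x))\<bar> * w (\<theta> x)) absolutely_integrable_on S \<and>
      integral S (\<lambda>x. \<bar>det (matrix (\<theta>' x))\<bar> * w (\<theta> x)) = b \<longleftrightarrow>
      w absolutely_integrable_on \<theta> ` S \<and> integral (\<theta> ` S) w = b" for b
    \<comment> \<open>The formula is stated for vector-valued integrands, so scalars are embedded
      into one-dimensional vectors.\<close>
    using has_absolute_integral_change_of_variables[OF S' has_derivative_at_withinI[OF der] inj,
        of "\<lambda>y. vec (w y) :: real ^ 1" "vec b"]
    by (simp add: absolutely_integrable_on_1_iff integral_on_1_eq vec_eq_iff)
  \<comment> \<open>Each finite value is attained on one side exactly when it is attained on the
    other; therefore an infinite value on one side excludes a finite one on the other.\<close>
  then have *: "?R = ennreal b \<and> 0 \<le> b \<longleftrightarrow> ?L = ennreal b \<and> 0 \<le> b" for b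
    using absolutely_integrable_nonneg_iff[OF m1 nn, of b] absolutely_integrable_nonneg_iff[OF m2, of b] nn by simp
  show ?thesis
  proof (cases ?L)
    case (real r)
    then show ?thesis using *[of r] by simp
  next
    case top
    show ?thesis
    proof (cases ?R)
      case (real r)
      then show ?thesis using *[of r] by simp
    qed (simp add: top)
  qed
qed

section \<open>Change of variables for an arbitrary finite index type\<close>

text \<open>Conjugation by \<open>\<sigma>\<close> is a bijection between the permutations of the
  two index types; it preserves signs and merely reorders the factors of each product.\<close>

lemma det_reindex:
  fixes M :: "real ^ 'b ^ 'b::finite" and \<sigma> :: "'a::finite \<Rightarrow> 'b"
  assumes \<sigma>: "bij \<sigma>"
  shows "det (\<chi> i j. M $ \<sigma> i $ \<sigma> j) = det M"
proof -
  let ?\<tau> = "inv \<sigma>"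
  have \<tau>: "bij ?\<tau>" and [simp]: "\<And>x. ?\<tau> (\<sigma> x) = x" "\<And>y. \<sigma> (?\<tau> y) = y"
    using \<sigma> by (auto simp: bij_imp_bij_inv bij_is_inj bij_is_surj surj_f_inv_f)
  have pm: "\<sigma> \<circ> p \<circ> ?\<tau> = map_permutation UNIV \<sigma> p" for p
    using bij_is_surj[OF \<sigma>] by (simp add: map_permutation_def restrict_id_def fun_eq_iff)
  have "det (\<chi> i j. M $ \<sigma> i $ \<sigma> j) = (\<Sum>p\<in>{p. p permutes UNIV}. of_int (sign p) * (\<Prod>i\<in>UNIV. M $ \<sigma> i $ \<sigma> (p i)))"
    by (simp add: det_def)
  also have "\<dots> = (\<Sum>q\<in>{q. q permutes UNIV}. of_int (sign q) * (\<Prod>k\<in>UNIV. M $ k $ q k))"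
  proof (rule sum.reindex_bij_witness[where j = "\<lambda>p. \<sigma> \<circ> p \<circ> ?\<tau>" and i = "\<lambda>q. ?\<tau> \<circ> q \<circ> \<sigma>"])
    fix p assume p: "p \<in> {p. p permutes (UNIV :: 'a set)}"
    show "?\<tau> \<circ> (\<sigma> \<circ> p \<circ> ?\<tau>) \<circ> \<sigma> = p" by (simp add: fun_eq_iff)
    show "\<sigma> \<circ> p \<circ> ?\<tau> \<in> {q. q permutes UNIV}"
      using map_permutation_permutes[of \<sigma> UNIV UNIV p] \<sigma> p by (simp add: pm)
    have "sign (\<sigma> \<circ> p \<circ> ?\<tau>) = sign p"
      unfolding pm by (rule sign_map_permutation) (use p bij_is_inj[OF \<sigma>] in auto)
    moreover have "(\<Prod>k\<in>UNIV. M $ k $ (\<sigma> \<circ> p \<circ> ?\<tau>) k) = (\<Prod>i\<in>UNIV. M $ \<sigma> i $ \<sigma> (p i))"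
      by (rule prod.reindex_bij_witness[where j = ?\<tau> and i = \<sigma>]) auto
    ultimately show "of_int (sign (\<sigma> \<circ> p \<circ> ?\<tau>)) * (\<Prod>k\<in>UNIV. M $ k $ (\<sigma> \<circ> p \<circ> ?\<tau>) k) =
        of_int (sign p) * (\<Prod>i\<in>UNIV. M $ \<sigma> i $ \<sigma> (p i))" by simp
  next
    fix q assume q: "q \<in> {q. q permutes (UNIV :: 'b set)}"
    show "\<sigma> \<circ> (?\<tau> \<circ> q \<circ> \<sigma>) \<circ> ?\<tau> = q" by (simp add: fun_eq_iff)
    have "bij q" using q permutes_bij by blast
    then have "bij (?\<tau> \<circ> q \<circ> \<sigma>)" by (intro bij_comp \<sigma> \<tau>)
    then show "?\<tau> \<circ> q \<circ> \<sigma> \<in> {p. p permutes UNIV}" using bij_imp_permutes[of _ UNIV] by blast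
  qed
  finally show ?thesis by (simp add: det_def)
qed

text \<open>The library proves the change of variables formula for coordinates indexed by a well-ordered
  type only. The following copy of an arbitrary finite index type is well-ordered.\<close>

typedef ('m::finite) ordered_index = "{..<CARD('m)}"
  by (auto intro!: exI[of _ 0])

instantiation ordered_index :: (finite) linorder
begin
definition less_eq_ordered_index :: "'a ordered_index \<Rightarrow> 'a ordered_index \<Rightarrow> bool" where
  "x \<le> y \<longleftrightarrow> Rep_ordered_index x \<le> Rep_ordered_index y"
definition less_ordered_index :: "'a ordered_index \<Rightarrow> 'a ordered_index \<Rightarrow> bool" where
  "x < y \<longleftrightarrow> Rep_ordered_index x < Rep_ordered_index y"
instance
  by standard (auto simp: less_eq_ordered_index_def less_ordered_index_def Rep_ordered_index_inject)
end

instance ordered_index :: (finite) finite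
proof
  show "finite (UNIV :: 'a ordered_index set)"
    unfolding type_definition.univ[OF type_definition_ordered_index] by simp
qed

instance ordered_index :: (finite) wellorder
proof
  fix P :: "'a ordered_index \<Rightarrow> bool" and a
  assume P: "\<And>x. (\<And>y. y < x \<Longrightarrow> P y) \<Longrightarrow> P x"
  show "P a"
  proof (rule measure_induct_rule[where f = Rep_ordered_index])
    fix x :: "'a ordered_index" assume *: "\<And>y. Rep_ordered_index y < Rep_ordered_index x \<Longrightarrow> P y"
    show "P x" by (rule P) (rule *, simp add: less_ordered_index_def)
  qed
qed

lemma ordered_index_bij: "\<exists>\<sigma> :: 'm ordered_index \<Rightarrow> 'm::finite. bij \<sigma>"
proof -
  have "bij_betw (Rep_ordered_index :: 'm ordered_index \<Rightarrow> nat) UNIV {..<CARD('m)}"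
    by (simp add: bij_betw_def inj_on_def Rep_ordered_index_inject type_definition.Rep_range[OF type_definition_ordered_index])
  moreover obtain k where "bij_betw k {0..<CARD('m)} (UNIV :: 'm set)" using ex_bij_betw_nat_finite[OF finite] by blast
  ultimately show ?thesis using bij_betw_trans by (metis atLeast0LessThan)
qed

lemma prod_Basis_vec:
  fixes f :: "real ^ 'm::finite \<Rightarrow> 'b::comm_monoid_mult"
  shows "(\<Prod>b\<in>Basis. f b) = (\<Prod>i\<in>UNIV. f (axis i 1))"
proof -
  have B: "Basis = range (\<lambda>i. axis i 1 :: real ^ 'm)" by (auto simp: Basis_vec_def)
  have "inj (\<lambda>i. axis i 1 :: real ^ 'm)" by (simp add: inj_on_def axis_eq_axis)
  then show ?thesis unfolding B by (subst prod.reindex) auto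
qed

text \<open>Boxes pull back to boxes with the same side lengths, and \<open>lborel\<close> is
  determined by its values on boxes.\<close>

lemma lborel_reindex:
  fixes \<sigma> :: "'a::finite \<Rightarrow> 'b::finite"
  assumes \<sigma>: "bij \<sigma>"
  shows "distr lborel borel (\<lambda>x :: real ^ 'b. \<chi> i. x $ \<sigma> i) = (lborel :: (real ^ 'a) measure)"
proof (rule lborel_eqI[symmetric])
  let ?R = "\<lambda>x :: real ^ 'b. (\<chi> i. x $ \<sigma> i) :: real ^ 'a" and ?R' = "\<lambda>y :: real ^ 'a. (\<chi> j. y $ inv \<sigma> j) :: real ^ 'b"
  have [simp]: "\<And>x. inv \<sigma> (\<sigma> x) = x" "\<And>y. \<sigma> (inv \<sigma> y) = y"
    using \<sigma> by (auto simp: bij_is_inj bij_is_surj surj_f_inv_f)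
  show "sets (distr lborel borel ?R) = sets borel" by simp
  fix l u :: "real ^ 'a" assume lu: "\<And>b. b \<in> Basis \<Longrightarrow> l \<bullet> b \<le> u \<bullet> b"
  then have le: "l $ i \<le> u $ i" for i by (metis axis_in_Basis_iff inner_axis inner_real_def mult.right_neutral Basis_real_def singletonI)
  have "?R \<in> borel_measurable borel"
    by (intro borel_measurable_continuous_onI continuous_on_vec_lambda continuous_intros)
  then have mR: "?R \<in> borel_measurable lborel" by simp
  have "?R -` box l u = box (?R' l) (?R' u)"
  proof (intro set_eqI)
    fix x :: "real ^ 'b"
    have "(\<forall>i. l $ i < x $ \<sigma> i \<and> x $ \<sigma> i < u $ i) \<longleftrightarrow> (\<forall>j. l $ inv \<sigma> j < x $ j \<and> x $ j < u $ inv \<sigma> j)"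
      by (metis \<open>\<And>x. inv \<sigma> (\<sigma> x) = x\<close> \<open>\<And>y. \<sigma> (inv \<sigma> y) = y\<close>)
    then show "x \<in> ?R -` box l u \<longleftrightarrow> x \<in> box (?R' l) (?R' u)" by (simp add: mem_box_cart)
  qed
  then have "emeasure (distr lborel borel ?R) (box l u) = emeasure lborel (box (?R' l) (?R' u))"
    using mR by (subst emeasure_distr) auto
  also have "\<dots> = (\<Prod>b\<in>Basis. (?R' u - ?R' l) \<bullet> b)"
    by (rule emeasure_lborel_box) (use le in \<open>auto simp: Basis_vec_def inner_axis\<close>)
  also have "\<dots> = (\<Prod>j\<in>UNIV. u $ inv \<sigma> j - l $ inv \<sigma> j)" by (simp add: prod_Basis_vec inner_axis)
  also have "\<dots> = (\<Prod>i\<in>UNIV. u $ i - l $ i)"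
    by (rule arg_cong[where f = ennreal], rule prod.reindex_bij_witness[where i = \<sigma> and j = "inv \<sigma>"]) auto
  also have "\<dots> = (\<Prod>b\<in>Basis. (u - l) \<bullet> b)" by (simp add: prod_Basis_vec inner_axis)
  finally show "emeasure (distr lborel borel ?R) (box l u) = (\<Prod>b\<in>Basis. (u - l) \<bullet> b)" .
qed

text \<open>Conjugation of \<open>\<theta>\<close> by the relabelling \<open>R\<close> and its
  inverse \<open>Q\<close> moves the problem to the well-ordered index type. Relabelling preserves
  Lebesgue measure and, by \<open>det_reindex\<close>, the Jacobian determinant.\<close>

lemma nn_integral_change_of_variables:
  fixes \<theta> :: "real ^ 'm::finite \<Rightarrow> real ^ 'm"
  assumes S: "S \<in> sets borel"
    and der: "\<And>x. x \<in> S \<Longrightarrow> (\<theta> has_derivative \<theta>' x) (at x)" and inj: "inj_on \<theta> S"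
    and m1: "(\<lambda>y. w y * indicator (\<theta> ` S) y) \<in> borel_measurable borel"
    and m2: "(\<lambda>x. (\<bar>det (matrix (\<theta>' x))\<bar> * w (\<theta> x)) * indicator S x) \<in> borel_measurable borel"
    and nn: "\<And>y. y \<in> \<theta> ` S \<Longrightarrow> 0 \<le> w y"
  shows "(\<integral>\<^sup>+y\<in>\<theta> ` S. ennreal (w y) \<partial>lborel) = (\<integral>\<^sup>+x\<in>S. ennreal (\<bar>det (matrix (\<theta>' x))\<bar> * w (\<theta> x)) \<partial>lborel)"
proof -
  obtain \<sigma> :: "'m ordered_index \<Rightarrow> 'm" where \<sigma>: "bij \<sigma>" using ordered_index_bij by blast
  define R where "R = (\<lambda>x :: real ^ 'm. (\<chi> i. x $ \<sigma> i) :: real ^ 'm ordered_index)"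
  define Q where "Q = (\<lambda>y :: real ^ 'm ordered_index. (\<chi> j. y $ inv \<sigma> j) :: real ^ 'm)"
  have s: "\<And>x. inv \<sigma> (\<sigma> x) = x" "\<And>y. \<sigma> (inv \<sigma> y) = y"
    using \<sigma> by (auto simp: bij_is_inj bij_is_surj surj_f_inv_f)
  have RQ [simp]: "R (Q y) = y" "Q (R x) = x" for x y by (simp_all add: R_def Q_def vec_eq_iff s)
  have lin: "linear R" "linear Q" by (auto intro!: linearI simp: R_def Q_def vec_eq_iff)
  have bl: "bounded_linear R" "bounded_linear Q" using lin by (simp_all add: linear_conv_bounded_linear)
  have mR: "R \<in> borel_measurable borel" and mQ: "Q \<in> borel_measurable borel"
    using bl by (auto intro!: borel_measurable_continuous_onI linear_continuous_on)
  have dR: "distr lborel borel R = lborel" unfolding R_def by (rule lborel_reindex[OF \<sigma>])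
  have tr: "(\<integral>\<^sup>+y. k y \<partial>lborel) = (\<integral>\<^sup>+x. k (R x) \<partial>lborel)" if "k \<in> borel_measurable borel" for k :: "_ \<Rightarrow> ennreal"
    using nn_integral_distr[of R lborel borel k] mR that by (simp add: dR)
  define \<eta> where "\<eta> = R \<circ> \<theta> \<circ> Q"
  define \<eta>' where "\<eta>' = (\<lambda>y. R \<circ> \<theta>' (Q y) \<circ> Q)"
  define T where "T = Q -` S"
  have T: "T \<in> sets borel" unfolding T_def using measurable_sets[OF mQ S] by simp
  have \<eta>T: "\<eta> ` T = Q -` (\<theta> ` S)"
  proof (intro set_eqI iffI)
    fix y assume "y \<in> \<eta> ` T"
    then show "y \<in> Q -` (\<theta> ` S)" by (auto simp: \<eta>_def T_def)
  next
    fix y assume "y \<in> Q -` (\<theta> ` S)"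
    then obtain x where x: "x \<in> S" "Q y = \<theta> x" by auto
    then have "y = \<eta> (R x)" unfolding \<eta>_def by (metis RQ comp_apply)
    then show "y \<in> \<eta> ` T" using x by (auto simp: T_def)
  qed
  have d\<eta>: "(\<eta> has_derivative \<eta>' y) (at y)" if "y \<in> T" for y
    unfolding \<eta>_def \<eta>'_def
  proof -
    have "Q y \<in> S" using that by (simp add: T_def)
    from diff_chain_at[OF der[OF this] bounded_linear_imp_has_derivative[OF bl(1)]]
    show "(R \<circ> \<theta> \<circ> Q has_derivative R \<circ> \<theta>' (Q y) \<circ> Q) (at y)"
      by (rule diff_chain_at[OF bounded_linear_imp_has_derivative[OF bl(2)]])
  qed
  have inj\<eta>: "inj_on \<eta> T"
  proof (rule inj_onI)
    fix y z assume yz: "y \<in> T" "z \<in> T" "\<eta> y = \<eta> z"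
    then have "\<theta> (Q y) = \<theta> (Q z)" unfolding \<eta>_def comp_def by (metis RQ(2))
    then have "Q y = Q z" using inj_onD[OF inj] yz by (simp add: T_def)
    then show "y = z" by (metis RQ(1))
  qed
  have Qax: "Q (axis j 1) = axis (\<sigma> j) 1" for j
    using s by (auto simp: Q_def vec_eq_iff axis_def)
  have "matrix (\<eta>' y) = (\<chi> i j. matrix (\<theta>' (Q y)) $ \<sigma> i $ \<sigma> j)" for y
    by (simp add: \<eta>'_def matrix_def Qax vec_eq_iff) (simp add: R_def)
  then have det: "det (matrix (\<eta>' y)) = det (matrix (\<theta>' (Q y)))" for y
    using det_reindex[OF \<sigma>] by simp
  have ind: "indicator (\<eta> ` T) y = (indicator (\<theta> ` S) (Q y) :: real)" "indicator T y = (indicator S (Q y) :: real)" for y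
    unfolding \<eta>T by (auto simp: T_def indicator_def)
  have \<eta>Q: "Q (\<eta> y) = \<theta> (Q y)" for y by (simp add: \<eta>_def)
  have n1: "(\<lambda>y. w (Q y) * indicator (\<eta> ` T) y) \<in> borel_measurable borel"
    unfolding ind using measurable_compose[OF mQ m1] .
  have n2: "(\<lambda>y. (\<bar>det (matrix (\<eta>' y))\<bar> * w (Q (\<eta> y))) * indicator T y) \<in> borel_measurable borel"
    unfolding ind det \<eta>Q using measurable_compose[OF mQ m2] .
  have e: "ennreal a * indicator A x = ennreal (a * indicator A x)" for a :: real and A and x :: "real ^ 'k"
    by (simp add: indicator_def)
  have e': "ennreal a * indicator A x = ennreal (a * indicator A x)" for a :: real and A and x :: "real ^ 'm ordered_index"
    by (simp add: indicator_def)
  have "(\<integral>\<^sup>+y\<in>\<theta> ` S. ennreal (w y) \<partial>lborel) = (\<integral>\<^sup>+y\<in>\<eta> ` T. ennreal (w (Q y)) \<partial>lborel)"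
    unfolding e e' by (subst tr) (use n1 in \<open>simp_all add: ind\<close>)
  also have "\<dots> = (\<integral>\<^sup>+y\<in>T. ennreal (\<bar>det (matrix (\<eta>' y))\<bar> * w (Q (\<eta> y))) \<partial>lborel)"
    by (rule nn_integral_change_of_variables_wellorder[OF T d\<eta> inj\<eta> n1 n2]) (use nn in \<open>auto simp: \<eta>T\<close>)
  also have "\<dots> = (\<integral>\<^sup>+x\<in>S. ennreal (\<bar>det (matrix (\<theta>' x))\<bar> * w (\<theta> x)) \<partial>lborel)"
    unfolding e e' by (subst tr) (use n2 in \<open>simp_all add: ind det \<eta>Q\<close>)
  finally show ?thesis .
qed

section \<open>Charts and the Riemannian volume\<close>

abbreviation cdom :: "('p, 'm::finite) chart \<Rightarrow> (real ^ 'm) set" where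
  "cdom c \<equiv> snd c ` fst c"

definition transition :: "('p, 'm::finite) chart \<Rightarrow> ('p, 'm) chart \<Rightarrow> real ^ 'm \<Rightarrow> real ^ 'm" where
  "transition c d = snd d \<circ> chart_inv c"

lemma is_chartD:
  fixes c :: "('p::topological_space, 'm::finite) chart"
  assumes c: "is_chart c"
  shows "open (fst c)" "open (cdom c)" "continuous_on (fst c) (snd c)" "continuous_on (cdom c) (chart_inv c)"
    "p \<in> fst c \<Longrightarrow> chart_inv c (snd c p) = p" "x \<in> cdom c \<Longrightarrow> chart_inv c x \<in> fst c"
    "x \<in> cdom c \<Longrightarrow> snd c (chart_inv c x) = x"
proof -
  have h: "homeomorphism (fst c) (cdom c) (snd c) (chart_inv c)" and "open (fst c)" "open (cdom c)"
    using c by (auto simp: is_chart_def)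
  then show "open (fst c)" "open (cdom c)" "continuous_on (fst c) (snd c)" "continuous_on (cdom c) (chart_inv c)"
    "p \<in> fst c \<Longrightarrow> chart_inv c (snd c p) = p" "x \<in> cdom c \<Longrightarrow> chart_inv c x \<in> fst c"
    "x \<in> cdom c \<Longrightarrow> snd c (chart_inv c x) = x"
    by (auto simp: homeomorphism_def)
qed

lemma chart_image_eq:
  assumes c: "is_chart c"
  shows "snd c ` (fst c \<inter> S) = cdom c \<inter> chart_inv c -` S"
  using is_chartD[OF c] by (force simp: image_iff)

lemma open_chart_image:
  assumes c: "is_chart c" and S: "open S"
  shows "open (snd c ` (fst c \<inter> S))"
proof -
  have "open (chart_inv c -` S \<inter> cdom c)"
    using continuous_on_open_vimage[OF is_chartD(2)[OF c]] is_chartD(4)[OF c] S by blast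
  then show ?thesis unfolding chart_image_eq[OF c] by (simp add: Int_commute)
qed

lemma open_chart_preimage:
  assumes c: "is_chart c" and W: "open W"
  shows "open (fst c \<inter> snd c -` W)"
  using continuous_on_open_vimage[OF is_chartD(1)[OF c], of "snd c"] is_chartD(3)[OF c] W
  by (auto simp: Int_commute)

section \<open>Transition maps and tangent vectors in charts\<close>

locale atlas =
  fixes A :: "('p::{t2_space,second_countable_topology}, 'm::finite) chart set"
  assumes smooth_atlas: "smooth_atlas A"
begin

lemma is_chart: "c \<in> A \<Longrightarrow> is_chart c"
  using smooth_atlas by (simp add: smooth_atlas_def)

lemmas chart = is_chartD[OF is_chart]

lemma chart_at: "chart_at A p \<in> A" "p \<in> fst (chart_at A p)"
proof -
  have "p \<in> (\<Union>c\<in>A. fst c)" using smooth_atlas by (simp add: smooth_atlas_def)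
  then have "\<exists>c. c \<in> A \<and> p \<in> fst c" by blast
  then have "chart_at A p \<in> A \<and> p \<in> fst (chart_at A p)" unfolding chart_at_def by (rule someI_ex)
  then show "chart_at A p \<in> A" "p \<in> fst (chart_at A p)" by auto
qed

lemma overlap_eq: "c \<in> A \<Longrightarrow> snd c ` (fst c \<inter> fst d) = cdom c \<inter> chart_inv c -` fst d"
  by (rule chart_image_eq[OF is_chart])

lemma open_overlap: "c \<in> A \<Longrightarrow> d \<in> A \<Longrightarrow> open (snd c ` (fst c \<inter> fst d))"
  by (rule open_chart_image[OF is_chart chart(1)])

lemma transition_C1:
  assumes "c \<in> A" "d \<in> A"
  shows "C1_on (snd c ` (fst c \<inter> fst d)) (transition c d)"
    "C1_on (snd c ` (fst c \<inter> fst d)) (\<lambda>x. fd (transition c d) x v)"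
proof -
  have "smooth_on (snd c ` (fst c \<inter> fst d)) (transition c d)"
    using smooth_atlas assms by (simp add: smooth_atlas_def transition_def)
  then show "C1_on (snd c ` (fst c \<inter> fst d)) (transition c d)"
    "C1_on (snd c ` (fst c \<inter> fst d)) (\<lambda>x. fd (transition c d) x v)"
    using smooth_on_imp_C1_on smooth_on_imp_C1_on_fd open_overlap[OF assms] by blast+
qed

lemma transition_snd: "c \<in> A \<Longrightarrow> p \<in> fst c \<Longrightarrow> transition c d (snd c p) = snd d p"
  by (simp add: transition_def chart(5))

lemma transition_image:
  assumes "c \<in> A" "d \<in> A"
  shows "transition c d ` (snd c ` (fst c \<inter> fst d)) \<subseteq> snd d ` (fst d \<inter> fst c)"
  using assms by (auto simp: transition_snd)

lemma transition_image_cdom: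
  assumes "c \<in> A" "d \<in> A"
  shows "transition c d ` (snd c ` (fst c \<inter> fst d)) \<subseteq> cdom d"
  using transition_image[OF assms] by blast

lemma linear_fd_transition:
  assumes "c \<in> A" "d \<in> A" "p \<in> fst c" "p \<in> fst d"
  shows "linear (fd (transition c d) (snd c p))"
  using C1_on_linear_fd[OF transition_C1(1)[OF assms(1,2)]] assms by blast

text \<open>Chain rule on the triple overlap. With \<open>e = c\<close> it shows that the Jacobians
  are invertible; with the chart fixed at \<open>p\<close> as \<open>e\<close> it gives the
  transformation of components.\<close>

lemma fd_transition_chain:
  assumes c: "c \<in> A" "p \<in> fst c" and d: "d \<in> A" "p \<in> fst d" and e: "e \<in> A" "p \<in> fst e"
  shows "fd (transition c e) (snd c p) v = fd (transition d e) (snd d p) (fd (transition c d) (snd c p) v)"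
proof -
  let ?S = "snd c ` (fst c \<inter> (fst d \<inter> fst e))"
  have S: "open ?S" by (rule open_chart_image[OF is_chart[OF c(1)]]) (simp add: chart(1) d e open_Int)
  have x: "snd c p \<in> ?S" using c d e by blast
  have "fd (transition c e) (snd c p) = fd (\<lambda>x. transition d e (transition c d x)) (snd c p)"
    by (rule fd_cong_open[OF S x]) (use c d e in \<open>auto simp: transition_snd\<close>)
  also have "\<dots> = (\<lambda>v. fd (transition d e) (transition c d (snd c p)) (fd (transition c d) (snd c p) v))"
    by (rule fd_compose[OF transition_C1(1)[OF c(1) d(1)] transition_C1(1)[OF d(1) e(1)]])
      (use c d e in \<open>auto simp: transition_snd\<close>)
  finally show ?thesis using c by (simp add: transition_snd)
qed

lemma fd_transition_self:
  assumes c: "c \<in> A" "p \<in> fst c"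
  shows "fd (transition c c) (snd c p) v = v"
proof -
  have "fd (transition c c) (snd c p) = fd (\<lambda>x. x) (snd c p)"
    by (rule fd_cong_open[OF chart(2)[OF c(1)]]) (use c in \<open>auto simp: transition_snd\<close>)
  then show ?thesis by simp
qed

lemma fd_transition_inverse:
  assumes c: "c \<in> A" "p \<in> fst c" and d: "d \<in> A" "p \<in> fst d"
  shows "fd (transition d c) (snd d p) (fd (transition c d) (snd c p) v) = v"
  using fd_transition_chain[OF c d c] fd_transition_self[OF c] by simp

lemma inj_fd_transition:
  assumes c: "c \<in> A" "p \<in> fst c" and d: "d \<in> A" "p \<in> fst d"
  shows "inj (fd (transition c d) (snd c p))"
  using fd_transition_inverse[OF assms] by (metis injI)

lemma from_chart_eq: "from_chart A c p = fd (transition c (chart_at A p)) (snd c p)"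
  by (simp add: from_chart_def transition_def)

lemma linear_from_chart: "c \<in> A \<Longrightarrow> p \<in> fst c \<Longrightarrow> linear (from_chart A c p)"
  unfolding from_chart_eq by (rule linear_fd_transition) (auto simp: chart_at)

lemma inj_from_chart: "c \<in> A \<Longrightarrow> p \<in> fst c \<Longrightarrow> inj (from_chart A c p)"
  unfolding from_chart_eq by (rule inj_fd_transition) (auto simp: chart_at)

lemma from_chart_transition:
  assumes "c \<in> A" "p \<in> fst c" "d \<in> A" "p \<in> fst d"
  shows "from_chart A c p v = from_chart A d p (fd (transition c d) (snd c p) v)"
  unfolding from_chart_eq by (rule fd_transition_chain) (auto simp: chart_at assms)

lemma from_chart_self: "from_chart A (chart_at A p) p v = v"
  unfolding from_chart_eq by (rule fd_transition_self) (auto simp: chart_at)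

end

section \<open>Riemannian metrics in charts\<close>

locale riemannian = atlas A for A :: "('p::{t2_space,second_countable_topology}, 'm::finite) chart set" +
  fixes g :: "'p \<Rightarrow> real ^ 'm \<Rightarrow> real ^ 'm \<Rightarrow> real"
  assumes riemannian: "riemannian_manifold A g"
begin

lemma inner_product_g: "inner_product (g p)"
  using riemannian by (simp add: riemannian_manifold_def)

lemma metric_in_snd:
  "c \<in> A \<Longrightarrow> p \<in> fst c \<Longrightarrow> metric_in A g c (snd c p) = (\<lambda>u v. g p (from_chart A c p u) (from_chart A c p v))"
  by (intro ext) (simp add: metric_in_def chart(5))

lemma metric_in_at: "metric_in A g (chart_at A p) (snd (chart_at A p) p) = g p"
  by (simp add: metric_in_snd chart_at from_chart_self)

lemma inner_product_metric_in:
  assumes "c \<in> A" "x \<in> cdom c" shows "inner_product (metric_in A g c x)"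
proof -
  obtain p where p: "p \<in> fst c" "x = snd c p" using assms by blast
  show ?thesis
    unfolding p(2) metric_in_snd[OF assms(1) p(1)]
    by (rule inner_product_pullback[OF inner_product_g linear_from_chart[OF assms(1) p(1)] inj_from_chart[OF assms(1) p(1)]])
qed

lemma C1_metric_in:
  assumes c: "c \<in> A" shows "C1_metric (cdom c) (metric_in A g c)"
proof -
  have "C1_on (cdom c) (\<lambda>x. metric_in A g c x u v)" for u v
    by (rule smooth_on_imp_C1_on[OF _ chart(2)[OF c] subset_refl])
      (use riemannian c in \<open>simp add: riemannian_manifold_def\<close>)
  then show ?thesis
    unfolding C1_metric_def using chart(2)[OF c] inner_product_metric_in[OF c] by simp
qed

text \<open>\<open>from_chart\<close> factors through the Jacobian of the transition map. Transition
  maps are thus isometries of the coordinate metrics, as \<open>div_form_transform\<close>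
  demands.\<close>

lemma metric_in_transition:
  assumes c: "c \<in> A" and d: "d \<in> A" and x: "x \<in> snd c ` (fst c \<inter> fst d)"
  shows "metric_in A g c x u v = metric_in A g d (transition c d x) (fd (transition c d) x u) (fd (transition c d) x v)"
proof -
  obtain p where p: "p \<in> fst c" "p \<in> fst d" "x = snd c p" using x by blast
  show ?thesis
    unfolding p(3) transition_snd[OF c p(1)] metric_in_snd[OF c p(1)] metric_in_snd[OF d p(2)]
    by (simp add: from_chart_transition[OF c p(1) d p(2)])
qed

lemma metric_trace_in:
  fixes F :: "real ^ 'm \<Rightarrow> real ^ 'm \<Rightarrow> 'b::real_vector"
  assumes c: "c \<in> A" "p \<in> fst c" and F: "bilinear F"
  shows "metric_trace (g p) F =
    metric_trace (metric_in A g c (snd c p)) (\<lambda>u v. F (from_chart A c p u) (from_chart A c p v))"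
  unfolding metric_in_snd[OF c]
  by (rule metric_trace_pullback[OF inner_product_g linear_from_chart[OF c] inj_from_chart[OF c] F, symmetric])

section \<open>Volume density and existence of the Riemannian measure\<close>

definition rho :: "('p, 'm) chart \<Rightarrow> real ^ 'm \<Rightarrow> real" where
  "rho c x = sqrt (det (gram (metric_in A g c x)))"

lemma rho_C1: "c \<in> A \<Longrightarrow> C1_on (cdom c) (rho c)"
  unfolding rho_def
  by (intro C1_on_sqrt C1_on_det_gram[OF C1_metric_in] det_gram_pos inner_product_metric_in)

lemma rho_pos: "c \<in> A \<Longrightarrow> x \<in> cdom c \<Longrightarrow> rho c x > 0"
  by (simp add: rho_def det_gram_pos inner_product_metric_in)

lemma rho_transition:
  assumes c: "c \<in> A" and d: "d \<in> A" and x: "x \<in> snd c ` (fst c \<inter> fst d)"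
  shows "rho c x = \<bar>det (matrix (fd (transition c d) x))\<bar> * rho d (transition c d x)"
proof -
  have y: "transition c d x \<in> cdom d" using transition_image_cdom[OF c d] x by blast
  have "metric_in A g c x = (\<lambda>u v. metric_in A g d (transition c d x) (fd (transition c d) x u) (fd (transition c d) x v))"
    by (intro ext metric_in_transition[OF assms])
  then show ?thesis
    unfolding rho_def
    by (simp add: sqrt_det_gram_pullback[OF inner_product_metric_in[OF d y] C1_on_linear_fd[OF transition_C1(1)[OF c d] x]])
qed

definition chart_volume :: "('p, 'm) chart \<Rightarrow> 'p set \<Rightarrow> ennreal" where
  "chart_volume c S = (\<integral>\<^sup>+x\<in>snd c ` S. ennreal (rho c x) \<partial>lborel)"

lemma chart_image_borel:
  assumes c: "c \<in> A" and S: "S \<in> sets borel" "S \<subseteq> fst c"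
  shows "snd c ` S \<in> sets borel"
proof -
  have "chart_inv c \<in> measurable (restrict_space borel (cdom c)) borel"
    by (rule borel_measurable_continuous_on_restrict[OF chart(4)[OF c]])
  from measurable_sets[OF this S(1)]
  have "chart_inv c -` S \<inter> cdom c \<in> sets (restrict_space borel (cdom c))" by (simp add: space_restrict_space)
  then have "chart_inv c -` S \<inter> cdom c \<in> sets borel"
    using chart(2)[OF c] by (subst (asm) sets_restrict_space_iff) auto
  moreover have "snd c ` S = chart_inv c -` S \<inter> cdom c"
  proof -
    have "fst c \<inter> S = S" using S(2) by blast
    then show ?thesis using chart_image_eq[OF is_chart[OF c], of S] by auto
  qed
  ultimately show ?thesis by simp
qed

lemma rho_measurable:
  assumes c: "c \<in> A" and S: "S \<in> sets borel" "S \<subseteq> cdom c"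
  shows "(\<lambda>x. rho c x * indicator S x) \<in> borel_measurable borel"
  using borel_measurable_continuous_on_indicator[OF S(1) continuous_on_subset[OF C1_on_continuous_on[OF rho_C1[OF c]] S(2)]]
  by (simp add: mult.commute)

text \<open>By \<open>rho_transition\<close> the density absorbs the Jacobian factor of the change
  of variables, so the volume computed in one chart agrees with the other.\<close>

lemma chart_volume_transition:
  assumes c: "c \<in> A" and d: "d \<in> A" and S: "S \<in> sets borel" "S \<subseteq> fst c" "S \<subseteq> fst d"
  shows "chart_volume c S = chart_volume d S"
proof -
  let ?S = "snd c ` S"
  have ov: "?S \<subseteq> snd c ` (fst c \<inter> fst d)" using S by blast
  have im: "transition c d ` ?S = snd d ` S"
    using S(2) c by (force simp: image_image transition_snd)
  have r: "rho c x = \<bar>det (matrix (fd (transition c d) x))\<bar> * rho d (transition c d x)" if "x \<in> ?S" for x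
    by (rule rho_transition[OF c d]) (use ov that in blast)
  have "(\<integral>\<^sup>+y\<in>transition c d ` ?S. ennreal (rho d y) \<partial>lborel) =
      (\<integral>\<^sup>+x\<in>?S. ennreal (\<bar>det (matrix (fd (transition c d) x))\<bar> * rho d (transition c d x)) \<partial>lborel)"
  proof (rule nn_integral_change_of_variables)
    show "?S \<in> sets borel" by (rule chart_image_borel[OF c S(1,2)])
    show "(transition c d has_derivative fd (transition c d) x) (at x)" if "x \<in> ?S" for x
      by (rule C1_on_has_derivative[OF transition_C1(1)[OF c d]]) (use ov that in blast)
    show "inj_on (transition c d) ?S"
    proof (rule inj_onI)
      fix x y assume "x \<in> ?S" "y \<in> ?S" "transition c d x = transition c d y"
      then obtain p q where "p \<in> S" "q \<in> S" "x = snd c p" "y = snd c q" "snd d p = snd d q"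
        using S(2) c by (auto simp: transition_snd subset_eq)
      then show "x = y" using chart(5)[OF d] S(3) by (metis subsetD)
    qed
    show "(\<lambda>y. rho d y * indicator (transition c d ` ?S) y) \<in> borel_measurable borel"
      unfolding im by (rule rho_measurable[OF d chart_image_borel[OF d S(1,3)]]) (use S in blast)
    have "(\<lambda>x. \<bar>det (matrix (fd (transition c d) x))\<bar> * rho d (transition c d x) * indicator ?S x) =
        (\<lambda>x. rho c x * indicator ?S x)"
      using r by (auto simp: indicator_def)
    then show "(\<lambda>x. \<bar>det (matrix (fd (transition c d) x))\<bar> * rho d (transition c d x) * indicator ?S x) \<in> borel_measurable borel"
      using rho_measurable[OF c chart_image_borel[OF c S(1,2)]] S(2) by auto
    show "0 \<le> rho d y" if "y \<in> transition c d ` ?S" for y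
      using rho_pos[OF d, of y] that S(3) unfolding im by (auto intro: less_imp_le)
  qed
  also have "\<dots> = chart_volume c S"
    unfolding chart_volume_def using r by (intro nn_integral_cong) (auto simp: indicator_def)
  finally show ?thesis by (simp add: chart_volume_def im)
qed

text \<open>The value \<open>undefined\<close> outside the coordinate domain makes the inverse chart
  a total measurable map; it carries no mass because the density vanishes there.\<close>

definition chart_measure :: "('p, 'm) chart \<Rightarrow> 'p measure" where
  "chart_measure c = distr (density lborel (\<lambda>x. ennreal (rho c x * indicator (cdom c) x))) borel
     (\<lambda>x. if x \<in> cdom c then chart_inv c x else undefined)"

lemma chart_inv_measurable:
  assumes c: "c \<in> A"
  shows "(\<lambda>x. if x \<in> cdom c then chart_inv c x else undefined) \<in> borel_measurable borel"
proof (rule measurable_If_restrict_space_iff[THEN iffD2])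
  show "{x \<in> space borel. x \<in> cdom c} \<in> sets borel" using chart(2)[OF c] by simp
  have "chart_inv c \<in> measurable (restrict_space borel (cdom c)) borel"
    by (rule borel_measurable_continuous_on_restrict[OF chart(4)[OF c]])
  then show "chart_inv c \<in> restrict_space borel {x. x \<in> cdom c} \<rightarrow>\<^sub>M borel \<and>
    (\<lambda>x. undefined) \<in> restrict_space borel {x. x \<notin> cdom c} \<rightarrow>\<^sub>M borel" by simp
qed

lemma sets_chart_measure [simp, measurable_cong]: "sets (chart_measure c) = sets borel"
  by (simp add: chart_measure_def)

lemma emeasure_chart_measure:
  assumes c: "c \<in> A" and S: "S \<in> sets borel"
  shows "emeasure (chart_measure c) S = chart_volume c (S \<inter> fst c)"
proof -
  let ?f = "\<lambda>x. if x \<in> cdom c then chart_inv c x else undefined"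
  have m: "(\<lambda>x. rho c x * indicator (cdom c) x) \<in> borel_measurable borel"
    by (rule rho_measurable[OF c]) (use chart(2)[OF c] in auto)
  have "emeasure (chart_measure c) S = emeasure (density lborel (\<lambda>x. ennreal (rho c x * indicator (cdom c) x))) (?f -` S)"
    unfolding chart_measure_def using chart_inv_measurable[OF c] S by (subst emeasure_distr) auto
  also have "\<dots> = (\<integral>\<^sup>+x\<in>?f -` S. ennreal (rho c x * indicator (cdom c) x) \<partial>lborel)"
    using m measurable_sets[OF chart_inv_measurable[OF c] S] by (subst emeasure_density) auto
  also have "\<dots> = chart_volume c (S \<inter> fst c)"
    unfolding chart_volume_def
  proof (rule nn_integral_cong)
    fix x
    have "snd c ` (S \<inter> fst c) = cdom c \<inter> chart_inv c -` S"
      using chart_image_eq[OF is_chart[OF c], of S] by (simp add: Int_commute)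
    then show "ennreal (rho c x * indicator (cdom c) x) * indicator (?f -` S) x =
        ennreal (rho c x) * indicator (snd c ` (S \<inter> fst c)) x"
      by (auto simp: indicator_def)
  qed
  finally show ?thesis .
qed

definition is_volume :: "'p measure \<Rightarrow> bool" where
  "is_volume \<mu> \<longleftrightarrow> sets \<mu> = sets borel \<and> (\<forall>c\<in>A. \<forall>S\<in>sets borel. S \<subseteq> fst c \<longrightarrow> emeasure \<mu> S = chart_volume c S)"

lemma riemannian_volume_eq: "riemannian_volume A g = (THE \<mu>. is_volume \<mu>)"
  unfolding riemannian_volume_def is_volume_def chart_volume_def rho_def gram_def ..

lemma finite_chart_cover:
  assumes cpt: "compact (UNIV :: 'p set)"
  obtains C :: "nat \<Rightarrow> ('p, 'm) chart" and n where "\<And>k. k < n \<Longrightarrow> C k \<in> A" "(\<Union>k<n. fst (C k)) = UNIV"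
proof -
  have "UNIV \<subseteq> (\<Union>c\<in>A. fst c)" using smooth_atlas by (simp add: smooth_atlas_def)
  then obtain F where F: "F \<subseteq> A" "finite F" "UNIV \<subseteq> (\<Union>c\<in>F. fst c)"
    using compactE_image[OF cpt, of A fst] chart(1) by metis
  obtain C where "bij_betw C {0..<card F} F" using ex_bij_betw_nat_finite[OF F(2)] by blast
  then have "C ` {..<card F} = F" by (simp add: bij_betw_def atLeast0LessThan)
  note CF = this
  have "C k \<in> A" if "k < card F" for k using CF F(1) that by blast
  moreover have "(\<Union>k<card F. fst (C k)) = (\<Union>c\<in>C ` {..<card F}. fst c)" by simp
  ultimately show ?thesis using that[of "card F" C] F(3) unfolding CF by auto
qed

text \<open>The compact space is cut into finitely many disjoint Borel pieces, each inside a chart,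
  and the chart measures of the pieces are added. Agreement of chart volumes on overlaps makes the
  sum correct in every chart, and a Borel measure is determined by its restrictions to the
  pieces.\<close>

lemma ex1_volume:
  assumes cpt: "compact (UNIV :: 'p set)"
  shows "\<exists>!\<mu>. is_volume \<mu>"
proof -
  obtain C :: "nat \<Rightarrow> ('p, 'm) chart" and n where C: "\<And>k. k < n \<Longrightarrow> C k \<in> A" "(\<Union>k<n. fst (C k)) = UNIV"
    using finite_chart_cover[OF cpt] by metis
  \<comment> \<open>Disjoint Borel pieces: points are assigned to the first chart of the cover that
    contains them.\<close>
  define D where "D = (\<lambda>k. fst (C k) - (\<Union>j<k. fst (C j)))"
  have Db: "D k \<in> sets borel" if "k < n" for k
  proof -
    have "fst (C j) \<in> sets borel" if "j < n" for j using borel_open[OF chart(1)[OF C(1)[OF that]]] .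
    then show ?thesis unfolding D_def using that by (intro sets.Diff sets.finite_UN) auto
  qed
  have disj: "disjoint_family_on D {..<n}"
    unfolding disjoint_family_on_def D_def by (auto simp: linorder_neq_iff)
  have UD: "(\<Union>k<n. D k) = UNIV"
  proof -
    have "p \<in> (\<Union>k<n. D k)" for p
    proof -
      have ex: "\<exists>k. k < n \<and> p \<in> fst (C k)" using C(2) by blast
      define k where "k = (LEAST k. k < n \<and> p \<in> fst (C k))"
      have "k < n \<and> p \<in> fst (C k)" unfolding k_def using LeastI_ex[OF ex] .
      moreover have "p \<notin> fst (C j)" if "j < k" for j
        using not_less_Least[of j "\<lambda>k. k < n \<and> p \<in> fst (C k)", folded k_def] that calculation by simp
      ultimately show ?thesis by (auto simp: D_def)
    qed
    then show ?thesis by blast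
  qed
  define m where "m = (\<lambda>S. \<Sum>k<n. emeasure (chart_measure (C k)) (S \<inter> D k))"
  define \<mu> where "\<mu> = measure_of UNIV (sets borel) m"
  have sets_\<mu>: "sets \<mu> = sets borel"
    unfolding \<mu>_def using sets.sigma_sets_eq[of borel] by simp
  have e\<mu>: "emeasure \<mu> S = m S" if "S \<in> sets borel" for S
    unfolding \<mu>_def
  proof (rule emeasure_measure_of_sigma)
    show "sigma_algebra UNIV (sets (borel :: 'p measure))" using sets.sigma_algebra_axioms[of "borel :: 'p measure"] by simp
    show "positive (sets borel) m" by (simp add: positive_def m_def)
    show "countably_additive (sets borel) m"
    proof (rule countably_additiveI)
      fix F :: "nat \<Rightarrow> 'p set" assume F: "range F \<subseteq> sets borel" "disjoint_family F" "(\<Union>i. F i) \<in> sets borel"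
      have "(\<Sum>i. m (F i)) = (\<Sum>k<n. \<Sum>i. emeasure (chart_measure (C k)) (F i \<inter> D k))"
        unfolding m_def by (rule suminf_sum) simp
      also have "\<dots> = (\<Sum>k<n. emeasure (chart_measure (C k)) (\<Union>i. F i \<inter> D k))"
        by (intro sum.cong refl suminf_emeasure)
          (use F Db in \<open>auto simp: disjoint_family_on_def\<close>)
      also have "\<dots> = (\<Sum>k<n. emeasure (chart_measure (C k)) ((\<Union>i. F i) \<inter> D k))"
        by (simp only: Int_UN_distrib2[symmetric] UN_simps(4))
      finally show "(\<Sum>i. m (F i)) = m (\<Union>i. F i)" unfolding m_def .
    qed
  qed (use that in simp)
  \<comment> \<open>Stated for an arbitrary Borel measure because it serves three purposes:
    reassembling a chart measure, and evaluating both the constructed measure and a competing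
    one.\<close>
  have split: "emeasure \<mu>' S = (\<Sum>k<n. emeasure \<mu>' (S \<inter> D k))"
    if "sets \<mu>' = sets borel" "S \<in> sets borel" for \<mu>' :: "'p measure" and S
  proof -
    have "disjoint_family_on (\<lambda>k. S \<inter> D k) {..<n}"
      using disj unfolding disjoint_family_on_def by blast
    moreover have "(\<lambda>k. S \<inter> D k) ` {..<n} \<subseteq> sets \<mu>'" using that Db by auto
    ultimately have "(\<Sum>k<n. emeasure \<mu>' (S \<inter> D k)) = emeasure \<mu>' (\<Union>k<n. S \<inter> D k)"
      by (intro sum_emeasure) auto
    moreover have "(\<Union>k<n. S \<inter> D k) = S" using UD by blast
    ultimately show ?thesis by simp
  qed
  have DC: "D k \<subseteq> fst (C k)" for k by (auto simp: D_def)
  have vol: "is_volume \<mu>"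
    unfolding is_volume_def
  proof (intro conjI ballI impI sets_\<mu>)
    fix c S assume c: "c \<in> A" and S: "S \<in> sets borel" "S \<subseteq> fst c"
    have "emeasure \<mu> S = (\<Sum>k<n. chart_volume (C k) (S \<inter> D k))"
      unfolding e\<mu>[OF S(1)] m_def
    proof (rule sum.cong[OF refl])
      fix k assume k: "k \<in> {..<n}"
      then show "emeasure (chart_measure (C k)) (S \<inter> D k) = chart_volume (C k) (S \<inter> D k)"
        using emeasure_chart_measure[OF C(1), of k "S \<inter> D k"] S Db[of k] DC[of k]
        by (simp add: Int_assoc Int_absorb2)
    qed
    \<comment> \<open>Each piece of \<open>S\<close> lies in the domain of \<open>c\<close> and in
      that of \<open>C k\<close>, so the two chart volumes coincide there.\<close>
    also have "\<dots> = (\<Sum>k<n. emeasure (chart_measure c) (S \<inter> D k))"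
    proof (rule sum.cong[OF refl])
      fix k assume k: "k \<in> {..<n}"
      have sub: "S \<inter> D k \<subseteq> fst c" "S \<inter> D k \<subseteq> fst (C k)" using S DC by auto
      have "S \<inter> D k \<in> sets borel" using S Db k by auto
      then show "chart_volume (C k) (S \<inter> D k) = emeasure (chart_measure c) (S \<inter> D k)"
        using chart_volume_transition[OF C(1) c, of k "S \<inter> D k"] emeasure_chart_measure[OF c, of "S \<inter> D k"] sub k
        by (simp add: Int_absorb2)
    qed
    also have "\<dots> = emeasure (chart_measure c) S" by (rule split[symmetric]) (use S in auto)
    also have "\<dots> = chart_volume c S" using emeasure_chart_measure[OF c S(1)] S(2) by (simp add: Int_absorb2)
    finally show "emeasure \<mu> S = chart_volume c S" .
  qed
  show ?thesis
  proof (rule ex1I[where P = is_volume, OF vol])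
    fix \<mu>' assume \<mu>': "is_volume \<mu>'"
    have D': "emeasure \<mu>'' (S \<inter> D k) = chart_volume (C k) (S \<inter> D k)"
      if "is_volume \<mu>''" "S \<in> sets borel" "k < n" for \<mu>'' S k
      using that C(1)[of k] Db[of k] DC[of k] unfolding is_volume_def by (meson Int_lower2 sets.Int subset_trans)
    show "\<mu>' = \<mu>"
    proof (rule measure_eqI)
      show "sets \<mu>' = sets \<mu>" using \<mu>' sets_\<mu> by (simp add: is_volume_def)
      fix S assume "S \<in> sets \<mu>'"
      then have S: "S \<in> sets borel" using \<mu>' by (simp add: is_volume_def)
      have "emeasure \<mu>' S = (\<Sum>k<n. chart_volume (C k) (S \<inter> D k))"
        using split[of \<mu>' S] \<mu>' S D'[OF \<mu>' S] by (simp add: is_volume_def)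
      also have "\<dots> = emeasure \<mu> S" using split[of \<mu> S] sets_\<mu> S D'[OF vol S] by simp
      finally show "emeasure \<mu>' S = emeasure \<mu> S" .
    qed
  qed
qed

end

section \<open>The divergence theorem\<close>

lemma C1_metric_subset: "C1_metric V G \<Longrightarrow> open U \<Longrightarrow> U \<subseteq> V \<Longrightarrow> C1_metric U G"
  unfolding C1_metric_def using C1_on_subset by blast

lemma div_form_zero:
  assumes "open U" "x \<in> U" "\<And>y v. y \<in> U \<Longrightarrow> \<omega> y v = 0"
  shows "div_form G \<omega> x = 0"
proof -
  have "fd (\<lambda>y. \<omega> y v) x = fd (\<lambda>y. 0) x" for v by (rule fd_cong_open[OF assms(1,2)]) (rule assms(3))
  then show ?thesis by (simp add: div_form_def metric_trace_onb nabla_form_def assms)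
qed

lemma div_form_sum:
  assumes "\<And>i. i \<in> I \<Longrightarrow> C1_form V (\<omega> i)" "x \<in> V"
  shows "div_form G (\<lambda>y v. \<Sum>i\<in>I. \<omega> i y v) x = (\<Sum>i\<in>I. div_form G (\<omega> i) x)"
proof -
  have "fd (\<lambda>y. \<Sum>i\<in>I. \<omega> i y v) x u = (\<Sum>i\<in>I. fd (\<lambda>y. \<omega> i y v) x u)" for u v
  proof -
    have "((\<lambda>y. \<Sum>i\<in>I. \<omega> i y v) has_derivative (\<lambda>u. \<Sum>i\<in>I. fd (\<lambda>y. \<omega> i y v) x u)) (at x)"
      by (intro has_derivative_sum C1_on_has_derivative[OF C1_formD(3)[OF assms(1)] assms(2)])
    then show ?thesis by (simp add: fd_unique)
  qed
  then have "nabla_form G (\<lambda>y v. \<Sum>i\<in>I. \<omega> i y v) x u v = (\<Sum>i\<in>I. nabla_form G (\<omega> i) x u v)" for u v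
    by (simp add: nabla_form_def sum_subtractf)
  then show ?thesis
    unfolding div_form_def metric_trace_onb by (simp add: sum.swap[of _ I])
qed

section \<open>Bump functions of class C^1 on Euclidean space\<close>

text \<open>Squaring removes the kink of the maximum at 0 and leaves a continuous derivative. This
  profile makes bump functions just regular enough to multiply a C^1 form.\<close>

lemma C1_on_max_square: "C1_on UNIV (\<lambda>s :: real. (max 0 s)\<^sup>2)"
proof (rule C1_onI)
  show "((\<lambda>s :: real. (max 0 s)\<^sup>2) has_derivative (*) (2 * max 0 s)) (at s)" for s
    unfolding has_field_derivative_def[symmetric]
  proof (cases s "0 :: real" rule: linorder_cases)
    case less
    have "((\<lambda>s :: real. 0) has_real_derivative 2 * max 0 s) (at s)" using less by simp
    then show "((\<lambda>s :: real. (max 0 s)\<^sup>2) has_real_derivative 2 * max 0 s) (at s)"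
      by (rule has_field_derivative_transform_within_open[of _ _ _ "{..<0}"]) (use less in auto)
  next
    case greater
    have "((\<lambda>s :: real. s\<^sup>2) has_real_derivative 2 * max 0 s) (at s)"
      using greater by (auto intro!: derivative_eq_intros)
    then show "((\<lambda>s :: real. (max 0 s)\<^sup>2) has_real_derivative 2 * max 0 s) (at s)"
      by (rule has_field_derivative_transform_within_open[of _ _ _ "{0<..}"]) (use greater in auto)
  next
    case equal
    have "((\<lambda>y :: real. max 0 y) \<longlongrightarrow> max 0 0) (at 0)" by (intro tendsto_intros)
    moreover have "\<forall>\<^sub>F y :: real in at 0. max 0 y = ((max 0 y)\<^sup>2 - (max 0 0)\<^sup>2) / (y - 0)"
      unfolding eventually_at by (rule exI[of _ 1]) (auto simp: max_def power2_eq_square)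
    ultimately have "((\<lambda>y :: real. ((max 0 y)\<^sup>2 - (max 0 0)\<^sup>2) / (y - 0)) \<longlongrightarrow> 0) (at 0)"
      by (simp add: tendsto_cong)
    then show "((\<lambda>s :: real. (max 0 s)\<^sup>2) has_real_derivative 2 * max 0 s) (at s)"
      unfolding has_field_derivative_iff equal by simp
  qed
  show "continuous_on UNIV (\<lambda>s. 2 * max 0 s * v)" for v :: real
    by (intro continuous_intros)
qed

lemma C1_on_bump:
  fixes x0 :: "'a::euclidean_space"
  shows "C1_on UNIV (\<lambda>x. (max 0 (r\<^sup>2 - (x - x0) \<bullet> (x - x0)))\<^sup>2)"
proof -
  have "C1_on UNIV (\<lambda>x. (x - x0) \<bullet> (x - x0))"
    by (rule C1_onI[where f' = "\<lambda>x v. 2 * ((x - x0) \<bullet> v)"])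
      (auto intro!: derivative_eq_intros continuous_intros simp: inner_commute)
  then have "C1_on UNIV (\<lambda>x. r\<^sup>2 - (x - x0) \<bullet> (x - x0))" by (intro C1_on_diff C1_on_const)
  from C1_on_compose[OF this C1_on_max_square] show ?thesis by simp
qed

section \<open>One-forms of class C^1 and their divergence on the manifold\<close>

context riemannian begin

definition C1_fun :: "('p \<Rightarrow> real) \<Rightarrow> bool" where
  "C1_fun u \<longleftrightarrow> (\<forall>c\<in>A. C1_on (cdom c) (\<lambda>x. u (chart_inv c x)))"

definition form_in :: "('p, 'm) chart \<Rightarrow> ('p \<Rightarrow> real ^ 'm \<Rightarrow> real) \<Rightarrow> real ^ 'm \<Rightarrow> real ^ 'm \<Rightarrow> real" where
  "form_in c \<omega> x v = \<omega> (chart_inv c x) (from_chart A c (chart_inv c x) v)"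

definition C1_oneform :: "('p \<Rightarrow> real ^ 'm \<Rightarrow> real) \<Rightarrow> bool" where
  "C1_oneform \<omega> \<longleftrightarrow> (\<forall>p. linear (\<omega> p)) \<and> (\<forall>c\<in>A. \<forall>v. C1_on (cdom c) (\<lambda>x. form_in c \<omega> x v))"

definition divergence :: "('p \<Rightarrow> real ^ 'm \<Rightarrow> real) \<Rightarrow> 'p \<Rightarrow> real" where
  "divergence \<omega> p = (let c = chart_at A p in div_form (metric_in A g c) (form_in c \<omega>) (snd c p))"

lemma C1_form_in:
  assumes "C1_oneform \<omega>" "c \<in> A"
  shows "C1_form (cdom c) (form_in c \<omega>)"
proof -
  have "linear (form_in c \<omega> x)" if "x \<in> cdom c" for x
    using linear_compose[OF linear_from_chart[OF assms(2) chart(6)[OF assms(2) that]], of "\<omega> (chart_inv c x)"] assms(1)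
    by (simp add: C1_oneform_def form_in_def[abs_def] o_def)
  then show ?thesis using assms chart(2) by (auto simp: C1_form_def C1_oneform_def)
qed

text \<open>The definition of \<open>divergence\<close> uses a different chart at every point.
  Isometry of the transition maps makes the result independent of the chart, so one chart can serve
  a whole coordinate domain.\<close>

lemma divergence_in_chart:
  assumes \<omega>: "C1_oneform \<omega>" and c: "c \<in> A" "p \<in> fst c"
  shows "divergence \<omega> p = div_form (metric_in A g c) (form_in c \<omega>) (snd c p)"
proof -
  let ?d = "chart_at A p"
  have d: "?d \<in> A" "p \<in> fst ?d" by (rule chart_at)+
  let ?V = "snd c ` (fst c \<inter> fst ?d)"
  have "div_form (metric_in A g c) (form_in c \<omega>) (snd c p) =
      div_form (metric_in A g ?d) (form_in ?d \<omega>) (transition c ?d (snd c p))"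
  proof (rule div_form_transform[OF C1_metric_subset[OF C1_metric_in[OF c(1)] open_overlap[OF c(1) d(1)]]
        C1_metric_in[OF d(1)] C1_form_in[OF \<omega> d(1)] transition_C1(1)[OF c(1) d(1)]
        transition_image_cdom[OF c(1) d(1)] transition_C1(2)[OF c(1) d(1)] metric_in_transition[OF c(1) d(1)]])
    fix x v assume "x \<in> ?V"
    then obtain q where q: "q \<in> fst c" "q \<in> fst ?d" "x = snd c q" by blast
    show "form_in c \<omega> x v = form_in ?d \<omega> (transition c ?d x) (fd (transition c ?d) x v)"
      using from_chart_transition[OF c(1) q(1) d(1) q(2)] q
      by (simp add: form_in_def transition_snd[OF c(1)] chart(5)[OF c(1)] chart(5)[OF d(1)])
  qed (use c d inj_fd_transition[OF c d] in auto)
  then show ?thesis by (simp add: divergence_def Let_def transition_snd[OF c])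
qed

lemma continuous_on_UNIV_chartI:
  fixes F :: "'p \<Rightarrow> 'b::topological_space"
  assumes "\<And>p. \<exists>c\<in>A. p \<in> fst c \<and> continuous_on (cdom c) (\<lambda>x. F (chart_inv c x))"
  shows "continuous_on UNIV F"
proof (rule continuous_at_imp_continuous_on, rule ballI)
  fix p :: 'p
  obtain c where c: "c \<in> A" "p \<in> fst c" "continuous_on (cdom c) (\<lambda>x. F (chart_inv c x))" using assms by blast
  have "continuous_on (fst c) (\<lambda>q. F (chart_inv c (snd c q)))"
    by (rule continuous_on_compose2[OF c(3) chart(3)[OF c(1)]]) simp
  then have "continuous_on (fst c) F"
    by (subst (asm) continuous_on_cong[OF refl, of _ _ F]) (simp_all add: chart(5)[OF c(1)])
  then show "isCont F p" using continuous_on_eq_continuous_at[OF chart(1)[OF c(1)]] c(2) by blast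
qed

text \<open>The defining trace runs over bases chosen by SOME, whose dependence on the point is
  uncontrolled. The coordinate formula expresses the divergence instead as a quotient of continuous
  functions with positive denominator \<open>rho\<close>.\<close>

lemma continuous_divergence:
  assumes \<omega>: "C1_oneform \<omega>"
  shows "continuous_on UNIV (divergence \<omega>)"
proof (rule continuous_on_UNIV_chartI)
  fix p
  let ?c = "chart_at A p"
  have c: "?c \<in> A" "p \<in> fst ?c" by (rule chart_at)+
  let ?W = "\<lambda>x. sqrt (det (gram (metric_in A g ?c x))) *\<^sub>R sharp (metric_in A g ?c x) (form_in ?c \<omega> x)"
  note W = div_form_eq_divergence[OF C1_metric_in[OF c(1)] C1_form_in[OF \<omega> c(1)]]
  have e: "divergence \<omega> (chart_inv ?c x) = (\<Sum>a\<in>UNIV. fd ?W x (axis a 1) $ a) / rho ?c x" if "x \<in> cdom ?c" for x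
    using W(2)[OF that] rho_pos[OF c(1) that] divergence_in_chart[OF \<omega> c(1) chart(6)[OF c(1) that]]
      chart(7)[OF c(1) that] by (simp add: rho_def)
  have "continuous_on (cdom ?c) (\<lambda>x. (\<Sum>a\<in>UNIV. fd ?W x (axis a 1) $ a) / rho ?c x)"
    by (intro continuous_intros continuous_on_divide C1_on_continuous_fd[OF W(1)] C1_on_continuous_on[OF rho_C1[OF c(1)]])
      (use rho_pos[OF c(1)] in force)
  then have "continuous_on (cdom ?c) (\<lambda>x. divergence \<omega> (chart_inv ?c x))"
    by (subst continuous_on_cong[OF refl e]) auto
  then show "\<exists>c\<in>A. p \<in> fst c \<and> continuous_on (cdom c) (\<lambda>x. divergence \<omega> (chart_inv c x))" using c by blast
qed

lemma divergence_zero: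
  assumes "open U" "p \<in> U" "\<And>q v. q \<in> U \<Longrightarrow> \<omega> q v = 0"
  shows "divergence \<omega> p = 0"
proof -
  let ?c = "chart_at A p"
  have c: "?c \<in> A" "p \<in> fst ?c" by (rule chart_at)+
  show ?thesis
    unfolding divergence_def Let_def
    by (rule div_form_zero[OF open_chart_image[OF is_chart[OF c(1)] assms(1)]])
      (use c assms(2,3) in \<open>auto simp: form_in_def chart(5)\<close>)
qed

end

section \<open>Integration over a compact manifold\<close>

locale compact_riemannian = riemannian A g
  for A :: "('p::{t2_space,second_countable_topology}, 'm::finite) chart set" and g +
  assumes compact: "compact (UNIV :: 'p set)"
begin

abbreviation "vol \<equiv> riemannian_volume A g"

lemma is_volume_vol: "is_volume vol"
  unfolding riemannian_volume_eq by (rule theI'[OF ex1_volume[OF compact]])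

lemma sets_vol [simp, measurable_cong]: "sets vol = sets borel"
  using is_volume_vol by (simp add: is_volume_def)

lemma space_vol [simp]: "space vol = UNIV"
  using sets_eq_imp_space_eq[OF sets_vol] by simp

lemma emeasure_vol: "c \<in> A \<Longrightarrow> S \<in> sets borel \<Longrightarrow> S \<subseteq> fst c \<Longrightarrow> emeasure vol S = chart_volume c S"
  using is_volume_vol by (simp add: is_volume_def)

text \<open>Restricted to the domain of one chart, the volume is the measure pushed forward from
  coordinates. Integrals of functions vanishing outside that domain thereby become integrals against
  \<open>lborel\<close>.\<close>

lemma density_vol:
  assumes c: "c \<in> A"
  shows "density vol (\<lambda>p. ennreal (indicator (fst c) p)) = chart_measure c"
proof (rule measure_eqI)
  show "sets (density vol (\<lambda>p. ennreal (indicator (fst c) p))) = sets (chart_measure c)" by simp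
  fix S assume "S \<in> sets (density vol (\<lambda>p. ennreal (indicator (fst c) p)))"
  then have S: "S \<in> sets borel" by simp
  have o: "fst c \<in> sets borel" using chart(1)[OF c] by simp
  have "emeasure (density vol (\<lambda>p. ennreal (indicator (fst c) p))) S =
      (\<integral>\<^sup>+p. ennreal (indicator (fst c) p) * indicator S p \<partial>vol)"
    using S o by (subst emeasure_density) auto
  also have "\<dots> = (\<integral>\<^sup>+p. indicator (S \<inter> fst c) p \<partial>vol)"
    by (intro nn_integral_cong) (auto simp: indicator_def)
  also have "\<dots> = emeasure (chart_measure c) S"
    using S o emeasure_vol[OF c, of "S \<inter> fst c"] emeasure_chart_measure[OF c S] by simp
  finally show "emeasure (density vol (\<lambda>p. ennreal (indicator (fst c) p))) S = emeasure (chart_measure c) S" .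
qed

lemma integral_vol_chart:
  fixes F :: "'p \<Rightarrow> real"
  assumes c: "c \<in> A" and F: "F \<in> borel_measurable borel" and out: "\<And>p. p \<notin> fst c \<Longrightarrow> F p = 0"
  shows "(\<integral>p. F p \<partial>vol) = (\<integral>x. indicator (cdom c) x * (rho c x * F (chart_inv c x)) \<partial>lborel)"
proof -
  let ?f = "\<lambda>x. if x \<in> cdom c then chart_inv c x else undefined"
  have m: "(\<lambda>x. rho c x * indicator (cdom c) x) \<in> borel_measurable borel"
    by (rule rho_measurable[OF c]) (use chart(2)[OF c] in auto)
  have o: "fst c \<in> sets borel" using chart(1)[OF c] by simp
  have "(\<integral>p. F p \<partial>vol) = (\<integral>p. indicator (fst c) p *\<^sub>R F p \<partial>vol)"
    using out by (intro Bochner_Integration.integral_cong) (auto simp: indicator_def)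
  also have "\<dots> = (\<integral>p. F p \<partial>chart_measure c)"
    unfolding density_vol[OF c, symmetric] by (rule integral_density[symmetric]) (use F o in auto)
  also have "\<dots> = (\<integral>x. F (?f x) \<partial>density lborel (\<lambda>x. ennreal (rho c x * indicator (cdom c) x)))"
    unfolding chart_measure_def by (rule integral_distr) (use chart_inv_measurable[OF c] F in auto)
  also have "\<dots> = (\<integral>x. (rho c x * indicator (cdom c) x) *\<^sub>R F (?f x) \<partial>lborel)"
    by (rule integral_density)
      (use m measurable_compose[OF chart_inv_measurable[OF c] F] rho_pos[OF c] in \<open>auto simp: indicator_def less_imp_le intro!: AE_I2\<close>)
  also have "\<dots> = (\<integral>x. indicator (cdom c) x * (rho c x * F (chart_inv c x)) \<partial>lborel)"
    by (intro Bochner_Integration.integral_cong) (auto simp: indicator_def)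
  finally show ?thesis .
qed

section \<open>Coordinate balls and finiteness of the volume\<close>

lemma chart_ball:
  obtains r where "r > 0" "cball (snd (chart_at A p) p) r \<subseteq> cdom (chart_at A p)"
  using open_contains_cball[of "cdom (chart_at A p)"] chart(2)[OF chart_at(1)] chart_at(2)[of p] by blast

definition radius :: "'p \<Rightarrow> real" where
  "radius p = (SOME r. r > 0 \<and> cball (snd (chart_at A p) p) r \<subseteq> cdom (chart_at A p))"

lemma radius: "radius p > 0" "cball (snd (chart_at A p) p) (radius p) \<subseteq> cdom (chart_at A p)"
proof -
  have "radius p > 0 \<and> cball (snd (chart_at A p) p) (radius p) \<subseteq> cdom (chart_at A p)"
    unfolding radius_def by (rule someI_ex) (use chart_ball in blast)
  then show "radius p > 0" "cball (snd (chart_at A p) p) (radius p) \<subseteq> cdom (chart_at A p)" by auto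
qed

definition nbhd :: "'p \<Rightarrow> 'p set" where
  "nbhd p = fst (chart_at A p) \<inter> snd (chart_at A p) -` ball (snd (chart_at A p) p) (radius p)"

text \<open>Written as the image of a closed Euclidean ball so that compactness is immediate;
  \<open>cnbhd_eq\<close> supplies the description as a preimage.\<close>

definition cnbhd :: "'p \<Rightarrow> 'p set" where
  "cnbhd p = chart_inv (chart_at A p) ` cball (snd (chart_at A p) p) (radius p)"

lemma open_nbhd: "open (nbhd p)"
  unfolding nbhd_def by (rule open_chart_preimage[OF is_chart[OF chart_at(1)]]) simp

lemma mem_nbhd: "p \<in> nbhd p"
  using chart_at radius by (simp add: nbhd_def)

lemma compact_cnbhd: "compact (cnbhd p)"
  unfolding cnbhd_def
  by (rule compact_continuous_image[OF continuous_on_subset[OF chart(4)[OF chart_at(1)] radius(2)]]) simp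

lemma cnbhd_subset: "cnbhd p \<subseteq> fst (chart_at A p)"
  unfolding cnbhd_def using radius(2)[of p] chart(6)[OF chart_at(1)[of p]] by blast

lemma cnbhd_eq: "cnbhd p = fst (chart_at A p) \<inter> snd (chart_at A p) -` cball (snd (chart_at A p) p) (radius p)"
  (is "_ = ?R")
proof
  show "cnbhd p \<subseteq> ?R"
  proof
    fix q assume q: "q \<in> cnbhd p"
    then obtain x where x: "x \<in> cball (snd (chart_at A p) p) (radius p)" "q = chart_inv (chart_at A p) x"
      unfolding cnbhd_def by blast
    then have "snd (chart_at A p) q = x" using chart(7)[OF chart_at(1)] radius(2)[of p] by blast
    then show "q \<in> ?R" using x q cnbhd_subset[of p] by auto
  qed
  show "?R \<subseteq> cnbhd p"
    unfolding cnbhd_def using chart(5)[OF chart_at(1)[of p]] by (force simp: image_iff)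
qed

text \<open>The density is continuous on the closed coordinate ball, hence bounded there, and that
  ball has finite Lebesgue measure.\<close>

lemma emeasure_vol_nbhd: "emeasure vol (nbhd p) < \<infinity>"
proof -
  let ?c = "chart_at A p" and ?B = "cball (snd (chart_at A p) p) (radius p)"
  have c: "?c \<in> A" by (rule chart_at)
  have "compact (rho ?c ` ?B)"
    by (rule compact_continuous_image[OF continuous_on_subset[OF C1_on_continuous_on[OF rho_C1[OF c]] radius(2)]]) simp
  then obtain C where C: "\<And>x. x \<in> ?B \<Longrightarrow> \<bar>rho ?c x\<bar> \<le> C"
    using compact_imp_bounded bounded_iff by (metis image_eqI real_norm_def)
  have "emeasure vol (nbhd p) = (\<integral>\<^sup>+x\<in>snd ?c ` nbhd p. ennreal (rho ?c x) \<partial>lborel)"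
    using emeasure_vol[OF c, of "nbhd p"] open_nbhd[of p] by (auto simp: nbhd_def chart_volume_def)
  also have "\<dots> \<le> (\<integral>\<^sup>+x. ennreal C * indicator ?B x \<partial>lborel)"
  proof (rule nn_integral_mono)
    fix x
    show "ennreal (rho ?c x) * indicator (snd ?c ` nbhd p) x \<le> ennreal C * indicator ?B x"
    proof (cases "x \<in> snd ?c ` nbhd p")
      case True
      then have "x \<in> ?B" by (auto simp: nbhd_def)
      then show ?thesis using C[of x] by (auto simp: indicator_def intro!: ennreal_leI)
    qed simp
  qed
  also have "\<dots> = ennreal C * emeasure lborel ?B" by (rule nn_integral_cmult_indicator) simp
  also have "\<dots> < \<infinity>"
    using emeasure_bounded_finite[OF bounded_cball, of "snd ?c p" "radius p"]
    by (simp add: ennreal_mult_less_top)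
  finally show ?thesis .
qed

lemma nbhd_cover:
  obtains P where "finite P" "UNIV \<subseteq> (\<Union>p\<in>P. nbhd p)"
proof -
  have "UNIV \<subseteq> (\<Union>p\<in>UNIV. nbhd p)" using mem_nbhd by blast
  then show ?thesis using compactE_image[OF compact, of UNIV nbhd] open_nbhd that by metis
qed

lemma finite_measure_vol: "finite_measure vol"
proof
  obtain P where P: "finite P" "UNIV \<subseteq> (\<Union>p\<in>P. nbhd p)" using nbhd_cover by blast
  then have "(\<Union>p\<in>P. nbhd p) = UNIV" by blast
  moreover have "nbhd ` P \<subseteq> sets vol" using open_nbhd by (auto intro: borel_open)
  ultimately have "emeasure vol UNIV \<le> (\<Sum>p\<in>P. emeasure vol (nbhd p))"
    using emeasure_subadditive_finite[OF P(1), of nbhd vol] by simp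
  also have "\<dots> < \<infinity>" using emeasure_vol_nbhd by (simp add: P(1))
  finally show "emeasure vol (space vol) \<noteq> \<infinity>" by simp
qed

lemma integrable_vol_bounded:
  fixes F :: "'p \<Rightarrow> real"
  assumes "F \<in> borel_measurable borel" "\<And>p. \<bar>F p\<bar> \<le> C"
  shows "integrable vol F"
  by (rule finite_measure.integrable_const_bound[OF finite_measure_vol, where B = C]) (use assms in auto)

lemma integrable_vol_continuous:
  fixes F :: "'p \<Rightarrow> real"
  assumes "continuous_on UNIV F"
  shows "integrable vol F"
proof -
  obtain C where "\<forall>y\<in>range F. norm y \<le> C"
    using compact_imp_bounded[OF compact_continuous_image[OF assms compact]] bounded_iff by metis
  then show ?thesis
    by (intro integrable_vol_bounded[of F C] borel_measurable_continuous_onI[OF assms]) auto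
qed

text \<open>In the chart the factor \<open>rho\<close> of the volume converts the divergence into
  the Euclidean divergence of \<open>W\<close>, and each partial derivative of a compactly supported
  function integrates to zero.\<close>

lemma integral_divergence_chart:
  assumes \<omega>: "C1_oneform \<omega>" and c: "c \<in> A" and K: "compact K" "K \<subseteq> fst c"
    and out: "\<And>p v. p \<notin> K \<Longrightarrow> \<omega> p v = 0"
  shows "(\<integral>p. divergence \<omega> p \<partial>vol) = 0"
proof -
  let ?G = "metric_in A g c" and ?w = "form_in c \<omega>"
  define W where "W = (\<lambda>x. sqrt (det (gram (?G x))) *\<^sub>R sharp (?G x) (?w x))"
  note W = div_form_eq_divergence[OF C1_metric_in[OF c] C1_form_in[OF \<omega> c], folded W_def]
  \<comment> \<open>Extension by zero to the whole model space. It is C^1 because \<open>W\<close>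
    vanishes off the compact set \<open>L\<close>, so the two formulas agree on an open
    overlap.\<close>
  define W0 where "W0 = (\<lambda>x. if x \<in> cdom c then W x else 0)"
  define L where "L = snd c ` K"
  have L: "compact L" "L \<subseteq> cdom c"
    using compact_continuous_image[OF continuous_on_subset[OF chart(3)[OF c] K(2)] K(1)] K(2) by (auto simp: L_def)
  have Wz: "W x = 0" if "x \<in> cdom c" "x \<notin> L" for x
  proof -
    have "chart_inv c x \<notin> K" using chart(7)[OF c that(1)] that(2) unfolding L_def by (metis imageI)
    then have "?w x v = 0" for v using out by (simp add: form_in_def)
    then have "sharp (?G x) (?w x) = 0"
      by (intro inner_product_eqI[OF inner_product_metric_in[OF c that(1)]])
        (simp add: sharp[OF inner_product_metric_in[OF c that(1)] C1_formD(2)[OF C1_form_in[OF \<omega> c] that(1)]]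
          bilinear_lzero[OF inner_product_bilinear[OF inner_product_metric_in[OF c that(1)]]])
    then show ?thesis by (simp add: W_def)
  qed
  have W0z: "W0 x = 0" if "x \<notin> L" for x using Wz that by (simp add: W0_def)
  have oL: "open (- L)" using L(1) by (simp add: compact_imp_closed open_Compl)
  have C1W0: "C1_on UNIV W0"
  proof (rule C1_on_local)
    fix x
    show "\<exists>U h. open U \<and> x \<in> U \<and> C1_on U h \<and> (\<forall>y\<in>U. W0 y = h y)"
    proof (cases "x \<in> cdom c")
      case True
      then show ?thesis
        by (intro exI[of _ "cdom c"] exI[of _ W]) (use W(1) chart(2)[OF c] in \<open>auto simp: W0_def\<close>)
    next
      case False
      then show ?thesis
        by (intro exI[of _ "- L"] exI[of _ "\<lambda>_. 0"]) (use oL L W0z in auto)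
    qed
  qed
  have a: "C1_on UNIV (\<lambda>x. W0 x $ i)" for i by (rule C1_on_vec_nth[OF C1W0])
  note I = integral_fd_compact_support[OF a L(1)]
  have fdW0: "fd W0 x v $ i = fd (\<lambda>x. W0 x $ i) x v" for x v i
    using fd_unique[OF bounded_linear.has_derivative[OF bounded_linear_vec_nth C1_on_has_derivative[OF C1W0]]] by simp
  have "(\<integral>p. divergence \<omega> p \<partial>vol) = (\<integral>x. indicator (cdom c) x * (rho c x * divergence \<omega> (chart_inv c x)) \<partial>lborel)"
  proof (rule integral_vol_chart[OF c])
    show "divergence \<omega> \<in> borel_measurable borel"
      by (rule borel_measurable_continuous_onI[OF continuous_divergence[OF \<omega>]])
    fix p assume "p \<notin> fst c"
    then show "divergence \<omega> p = 0"
      by (intro divergence_zero[of "- K"]) (use K compact_imp_closed out in \<open>auto simp: open_Compl\<close>)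
  qed
  also have "\<dots> = (\<integral>x. (\<Sum>i\<in>UNIV. fd (\<lambda>x. W0 x $ i) x (axis i 1)) \<partial>lborel)"
  proof (rule Bochner_Integration.integral_cong[OF refl])
    fix x
    show "indicator (cdom c) x * (rho c x * divergence \<omega> (chart_inv c x)) = (\<Sum>i\<in>UNIV. fd (\<lambda>x. W0 x $ i) x (axis i 1))"
    proof (cases "x \<in> cdom c")
      case True
      have "fd W0 x = fd W x" by (rule fd_cong_open[OF chart(2)[OF c] True]) (simp add: W0_def)
      then have "(\<Sum>i\<in>UNIV. fd (\<lambda>x. W0 x $ i) x (axis i 1)) = rho c x * div_form ?G ?w x"
        using W(2)[OF True] by (simp add: fdW0[symmetric] rho_def)
      then show ?thesis
        using True divergence_in_chart[OF \<omega> c chart(6)[OF c True]] chart(7)[OF c True] by simp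
    next
      case False
      have "fd W0 x = fd (\<lambda>_. 0) x" by (rule fd_cong_open[OF oL]) (use False L W0z in auto)
      then show ?thesis using False by (simp add: fdW0[symmetric])
    qed
  qed
  also have "\<dots> = 0"
    using I W0z by (subst Bochner_Integration.integral_sum) auto
  finally show ?thesis .
qed

section \<open>Partition of unity and the global divergence theorem\<close>

definition bump :: "'p \<Rightarrow> 'p \<Rightarrow> real" where
  "bump p q = (if q \<in> fst (chart_at A p) then
     (max 0 ((radius p)\<^sup>2 - (snd (chart_at A p) q - snd (chart_at A p) p) \<bullet> (snd (chart_at A p) q - snd (chart_at A p) p)))\<^sup>2 else 0)"

lemma bump_zero: "q \<notin> cnbhd p \<Longrightarrow> bump p q = 0"
proof (cases "q \<in> fst (chart_at A p)")
  case True
  assume "q \<notin> cnbhd p"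
  then have "radius p < norm (snd (chart_at A p) q - snd (chart_at A p) p)"
    using True by (auto simp: cnbhd_eq dist_norm norm_minus_commute)
  then have "(radius p)\<^sup>2 \<le> (norm (snd (chart_at A p) q - snd (chart_at A p) p))\<^sup>2"
    using radius(1)[of p] by (intro power_mono) auto
  then show ?thesis by (simp add: bump_def power2_norm_eq_inner)
qed (simp add: bump_def)

lemma bump_nonneg: "bump p q \<ge> 0"
  by (simp add: bump_def)

lemma bump_pos: "q \<in> nbhd p \<Longrightarrow> bump p q > 0"
proof -
  assume q: "q \<in> nbhd p"
  then have "norm (snd (chart_at A p) q - snd (chart_at A p) p) < radius p"
    by (auto simp: nbhd_def dist_norm norm_minus_commute)
  then have "(norm (snd (chart_at A p) q - snd (chart_at A p) p))\<^sup>2 < (radius p)\<^sup>2"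
    by (intro power_strict_mono) auto
  then show ?thesis using q by (auto simp: bump_def nbhd_def power2_norm_eq_inner)
qed

text \<open>Two formulas on open sets: the Euclidean bump inside the chart fixed at
  \<open>p\<close>, and zero off \<open>cnbhd p\<close>, which is closed as a compact subset of a
  Hausdorff space.\<close>

lemma C1_bump: "C1_fun (bump p)"
  unfolding C1_fun_def
proof (intro ballI C1_on_local)
  fix d y assume d: "d \<in> A" and y: "y \<in> cdom d"
  let ?c = "chart_at A p"
  have c: "?c \<in> A" by (rule chart_at)
  let ?q = "chart_inv d y"
  show "\<exists>U h. open U \<and> y \<in> U \<and> C1_on U h \<and> (\<forall>z\<in>U. bump p (chart_inv d z) = h z)"
  proof (cases "?q \<in> fst ?c")
    case True
    let ?U = "snd d ` (fst d \<inter> fst ?c)"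
    let ?\<beta> = "\<lambda>x. (max 0 ((radius p)\<^sup>2 - (x - snd ?c p) \<bullet> (x - snd ?c p)))\<^sup>2"
    have "C1_on ?U (\<lambda>x. ?\<beta> (transition d ?c x))"
      by (rule C1_on_compose[OF transition_C1(1)[OF d c] C1_on_bump]) simp
    moreover have "y \<in> ?U" unfolding overlap_eq[OF d] using y True by simp
    moreover have "bump p (chart_inv d z) = ?\<beta> (transition d ?c z)" if "z \<in> ?U" for z
      using that d by (auto simp: bump_def transition_snd chart(5))
    ultimately show ?thesis using open_overlap[OF d c] by blast
  next
    case False
    let ?U = "snd d ` (fst d \<inter> - cnbhd p)"
    have "open ?U"
      by (rule open_chart_image[OF is_chart[OF d]]) (simp add: compact_cnbhd compact_imp_closed open_Compl)
    moreover have "y \<in> ?U"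
      unfolding chart_image_eq[OF is_chart[OF d]] using y False cnbhd_subset[of p] by auto
    moreover have "bump p (chart_inv d z) = 0" if "z \<in> ?U" for z
      using that d by (auto simp: chart(5) bump_zero)
    ultimately show ?thesis using C1_on_const by blast
  qed
qed

lemma C1_oneform_mult:
  assumes u: "C1_fun u" and \<omega>: "C1_oneform \<omega>"
  shows "C1_oneform (\<lambda>p v. u p * \<omega> p v)"
  unfolding C1_oneform_def
proof (intro conjI allI ballI)
  show "linear (\<lambda>v. u p * \<omega> p v)" for p
    using linear_compose_scale_right[of "\<omega> p" "u p"] \<omega> by (simp add: C1_oneform_def)
  fix c v assume c: "c \<in> A"
  have "C1_on (cdom c) (\<lambda>x. u (chart_inv c x) * form_in c \<omega> x v)"
    using u \<omega> c by (intro C1_on_mult) (auto simp: C1_fun_def C1_oneform_def)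
  then show "C1_on (cdom c) (\<lambda>x. form_in c (\<lambda>p v. u p * \<omega> p v) x v)"
    by (simp add: form_in_def)
qed

text \<open>The form is split into finitely many forms, each supported in one chart, before its
  divergence is taken. Additivity of the divergence is then enough, and derivatives of the weights
  never appear.\<close>

theorem integral_divergence:
  assumes \<omega>: "C1_oneform \<omega>"
  shows "(\<integral>p. divergence \<omega> p \<partial>vol) = 0"
proof -
  obtain P where P: "finite P" "UNIV \<subseteq> (\<Union>p\<in>P. nbhd p)" using nbhd_cover by blast
  define b where "b = (\<lambda>q. \<Sum>p\<in>P. bump p q)"
  have bpos: "b q > 0" for q
  proof -
    obtain p where "p \<in> P" "q \<in> nbhd p" using P(2) by blast
    then show ?thesis unfolding b_def using bump_pos bump_nonneg by (intro sum_pos2[OF P(1)]) auto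
  qed
  \<comment> \<open>Normalized bumps; the denominator is positive everywhere because the open
    coordinate balls cover the manifold.\<close>
  define pu where "pu = (\<lambda>p q. bump p q / b q)"
  have pu: "C1_fun (pu p)" for p
    using C1_bump bpos unfolding C1_fun_def pu_def b_def
    by (intro ballI C1_on_divide C1_on_sum) (auto simp: less_imp_neq[THEN not_sym])
  have pu_form: "C1_oneform (\<lambda>q v. pu p q * \<omega> q v)" for p by (rule C1_oneform_mult[OF pu \<omega>])
  have one: "(\<Sum>p\<in>P. pu p q) = 1" for q
    using bpos[of q] by (simp add: pu_def b_def sum_divide_distrib[symmetric])
  have "divergence \<omega> q = (\<Sum>p\<in>P. divergence (\<lambda>q v. pu p q * \<omega> q v) q)" for q
  proof -
    let ?c = "chart_at A q"
    have c: "?c \<in> A" "q \<in> fst ?c" by (rule chart_at)+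
    have "\<omega> = (\<lambda>q v. \<Sum>p\<in>P. pu p q * \<omega> q v)" using one by (simp add: sum_distrib_right[symmetric])
    then have "form_in ?c \<omega> = (\<lambda>x v. \<Sum>p\<in>P. form_in ?c (\<lambda>q v. pu p q * \<omega> q v) x v)"
      by (auto simp: form_in_def fun_eq_iff dest: fun_cong)
    then show ?thesis
      unfolding divergence_def Let_def
      using div_form_sum[of P "cdom ?c" "\<lambda>p. form_in ?c (\<lambda>q v. pu p q * \<omega> q v)" "snd ?c q" "metric_in A g ?c",
          OF C1_form_in[OF pu_form c(1)]] c(2) by simp
  qed
  then have "(\<integral>q. divergence \<omega> q \<partial>vol) = (\<Sum>p\<in>P. \<integral>q. divergence (\<lambda>q v. pu p q * \<omega> q v) q \<partial>vol)"
    using integrable_vol_continuous[OF continuous_divergence[OF pu_form]]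
    by (simp add: Bochner_Integration.integral_sum)
  also have "\<dots> = 0"
  proof (rule sum.neutral, rule ballI)
    fix p
    show "(\<integral>q. divergence (\<lambda>q v. pu p q * \<omega> q v) q \<partial>vol) = 0"
      by (rule integral_divergence_chart[OF pu_form chart_at(1)[of p] compact_cnbhd[of p] cnbhd_subset[of p]])
        (simp add: pu_def bump_zero)
  qed
  finally show ?thesis .
qed

end

section \<open>The first variation of the energy along the flow\<close>

definition rep :: "('p, 'm::finite) chart \<Rightarrow> ('q, 'n::finite) chart \<Rightarrow> ('p \<Rightarrow> 'q) \<Rightarrow> real ^ 'm \<Rightarrow> real ^ 'n" where
  "rep c d F = snd d \<circ> F \<circ> chart_inv c"

text \<open>Space-time calculus reduces to calculus at fixed time or fixed point by composing with
  the inclusion of a slice: space derivatives become derivatives along \<open>(v, 0)\<close>, the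
  time derivative the one along \<open>(0, 1)\<close>.\<close>

lemma slice_C1:
  fixes k :: "'a::euclidean_space \<times> real \<Rightarrow> 'b::real_normed_vector"
  assumes k: "C1_on S k"
  shows "C1_on {x. (x, t) \<in> S} (\<lambda>x. k (x, t))"
    "(x, t) \<in> S \<Longrightarrow> fd (\<lambda>x. k (x, t)) x v = fd k (x, t) (v, 0)"
    "(x, t) \<in> S \<Longrightarrow> ((\<lambda>s. k (x, s)) has_vector_derivative fd k (x, t) (0, 1)) (at t)"
proof -
  have d: "((\<lambda>x. k (x, t)) has_derivative (\<lambda>v. fd k (x, t) (v, 0))) (at x)" if "(x, t) \<in> S" for x
    by (rule has_derivative_compose[where f = "\<lambda>x. (x, t)", OF _ C1_on_has_derivative[OF k that]])
      (auto intro!: derivative_eq_intros)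
  show "C1_on {x. (x, t) \<in> S} (\<lambda>x. k (x, t))"
  proof (rule C1_onI)
    show "((\<lambda>x. k (x, t)) has_derivative (\<lambda>v. fd k (x, t) (v, 0))) (at x)" if "x \<in> {x. (x, t) \<in> S}" for x
      using d that by simp
    show "continuous_on {x. (x, t) \<in> S} (\<lambda>x. fd k (x, t) (v, 0))" for v
      by (rule continuous_on_compose2[OF C1_on_continuous_fd[OF k]]) (auto intro!: continuous_intros)
  qed
  show "fd (\<lambda>x. k (x, t)) x v = fd k (x, t) (v, 0)" if "(x, t) \<in> S"
    using fd_unique[OF d[OF that]] by simp
  assume x: "(x, t) \<in> S"
  have "((\<lambda>s. k (x, s)) has_derivative (\<lambda>r. fd k (x, t) (0, r))) (at t)"
    by (rule has_derivative_compose[where f = "\<lambda>s. (x, s)", OF _ C1_on_has_derivative[OF k x]])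
      (auto intro!: derivative_eq_intros)
  moreover have "(\<lambda>r. fd k (x, t) (0, r)) = (\<lambda>r. r *\<^sub>R fd k (x, t) (0, 1))"
  proof
    show "fd k (x, t) (0, r) = r *\<^sub>R fd k (x, t) (0, 1)" for r
      using linear_cmul[OF C1_on_linear_fd[OF k x], of r "(0, 1)"] by simp
  qed
  ultimately show "((\<lambda>s. k (x, s)) has_vector_derivative fd k (x, t) (0, 1)) (at t)"
    unfolding has_vector_derivative_def by (simp only:)
qed

section \<open>Maps between manifolds and their energy density\<close>

locale mapping = M: compact_riemannian A g + N: riemannian B h
  for A :: "('p::{t2_space,second_countable_topology}, 'm::finite) chart set" and g
    and B :: "('q::{t2_space,second_countable_topology}, 'n::finite) chart set" and h
begin

definition C1_map :: "('p \<Rightarrow> 'q) \<Rightarrow> bool" where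
  "C1_map F \<longleftrightarrow> continuous_on UNIV F \<and> (\<forall>c\<in>A. \<forall>d\<in>B. C1_on (snd c ` (fst c \<inter> F -` fst d)) (rep c d F))"

lemma C1_mapD:
  assumes "C1_map F"
  shows "continuous_on UNIV F" "c \<in> A \<Longrightarrow> d \<in> B \<Longrightarrow> C1_on (snd c ` (fst c \<inter> F -` fst d)) (rep c d F)"
  using assms by (auto simp: C1_map_def)

lemma open_preimage: "C1_map F \<Longrightarrow> open U \<Longrightarrow> open (F -` U)"
  using C1_mapD(1) open_vimage by blast

lemma rep_snd: "c \<in> A \<Longrightarrow> p \<in> fst c \<Longrightarrow> rep c d F (snd c p) = snd d (F p)"
  by (simp add: rep_def M.chart(5))

text \<open>One map is written in two ways, changing charts before or after applying
  \<open>F\<close>; the chain rule on the open set where all four charts apply compares the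
  derivatives.\<close>

lemma rep_change:
  assumes F: "C1_map F" and c: "c \<in> A" "p \<in> fst c" "c' \<in> A" "p \<in> fst c'"
    and d: "d \<in> B" "F p \<in> fst d" "d' \<in> B" "F p \<in> fst d'"
  shows "fd (rep c' d' F) (snd c' p) (fd (transition c c') (snd c p) v) =
    fd (transition d d') (snd d (F p)) (fd (rep c d F) (snd c p) v)"
proof -
  let ?S = "snd c ` (fst c \<inter> (fst c' \<inter> F -` (fst d \<inter> fst d')))"
  have S: "open ?S"
    by (rule open_chart_image[OF M.is_chart[OF c(1)]])
      (intro open_Int open_preimage[OF F] M.chart(1)[OF c(3)] N.chart(1) d)
  have x: "snd c p \<in> ?S" using c d by blast
  have "fd (\<lambda>y. rep c' d' F (transition c c' y)) (snd c p) = fd (\<lambda>y. transition d d' (rep c d F y)) (snd c p)"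
    by (rule fd_cong_open[OF S x]) (use c d in \<open>auto simp: M.transition_snd N.transition_snd rep_snd\<close>)
  moreover have "fd (\<lambda>y. rep c' d' F (transition c c' y)) (snd c p) =
      (\<lambda>v. fd (rep c' d' F) (transition c c' (snd c p)) (fd (transition c c') (snd c p) v))"
    by (rule fd_compose[OF M.transition_C1(1)[OF c(1,3)] C1_mapD(2)[OF F c(3) d(3)]])
      (use c d in \<open>auto simp: M.transition_snd\<close>)
  moreover have "fd (\<lambda>y. transition d d' (rep c d F y)) (snd c p) =
      (\<lambda>v. fd (transition d d') (rep c d F (snd c p)) (fd (rep c d F) (snd c p) v))"
    by (rule fd_compose[OF C1_mapD(2)[OF F c(1) d(1)] N.transition_C1(1)[OF d(1,3)]])
      (use c d in \<open>auto simp: rep_snd\<close>)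
  ultimately show ?thesis
    using M.transition_snd[OF c(1,2)] rep_snd[OF c(1,2)] by metis
qed

lemma differential_rep: "differential A B F p = fd (rep (chart_at A p) (chart_at B (F p)) F) (snd (chart_at A p) p)"
  by (simp add: differential_def local_rep_def rep_def)

text \<open>Specializes \<open>rep_change\<close> to the charts in which \<open>differential\<close>
  is defined, and so makes the differential available in any pair of charts.\<close>

lemma differential_from_chart:
  assumes F: "C1_map F" and c: "c \<in> A" "p \<in> fst c" and d: "d \<in> B" "F p \<in> fst d"
  shows "differential A B F p (from_chart A c p v) = from_chart B d (F p) (fd (rep c d F) (snd c p) v)"
  unfolding differential_rep M.from_chart_eq N.from_chart_eq
  by (rule rep_change[OF F c M.chart_at d N.chart_at])

lemma fd_rep_linear:
  assumes F: "C1_map F" and c: "c \<in> A" "p \<in> fst c" and d: "d \<in> B" "F p \<in> fst d"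
  shows "linear (fd (rep c d F) (snd c p))"
  by (rule C1_on_linear_fd[OF C1_mapD(2)[OF F c(1) d(1)]]) (use c d in blast)

lemma linear_differential: "C1_map F \<Longrightarrow> linear (differential A B F p)"
  unfolding differential_rep by (rule fd_rep_linear) (auto simp: M.chart_at N.chart_at)

definition energy_density :: "('p \<Rightarrow> 'q) \<Rightarrow> 'p \<Rightarrow> real" where
  "energy_density F p = 1/2 * metric_trace (g p) (\<lambda>u v. h (F p) (differential A B F p u) (differential A B F p v))"

lemma energy_eq: "energy A g B h F = (\<integral>p. energy_density F p \<partial>M.vol)"
  by (simp add: energy_def energy_density_def)

definition cometric :: "('p, 'm) chart \<Rightarrow> real ^ 'm \<Rightarrow> 'm \<Rightarrow> 'm \<Rightarrow> real" where
  "cometric c x a b = matrix_inv (gram (metric_in A g c x)) $ a $ b"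

text \<open>The energy density as an explicit function of the source point, the target point and the
  first derivatives in the coordinate directions. The bases chosen by SOME are gone, so regularity
  in space and time can be read off.\<close>

definition chart_density :: "('p, 'm) chart \<Rightarrow> ('q, 'n) chart \<Rightarrow> real ^ 'm \<Rightarrow> real ^ 'n \<Rightarrow> ('m \<Rightarrow> real ^ 'n) \<Rightarrow> real" where
  "chart_density c d x y D = 1/2 * (\<Sum>a\<in>UNIV. \<Sum>b\<in>UNIV. cometric c x a b * metric_in B h d y (D a) (D b))"

lemma C1_cometric:
  assumes c: "c \<in> A" shows "C1_on (cdom c) (\<lambda>x. cometric c x a b)"
proof -
  have "linear (\<lambda>w :: real ^ 'm. w $ b)" by (rule bounded_linear.linear[OF bounded_linear_vec_nth])
  then have "C1_form (cdom c) (\<lambda>x w. w $ b)" using M.chart(2)[OF c] by (simp add: C1_form_def)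
  from C1_on_vec_nth[OF C1_on_sharp[OF M.C1_metric_in[OF c] this]]
  show ?thesis
    by (rule C1_on_cong[OF M.chart(2)[OF c]])
      (simp add: cometric_def matrix_inv_gram_sharp[OF M.inner_product_metric_in[OF c]])
qed

lemma h_differential:
  assumes F: "C1_map F" and c: "c \<in> A" "p \<in> fst c" and d: "d \<in> B" "F p \<in> fst d"
  shows "h (F p) (differential A B F p (from_chart A c p u)) (differential A B F p (from_chart A c p v)) =
    metric_in B h d (snd d (F p)) (fd (rep c d F) (snd c p) u) (fd (rep c d F) (snd c p) v)"
  unfolding differential_from_chart[OF assms] N.metric_in_snd[OF d] ..

lemma energy_density_chart:
  assumes F: "C1_map F" and c: "c \<in> A" "p \<in> fst c" and d: "d \<in> B" "F p \<in> fst d"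
  shows "energy_density F p = chart_density c d (snd c p) (snd d (F p)) (\<lambda>a. fd (rep c d F) (snd c p) (axis a 1))"
proof -
  note bl = bilinear_pullback[OF inner_product_bilinear]
  have G: "inner_product (metric_in A g c (snd c p))" using M.inner_product_metric_in c by blast
  have G': "inner_product (metric_in B h d (snd d (F p)))" using N.inner_product_metric_in d by blast
  note l = fd_rep_linear[OF assms] and l' = linear_differential[OF F, of p]
  show ?thesis
    unfolding energy_density_def M.metric_trace_in[OF c bl[OF N.inner_product_g l' l']] h_differential[OF assms]
      metric_trace_coords[OF G bl[OF G' l l]] chart_density_def cometric_def by simp
qed

lemma continuous_energy_density:
  assumes F: "C1_map F" shows "continuous_on UNIV (energy_density F)"
proof (rule continuous_at_imp_continuous_on, rule ballI)
  fix p
  let ?c = "chart_at A p" and ?d = "chart_at B (F p)"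
  let ?U = "fst ?c \<inter> F -` fst ?d" and ?V = "snd ?c ` (fst ?c \<inter> F -` fst ?d)"
  have c: "?c \<in> A" "p \<in> fst ?c" and d: "?d \<in> B" "F p \<in> fst ?d" by (rule M.chart_at N.chart_at)+
  let ?e = "\<lambda>x. chart_density ?c ?d x (rep ?c ?d F x) (\<lambda>a. fd (rep ?c ?d F) x (axis a 1))"
  have U: "open ?U" by (intro open_Int M.chart(1)[OF c(1)] open_preimage[OF F] N.chart(1)[OF d(1)])
  have V: "?V \<subseteq> cdom ?c" "open ?V" by (blast, rule open_chart_image[OF M.is_chart[OF c(1)] open_preimage[OF F N.chart(1)[OF d(1)]]])
  have r: "rep ?c ?d F ` ?V \<subseteq> cdom ?d" using rep_snd[OF c(1), of _ ?d F] by auto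
  note C = C1_mapD(2)[OF F c(1) d(1)]
  \<comment> \<open>For a C^1 map the first derivatives are merely continuous, so
    \<open>C1_metric_comp\<close> is out of reach for them; the bilinear expansion gives continuity
    directly.\<close>
  have met: "continuous_on ?V (\<lambda>x. metric_in B h ?d (rep ?c ?d F x) (fd (rep ?c ?d F) x (axis a 1)) (fd (rep ?c ?d F) x (axis b 1)))" for a b
  proof -
    have "continuous_on ?V (\<lambda>x. \<Sum>i\<in>UNIV. \<Sum>j\<in>UNIV. (fd (rep ?c ?d F) x (axis a 1) $ i * fd (rep ?c ?d F) x (axis b 1) $ j) *\<^sub>R
        metric_in B h ?d (rep ?c ?d F x) (axis i 1) (axis j 1))"
      by (intro continuous_intros C1_on_continuous_fd[OF C]
          continuous_on_compose2[OF C1_on_continuous_on[OF C1_metricD(3)[OF N.C1_metric_in[OF d(1)]]] C1_on_continuous_on[OF C] r])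
    moreover have "metric_in B h ?d (rep ?c ?d F x) u v = (\<Sum>i\<in>UNIV. \<Sum>j\<in>UNIV. (u $ i * v $ j) *\<^sub>R
        metric_in B h ?d (rep ?c ?d F x) (axis i 1) (axis j 1))" if "x \<in> ?V" for x u v
      by (rule bilinear_axis[OF C1_metricD(4)[OF N.C1_metric_in[OF d(1)]]]) (use r that in blast)
    ultimately show ?thesis by (subst continuous_on_cong[OF refl]) assumption
  qed
  have "continuous_on ?V ?e"
    unfolding chart_density_def
    by (intro continuous_intros met continuous_on_subset[OF C1_on_continuous_on[OF C1_cometric[OF c(1)]] V(1)])
  then have "continuous_on ?U (\<lambda>q. ?e (snd ?c q))"
    by (rule continuous_on_compose2[OF _ continuous_on_subset[OF M.chart(3)[OF c(1)]]]) auto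
  then have "continuous_on ?U (energy_density F)"
    by (rule continuous_on_eq) (use energy_density_chart[OF F c(1) _ d(1)] rep_snd[OF c(1), of _ ?d F] in auto)
  then show "isCont (energy_density F) p" using continuous_on_eq_continuous_at[OF U] c d by blast
qed

end

section \<open>The flow in space-time charts\<close>

locale flow = mapping A g B h
  for A :: "('p::{t2_space,second_countable_topology}, 'm::finite) chart set" and g
    and B :: "('q::{t2_space,second_countable_topology}, 'n::finite) chart set" and h +
  fixes f :: "real \<Rightarrow> 'p \<Rightarrow> 'q"
  assumes smooth: "smooth_family A B {0..} f"
begin

text \<open>The strict inequality on time makes this set open, so that ordinary two-sided
  derivatives of \<open>phi\<close> exist on it.\<close>

definition Om :: "('p, 'm) chart \<Rightarrow> ('q, 'n) chart \<Rightarrow> ((real ^ 'm) \<times> real) set" where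
  "Om c d = {(x, t). x \<in> cdom c \<and> 0 < t \<and> f t (chart_inv c x) \<in> fst d}"

definition phi :: "('p, 'm) chart \<Rightarrow> ('q, 'n) chart \<Rightarrow> (real ^ 'm) \<times> real \<Rightarrow> real ^ 'n" where
  "phi c d z = snd d (f (snd z) (chart_inv c (fst z)))"

lemma continuous_f: "continuous_on (UNIV \<times> {0..}) (\<lambda>z. f (snd z) (fst z))"
  using smooth by (simp add: smooth_family_def case_prod_unfold)

lemma open_Om:
  assumes c: "c \<in> A" and d: "d \<in> B"
  shows "open (Om c d)"
proof -
  let ?S = "cdom c \<times> {0 <..} :: ((real ^ 'm) \<times> real) set"
  have "continuous_on ?S (\<lambda>z. f (snd z) (chart_inv c (fst z)))"
    by (rule continuous_on_compose2[OF continuous_f, of _ "\<lambda>z. (chart_inv c (fst z), snd z)", simplified])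
      (auto intro!: continuous_intros continuous_on_compose2[OF M.chart(4)[OF c]])
  moreover have "open ?S" by (intro open_Times M.chart(2)[OF c]) simp
  ultimately have "open (?S \<inter> (\<lambda>z. f (snd z) (chart_inv c (fst z))) -` fst d)"
    by (rule continuous_open_preimage[OF _ _ N.chart(1)[OF d]])
  moreover have "?S \<inter> (\<lambda>z. f (snd z) (chart_inv c (fst z))) -` fst d = Om c d" by (auto simp: Om_def)
  ultimately show ?thesis by simp
qed

lemma phi_C1:
  assumes c: "c \<in> A" and d: "d \<in> B"
  shows "C1_on (Om c d) (phi c d)" "C1_on (Om c d) (\<lambda>z. fd (phi c d) z w)"
proof -
  have "smooth_on {(x, t). x \<in> cdom c \<and> t \<in> {0..} \<and> f t (chart_inv c x) \<in> fst d} (phi c d)"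
    using smooth c d unfolding smooth_family_def phi_def[abs_def] case_prod_unfold by blast
  note s = this open_Om[OF c d]
  show "C1_on (Om c d) (phi c d)" "C1_on (Om c d) (\<lambda>z. fd (phi c d) z w)"
    by (rule smooth_on_imp_C1_on[OF s] smooth_on_imp_C1_on_fd[OF s]; auto simp: Om_def)+
qed

lemma phi_image: "d \<in> B \<Longrightarrow> phi c d ` Om c d \<subseteq> cdom d"
  by (auto simp: phi_def Om_def)

lemma rep_phi: "rep c d (f t) = (\<lambda>x. phi c d (x, t))"
  by (auto simp: rep_def phi_def)

lemma mem_Om: "c \<in> A \<Longrightarrow> p \<in> fst c \<Longrightarrow> 0 < t \<Longrightarrow> (snd c p, t) \<in> Om c d \<longleftrightarrow> f t p \<in> fst d"
  by (auto simp: Om_def M.chart(5))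

lemma Om_slice: "c \<in> A \<Longrightarrow> 0 < t \<Longrightarrow> snd c ` (fst c \<inter> f t -` fst d) = {x. (x, t) \<in> Om c d}"
  using chart_image_eq[OF M.is_chart] by (auto simp: Om_def)

lemma C1_map_f:
  assumes t: "t > 0" shows "C1_map (f t)"
  unfolding C1_map_def
proof (intro conjI ballI)
  show "continuous_on UNIV (f t)"
    by (rule continuous_on_compose2[OF continuous_f, of UNIV "\<lambda>p. (p, t)", simplified])
      (use t in \<open>auto intro!: continuous_intros\<close>)
  show "C1_on (snd c ` (fst c \<inter> f t -` fst d)) (rep c d (f t))" if "c \<in> A" "d \<in> B" for c d
    unfolding Om_slice[OF that(1) t] rep_phi by (rule slice_C1(1)[OF phi_C1(1)[OF that]])
qed

lemma fd_rep_phi: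
  assumes "c \<in> A" "p \<in> fst c" "d \<in> B" "f t p \<in> fst d" "t > 0"
  shows "fd (rep c d (f t)) (snd c p) v = fd (phi c d) (snd c p, t) (v, 0)"
  unfolding rep_phi by (rule slice_C1(2)[OF phi_C1(1)[OF assms(1,3)]]) (use assms in \<open>simp add: mem_Om\<close>)

text \<open>At positive times the derivative within the half-line is the full derivative, and the
  chain rule carries it from the chart fixed at \<open>f t p\<close> to \<open>d\<close>.\<close>

lemma velocity_chart:
  assumes c: "c \<in> A" "p \<in> fst c" and d: "d \<in> B" "f t p \<in> fst d" and t: "t > 0"
  shows "velocity B f t p = from_chart B d (f t p) (fd (phi c d) (snd c p, t) (0, 1))"
proof -
  let ?d = "chart_at B (f t p)" and ?x = "snd c p"
  have d': "?d \<in> B" "f t p \<in> fst ?d" by (rule N.chart_at)+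
  have z: "(?x, t) \<in> Om c ?d" "(?x, t) \<in> Om c d" using mem_Om[OF c t] d d' by auto
  have "at t within {0..} = at t" by (rule at_within_interior) (use t in simp)
  moreover have "((\<lambda>s. phi c ?d (?x, s)) has_vector_derivative fd (phi c ?d) (?x, t) (0, 1)) (at t)"
    by (rule slice_C1(3)[OF phi_C1(1)[OF c(1) d'(1)] z(1)])
  ultimately have "velocity B f t p = fd (phi c ?d) (?x, t) (0, 1)"
    unfolding velocity_def by (simp add: phi_def M.chart(5)[OF c] vector_derivative_at)
  also have "fd (phi c ?d) (?x, t) = fd (\<lambda>z. transition d ?d (phi c d z)) (?x, t)"
    by (rule fd_cong_open[OF open_Int[OF open_Om[OF c(1) d(1)] open_Om[OF c(1) d'(1)]]])
      (use z N.transition_snd[OF d(1), of _ ?d] in \<open>auto simp: phi_def Om_def\<close>)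
  also have "\<dots> = (\<lambda>w. fd (transition d ?d) (phi c d (?x, t)) (fd (phi c d) (?x, t) w))"
    by (rule fd_compose[OF phi_C1(1)[OF c(1) d(1)] N.transition_C1(1)[OF d(1) d'(1)] z(2)])
      (use c d d' in \<open>auto simp: phi_def M.chart(5)\<close>)
  finally show ?thesis by (simp add: N.from_chart_eq phi_def M.chart(5)[OF c])
qed

definition eps :: "('p, 'm) chart \<Rightarrow> ('q, 'n) chart \<Rightarrow> (real ^ 'm) \<times> real \<Rightarrow> real" where
  "eps c d z = chart_density c d (fst z) (phi c d z) (\<lambda>a. fd (phi c d) z (axis a 1, 0))"

lemma C1_eps:
  assumes c: "c \<in> A" and d: "d \<in> B"
  shows "C1_on (Om c d) (eps c d)"
proof -
  have fst: "C1_on (Om c d) fst" by (rule C1_on_linear) (simp add: bounded_linear.linear[OF bounded_linear_fst])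
  have "C1_on (Om c d) (\<lambda>z. cometric c (fst z) a b)" for a b
    by (rule C1_on_compose[OF fst C1_cometric[OF c]]) (auto simp: Om_def)
  then show ?thesis
    unfolding eps_def[abs_def] chart_density_def
    by (intro C1_on_mult C1_on_sum C1_on_const)
      (auto intro: C1_metric_comp(1)[OF N.C1_metric_in[OF d] open_Om[OF c d] phi_C1(1)[OF c d] phi_image[OF d] phi_C1(2)[OF c d] phi_C1(2)[OF c d]])
qed

lemma energy_density_eps:
  assumes "c \<in> A" "p \<in> fst c" "d \<in> B" "f t p \<in> fst d" "t > 0"
  shows "energy_density (f t) p = eps c d (snd c p, t)"
  using energy_density_chart[OF C1_map_f[OF assms(5)] assms(1-4)] assms
  by (simp add: eps_def fd_rep_phi phi_def M.chart(5))

lemma energy_density_has_derivative: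
  assumes c: "c \<in> A" "p \<in> fst c" and d: "d \<in> B" "f t p \<in> fst d" and t: "t > 0"
  shows "((\<lambda>s. energy_density (f s) p) has_real_derivative fd (eps c d) (snd c p, t) (0, 1)) (at t)"
proof -
  let ?T = "{s. (snd c p, s) \<in> Om c d}"
  have z: "(snd c p, t) \<in> Om c d" using mem_Om[OF c t] d by simp
  have der: "((\<lambda>s. eps c d (snd c p, s)) has_real_derivative fd (eps c d) (snd c p, t) (0, 1)) (at t)"
    using slice_C1(3)[OF C1_eps[OF c(1) d(1)] z] by (simp add: has_real_derivative_iff_has_vector_derivative)
  have op: "open ?T"
    using continuous_open_preimage[of UNIV "\<lambda>s. (snd c p, s)" "Om c d"] open_Om[OF c(1) d(1)]
    by (simp add: vimage_def continuous_on_Pair)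
  have eq: "eps c d (snd c p, s) = energy_density (f s) p" if "s \<in> ?T" for s
  proof -
    have "0 < s" "f s p \<in> fst d" using that by (auto simp: Om_def M.chart(5)[OF c])
    then show ?thesis using energy_density_eps[OF c d(1)] by simp
  qed
  show ?thesis
    by (rule has_field_derivative_transform_within_open[OF der op _ eq]) (use z in simp_all)
qed

section \<open>Differentiating the energy in time\<close>

text \<open>Defined through \<open>deriv\<close>, hence without reference to charts, so that the
  local formulas in different charts describe one and the same function.\<close>

definition energy_density' :: "real \<Rightarrow> 'p \<Rightarrow> real" where
  "energy_density' t p = deriv (\<lambda>s. energy_density (f s) p) t"

lemma energy_density':
  assumes "c \<in> A" "p \<in> fst c" "d \<in> B" "f t p \<in> fst d" "t > 0"
  shows "energy_density' t p = fd (eps c d) (snd c p, t) (0, 1)"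
  unfolding energy_density'_def by (rule DERIV_imp_deriv[OF energy_density_has_derivative[OF assms]])

lemma energy_density_DERIV:
  assumes t: "t > 0"
  shows "((\<lambda>s. energy_density (f s) p) has_real_derivative energy_density' t p) (at t)"
  using energy_density_has_derivative[OF M.chart_at N.chart_at t] energy_density'[OF M.chart_at N.chart_at t] by metis

lemma energy_density'_locally_bounded:
  assumes t: "t > 0"
  shows "\<exists>U r C. open U \<and> p \<in> U \<and> r > 0 \<and> (\<forall>q\<in>U. \<forall>s. \<bar>s - t\<bar> < r \<longrightarrow> \<bar>energy_density' s q\<bar> \<le> C)"
proof -
  let ?c = "chart_at A p" and ?d = "chart_at B (f t p)"
  have c: "?c \<in> A" "p \<in> fst ?c" and d: "?d \<in> B" "f t p \<in> fst ?d" by (rule M.chart_at N.chart_at)+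
  let ?x = "snd ?c p" and ?k = "\<lambda>z. fd (eps ?c ?d) z (0, 1)"
  have z: "(?x, t) \<in> Om ?c ?d" using mem_Om[OF c t] d by simp
  have "isCont ?k (?x, t)"
    using C1_on_continuous_fd[OF C1_eps[OF c(1) d(1)]] continuous_on_eq_continuous_at[OF open_Om[OF c(1) d(1)]] z by blast
  then obtain e where e: "e > 0" "\<And>w. dist w (?x, t) < e \<Longrightarrow> dist (?k w) (?k (?x, t)) < 1"
    unfolding continuous_at_eps_delta by (metis zero_less_one)
  obtain e' where e': "e' > 0" "ball (?x, t) e' \<subseteq> Om ?c ?d"
    using open_Om[OF c(1) d(1)] z open_contains_ball by blast
  \<comment> \<open>Half, because the distance in the product is bounded by the sum of the distances
    in space and in time.\<close>
  define r where "r = min e e' / 2"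
  have r: "r > 0" using e e' by (simp add: r_def)
  let ?U = "fst ?c \<inter> snd ?c -` ball ?x r"
  have "\<bar>energy_density' s q\<bar> \<le> \<bar>?k (?x, t)\<bar> + 1" if q: "q \<in> ?U" and s: "\<bar>s - t\<bar> < r" for q s
  proof -
    have "dist (snd ?c q, s) (?x, t) \<le> dist (snd ?c q) ?x + dist s t"
      unfolding dist_prod_def by (simp add: sqrt_sum_squares_le_sum)
    also have "\<dots> < r + r" using q s by (intro add_strict_mono) (auto simp: dist_real_def dist_commute)
    also have "\<dots> = min e e'" by (simp add: r_def)
    finally have *: "dist (snd ?c q, s) (?x, t) < e" "(snd ?c q, s) \<in> Om ?c ?d"
      using e' by (auto simp: dist_commute)
    then have "f s q \<in> fst ?d" "s > 0" using q by (auto simp: Om_def M.chart(5)[OF c(1)])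
    then have "energy_density' s q = ?k (snd ?c q, s)" using q by (intro energy_density'[OF c(1) _ d(1)]) auto
    then show ?thesis using e(2)[OF *(1)] by (auto simp: dist_real_def)
  qed
  moreover have "open ?U" by (rule open_chart_preimage[OF M.is_chart[OF c(1)]]) simp
  moreover have "p \<in> ?U" using c r by simp
  ultimately show ?thesis
    using r by (intro exI[of _ ?U] exI[of _ r] exI[of _ "\<bar>?k (?x, t)\<bar> + 1"] conjI ballI allI impI)
qed

text \<open>Compactness reduces the local bounds to finitely many: the smallest time radius works,
  and the sum of the absolute values of the bounds majorizes each of them.\<close>

lemma energy_density'_bounded:
  assumes t: "t > 0"
  shows "\<exists>r C. r > 0 \<and> (\<forall>q s. \<bar>s - t\<bar> < r \<longrightarrow> \<bar>energy_density' s q\<bar> \<le> C)"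
proof -
  obtain U r C where U: "\<And>p. open (U p)" "\<And>p. p \<in> U p" "\<And>p. r p > (0 :: real)"
    "\<And>p q s. q \<in> U p \<Longrightarrow> \<bar>s - t\<bar> < r p \<Longrightarrow> \<bar>energy_density' s q\<bar> \<le> C p"
    using energy_density'_locally_bounded[OF t] by metis
  have "UNIV \<subseteq> (\<Union>p\<in>UNIV. U p)" using U(2) by blast
  then obtain P where P: "finite P" "UNIV \<subseteq> (\<Union>p\<in>P. U p)"
    using compactE_image[OF M.compact, of UNIV U] U(1) by metis
  define R where "R = Min (insert 1 (r ` P))"
  have "R > 0" unfolding R_def using P(1) U(3) by (subst Min_gr_iff) auto
  moreover have "\<bar>energy_density' s q\<bar> \<le> (\<Sum>p\<in>P. \<bar>C p\<bar>)" if "\<bar>s - t\<bar> < R" for q s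
  proof -
    obtain p where p: "p \<in> P" "q \<in> U p" using P(2) by blast
    have "R \<le> r p" unfolding R_def using P(1) p(1) by (intro Min_le) auto
    then have "\<bar>energy_density' s q\<bar> \<le> C p" using U(4)[OF p(2)] that by simp
    also have "C p \<le> (\<Sum>p\<in>P. \<bar>C p\<bar>)"
      using member_le_sum[of p P "\<lambda>p. \<bar>C p\<bar>"] p(1) P(1) by force
    finally show ?thesis .
  qed
  ultimately show ?thesis by blast
qed

text \<open>The volume is finite, so the constant bound is an integrable dominating function near
  time \<open>t\<close>.\<close>

lemma energy_DERIV:
  assumes t: "t > 0"
  shows "integrable M.vol (energy_density' t)"
    "((\<lambda>s. energy A g B h (f s)) has_real_derivative (\<integral>p. energy_density' t p \<partial>M.vol)) (at t)"
proof -
  obtain r C where r: "r > 0" "\<And>q s. \<bar>s - t\<bar> < r \<Longrightarrow> \<bar>energy_density' s q\<bar> \<le> C"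
    using energy_density'_bounded[OF t] by blast
  \<comment> \<open>The minimum with \<open>t\<close> keeps all times considered positive.\<close>
  define r' where "r' = min r t"
  have r': "r' > 0" using r t by (simp add: r'_def)
  have pos: "s > 0" if "\<bar>s - t\<bar> < r'" for s using that by (auto simp: r'_def abs_less_iff)
  have 1: "integrable M.vol (energy_density (f s))" if "\<bar>s - t\<bar> < r'" for s
    by (rule M.integrable_vol_continuous[OF continuous_energy_density[OF C1_map_f[OF pos[OF that]]]])
  have 2: "((\<lambda>s. energy_density (f s) p) has_real_derivative energy_density' s p) (at s)" if "\<bar>s - t\<bar> < r'" for p s
    by (rule energy_density_DERIV[OF pos[OF that]])
  have 3: "\<bar>energy_density' s p\<bar> \<le> C" if "\<bar>s - t\<bar> < r'" for s p using r(2) that by (simp add: r'_def)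
  have 4: "integrable M.vol (\<lambda>_. C)" by (rule M.integrable_vol_bounded[of _ "\<bar>C\<bar>"]) auto
  note L = has_real_derivative_integral[of r' t M.vol "\<lambda>s. energy_density (f s)" energy_density' "\<lambda>_. C", OF r' 1 2 3 4]
  show "integrable M.vol (energy_density' t)" by (rule L(1)) auto
  show "((\<lambda>s. energy A g B h (f s)) has_real_derivative (\<integral>p. energy_density' t p \<partial>M.vol)) (at t)"
    unfolding energy_eq by (rule L(2)) auto
qed

section \<open>The first variation formula\<close>

definition omega :: "real \<Rightarrow> 'p \<Rightarrow> real ^ 'm \<Rightarrow> real" where
  "omega t p v = h (f t p) (differential A B (f t) p v) (velocity B f t p)"

lemma omega_chart:
  assumes c: "c \<in> A" and d: "d \<in> B" and z: "(x, t) \<in> Om c d"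
  shows "M.form_in c (omega t) x v =
    metric_in B h d (phi c d (x, t)) (fd (phi c d) (x, t) (v, 0)) (fd (phi c d) (x, t) (0, 1))"
proof -
  let ?p = "chart_inv c x"
  have x: "x \<in> cdom c" "t > 0" "f t ?p \<in> fst d" using z by (auto simp: Om_def)
  have p: "?p \<in> fst c" "snd c ?p = x" using M.chart(6,7)[OF c x(1)] by auto
  have "differential A B (f t) ?p (from_chart A c ?p v) = from_chart B d (f t ?p) (fd (phi c d) (x, t) (v, 0))"
    using differential_from_chart[OF C1_map_f[OF x(2)] c p(1) d x(3)] fd_rep_phi[OF c p(1) d x(3,2)] p(2) by simp
  moreover have "velocity B f t ?p = from_chart B d (f t ?p) (fd (phi c d) (x, t) (0, 1))"
    using velocity_chart[OF c p(1) d x(3,2)] p(2) by simp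
  ultimately show ?thesis
    using N.metric_in_snd[OF d x(3)] by (simp add: M.form_in_def omega_def phi_def)
qed

lemma C1_omega:
  assumes t: "t > 0"
  shows "M.C1_oneform (omega t)"
  unfolding M.C1_oneform_def
proof (intro conjI allI ballI)
  fix p
  have "linear (\<lambda>w. h (f t p) w (velocity B f t p))"
    using inner_product_bilinear[OF N.inner_product_g] by (simp add: bilinear_def)
  from linear_compose[OF linear_differential[OF C1_map_f[OF t]] this]
  show "linear (omega t p)" by (simp add: omega_def[abs_def] o_def)
next
  fix c v assume c: "c \<in> A"
  show "C1_on (cdom c) (\<lambda>x. M.form_in c (omega t) x v)"
  proof (rule C1_on_local)
    fix x assume x: "x \<in> cdom c"
    let ?d = "chart_at B (f t (chart_inv c x))"
    have d: "?d \<in> B" "f t (chart_inv c x) \<in> fst ?d" by (rule N.chart_at)+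
    let ?U = "{x. (x, t) \<in> Om c ?d}"
    let ?k = "\<lambda>z. metric_in B h ?d (phi c ?d z) (fd (phi c ?d) z (v, 0)) (fd (phi c ?d) z (0, 1))"
    have "C1_on (Om c ?d) ?k"
      by (rule C1_metric_comp(1)[OF N.C1_metric_in[OF d(1)] open_Om[OF c d(1)] phi_C1(1)[OF c d(1)] phi_image[OF d(1)]
            phi_C1(2)[OF c d(1)] phi_C1(2)[OF c d(1)]])
    then have "C1_on ?U (\<lambda>x. ?k (x, t))" by (rule slice_C1(1))
    moreover have "open ?U"
      using continuous_open_preimage[of UNIV "\<lambda>x. (x, t)" "Om c ?d"] open_Om[OF c d(1)]
      by (simp add: vimage_def continuous_on_Pair)
    moreover have "x \<in> ?U" using x t d by (simp add: Om_def)
    ultimately show "\<exists>U g. open U \<and> x \<in> U \<and> C1_on U g \<and> (\<forall>y\<in>U. M.form_in c (omega t) y v = g y)"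
      using omega_chart[OF c d(1)] by (intro exI[of _ ?U] exI[of _ "\<lambda>x. ?k (x, t)"]) auto
  qed
qed

text \<open>At \<open>p\<close>, all terms are computed in the charts in which the tension field at \<open>p\<close> is defined, so
  that no transformation rule for the second fundamental form is needed.\<close>

lemma first_variation_pointwise:
  assumes t: "t > 0"
  shows "energy_density' t p = M.divergence (omega t) p - h (f t p) (tension A g B h (f t) p) (velocity B f t p)"
proof -
  define c where "c = chart_at A p"
  define d where "d = chart_at B (f t p)"
  have c: "c \<in> A" "p \<in> fst c" and d: "d \<in> B" "f t p \<in> fst d"
    unfolding c_def d_def by (rule M.chart_at N.chart_at)+
  define x where "x = snd c p"
  define z where "z = (x, t)"
  define \<phi> where "\<phi> = phi c d"
  define G where "G = metric_in B h d"
  define y where "y = \<phi> z"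
  \<comment> \<open>One orthonormal basis at \<open>p\<close> serves everywhere below: the point
    does not move in the time derivative, and the traces involve values at \<open>p\<close>
    only.\<close>
  define e where "e = onb (g p)"
  define T where "T = fd \<phi> z (0, 1)"
  define D where "D = (\<lambda>v. fd \<phi> z (v, 0))"
  define D2 where "D2 = (\<lambda>v w. fd (\<lambda>z. fd \<phi> z (v, 0)) z w)"
  have z: "z \<in> Om c d" using mem_Om[OF c t] d by (simp add: z_def x_def)
  have yV: "y \<in> cdom d" using phi_image[OF d(1), of c] z by (auto simp: y_def \<phi>_def)
  have hG: "h (f t p) = G y"
    using N.metric_in_at[of "f t p"] by (simp add: G_def y_def \<phi>_def phi_def z_def x_def M.chart(5)[OF c] d_def)
  have gG: "metric_in A g c x = g p" using M.metric_in_at[of p] by (simp add: c_def x_def)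
  note O = open_Om[OF c(1) d(1)] and GM = N.C1_metric_in[OF d(1), folded G_def]
    and P = phi_C1[OF c(1) d(1), folded \<phi>_def] phi_image[OF d(1), of c, folded \<phi>_def]
  have sl: "open {x. (x, t) \<in> Om c d}"
    using continuous_open_preimage[of UNIV "\<lambda>x. (x, t)" "Om c d"] O by (simp add: vimage_def continuous_on_Pair)
  \<comment> \<open>Symmetry of second derivatives between space and time: the space derivative of
    the velocity is the time derivative of the differential.\<close>
  have comm: "fd (\<lambda>z. fd \<phi> z (0, 1)) z (v, 0) = D2 v (0, 1)" for v
    unfolding D2_def by (rule fd_fd_commute[OF O z P(1,2)])
  have Gsym: "G y a b = G y b a" for a b by (rule C1_metricD(5)[OF GM yV])
  note B = C1_metricD(4)[OF GM yV]
  have from_id: "from_chart A c p v = v" for v unfolding c_def by (rule M.from_chart_self)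

  have dens: "energy_density' t p = 1/2 * (\<Sum>i\<in>UNIV. fd (\<lambda>y. G y (D (e i)) (D (e i))) y T + 2 * G y (D2 (e i) (0, 1)) (D (e i)))"
  proof -
    let ?k = "\<lambda>i z. G (\<phi> z) (fd \<phi> z (e i, 0)) (fd \<phi> z (e i, 0))"
    let ?S = "{s. (x, s) \<in> Om c d}"
    have dk: "((\<lambda>s. ?k i (x, s)) has_real_derivative
        fd (\<lambda>y. G y (D (e i)) (D (e i))) y T + 2 * G y (D2 (e i) (0, 1)) (D (e i))) (at t)" for i
    proof -
      have "C1_on (Om c d) (?k i)" by (rule C1_metric_comp(1)[OF GM O P(1,3) P(2) P(2)])
      from slice_C1(3)[OF this z[unfolded z_def]]
      have "((\<lambda>s. ?k i (x, s)) has_real_derivative fd (?k i) z (0, 1)) (at t)"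
        by (simp add: has_real_derivative_iff_has_vector_derivative z_def)
      then show ?thesis
        using C1_metric_comp(2)[OF GM O P(1,3) P(2) P(2) z, of "(e i, 0)" "(e i, 0)" "(0, 1)"]
          Gsym[of "D (e i)" "D2 (e i) (0, 1)"] by (simp add: y_def T_def D_def D2_def add.commute)
    qed
    have S: "open ?S"
      using continuous_open_preimage[of UNIV "\<lambda>s. (x, s)" "Om c d"] O by (simp add: vimage_def continuous_on_Pair)
    have eq: "1/2 * (\<Sum>i\<in>UNIV. ?k i (x, s)) = energy_density (f s) p" if "s \<in> ?S" for s
    proof -
      have s: "s > 0" "f s p \<in> fst d" using that by (auto simp: Om_def x_def M.chart(5)[OF c])
      have "h (f s p) (differential A B (f s) p u) (differential A B (f s) p v) =
          G (\<phi> (x, s)) (fd \<phi> (x, s) (u, 0)) (fd \<phi> (x, s) (v, 0))" for u v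
        using h_differential[OF C1_map_f[OF s(1)] c d(1) s(2), of u v] fd_rep_phi[OF c d(1) s(2,1)]
        by (simp add: from_id G_def \<phi>_def x_def phi_def M.chart(5)[OF c])
      then show ?thesis by (simp add: energy_density_def metric_trace_onb e_def)
    qed
    have "((\<lambda>s. 1/2 * (\<Sum>i\<in>UNIV. ?k i (x, s))) has_real_derivative
        1/2 * (\<Sum>i\<in>UNIV. fd (\<lambda>y. G y (D (e i)) (D (e i))) y T + 2 * G y (D2 (e i) (0, 1)) (D (e i)))) (at t)"
      by (intro DERIV_cmult DERIV_sum dk)
    then have "((\<lambda>s. energy_density (f s) p) has_real_derivative
        1/2 * (\<Sum>i\<in>UNIV. fd (\<lambda>y. G y (D (e i)) (D (e i))) y T + 2 * G y (D2 (e i) (0, 1)) (D (e i)))) (at t)"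
      by (rule has_field_derivative_transform_within_open[OF _ S]) (use z eq in \<open>auto simp: z_def\<close>)
    then show ?thesis using DERIV_unique energy_density_DERIV[OF t] by blast
  qed

  define \<Gamma> where "\<Gamma> = (\<lambda>u v. christoffel (metric_in A g c) x u v)"
  have div: "M.divergence (omega t) p = (\<Sum>i\<in>UNIV. fd (\<lambda>y. G y (D (e i)) T) y (D (e i)) + G y (D2 (e i) (e i, 0)) T
      + G y (D (e i)) (D2 (e i) (0, 1)) - G y (D (\<Gamma> (e i) (e i))) T)"
  proof -
    have "nabla_form (metric_in A g c) (M.form_in c (omega t)) x u v =
        fd (\<lambda>y. G y (D v) T) y (D u) + G y (D2 v (u, 0)) T + G y (D v) (D2 u (0, 1)) - G y (D (\<Gamma> u v)) T" for u v
    proof -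
      let ?k = "\<lambda>z. G (\<phi> z) (fd \<phi> z (v, 0)) (fd \<phi> z (0, 1))"
      have k: "C1_on (Om c d) ?k" by (rule C1_metric_comp(1)[OF GM O P(1,3) P(2) P(2)])
      have "fd (\<lambda>y. M.form_in c (omega t) y v) x = fd (\<lambda>y. ?k (y, t)) x"
        by (rule fd_cong_open[OF sl]) (use z omega_chart[OF c(1) d(1)] in \<open>auto simp: z_def G_def \<phi>_def\<close>)
      then have "fd (\<lambda>y. M.form_in c (omega t) y v) x u = fd ?k z (u, 0)"
        using slice_C1(2)[OF k z[unfolded z_def]] by (simp add: z_def)
      also have "\<dots> = fd (\<lambda>y. G y (D v) T) y (D u) + G y (D2 v (u, 0)) T + G y (D v) (D2 u (0, 1))"
        using C1_metric_comp(2)[OF GM O P(1,3) P(2) P(2) z, of "(v, 0)" "(0, 1)" "(u, 0)"] comm[of u]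
        by (simp add: y_def T_def D_def D2_def)
      finally show ?thesis
        using omega_chart[OF c(1) d(1) z[unfolded z_def]]
        by (simp add: nabla_form_def \<Gamma>_def G_def y_def \<phi>_def D_def T_def z_def)
    qed
    then show ?thesis
      by (simp add: M.divergence_def Let_def div_form_def c_def[symmetric] x_def[symmetric] gG metric_trace_onb e_def)
  qed

  have tens: "tension A g B h (f t) p =
      (\<Sum>i\<in>UNIV. D2 (e i) (e i, 0) + christoffel G y (D (e i)) (D (e i)) - D (\<Gamma> (e i) (e i)))"
  proof -
    \<comment> \<open>The charts \<open>c\<close> and \<open>d\<close> are those fixed at
      \<open>p\<close> and at \<open>f t p\<close>, so the local expression in the definition of the
      tension field is literally \<open>\<phi>\<close> at time \<open>t\<close>.\<close>
    have r: "local_rep A B (f t) p = (\<lambda>y. \<phi> (y, t))"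
      by (auto simp: local_rep_def \<phi>_def phi_def c_def d_def)
    have D': "fd (\<lambda>y. \<phi> (y, t)) y v = fd \<phi> (y, t) (v, 0)" if "(y, t) \<in> Om c d" for y v
      by (rule slice_C1(2)[OF P(1) that])
    have D2': "fd (\<lambda>y. fd (\<lambda>y. \<phi> (y, t)) y v) x u = D2 v (u, 0)" for u v
    proof -
      have "fd (\<lambda>y. fd (\<lambda>y. \<phi> (y, t)) y v) x = fd (\<lambda>y. fd \<phi> (y, t) (v, 0)) x"
        by (rule fd_cong_open[OF sl]) (use z D' in \<open>auto simp: z_def\<close>)
      then show ?thesis using slice_C1(2)[OF P(2) z[unfolded z_def]] by (simp add: D2_def z_def)
    qed
    have "nabla_differential A g B h (f t) p u v =
        D2 v (u, 0) + christoffel G y (D u) (D v) - D (\<Gamma> u v)" for u v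
      unfolding nabla_differential_def Let_def r nabla_field_def pullback_nabla_def
        c_def[symmetric] d_def[symmetric] x_def[symmetric] G_def[symmetric] D2'
      using D'[OF z[unfolded z_def]] by (simp add: D_def z_def y_def \<Gamma>_def)
    then show ?thesis by (simp add: tension_def metric_trace_onb e_def)
  qed

  have vel: "velocity B f t p = T"
    using velocity_chart[OF c d t] N.from_chart_self[of "f t p"]
    by (simp add: T_def \<phi>_def z_def x_def d_def)
  have "h (f t p) (tension A g B h (f t) p) (velocity B f t p) =
      (\<Sum>i\<in>UNIV. G y (D2 (e i) (e i, 0)) T + G y (christoffel G y (D (e i)) (D (e i))) T - G y (D (\<Gamma> (e i) (e i))) T)"
  proof -
    have l: "linear (\<lambda>w. G y w T)" using B by (simp add: bilinear_def)
    show ?thesis unfolding hG vel tens by (simp add: linear_sum[OF l] linear_add[OF l] linear_diff[OF l])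
  qed
  then show ?thesis
    unfolding dens div sum_distrib_left sum_subtractf[symmetric]
  proof (simp only: sum_subtractf[symmetric], intro sum.cong refl)
    fix i
    \<comment> \<open>Second space derivatives and the Christoffel terms of the domain cancel
      between divergence and tension. What remains is the variation of the target metric, which the
      Koszul formula matches with the Christoffel term of the target.\<close>
    have "2 * G y (christoffel G y (D (e i)) (D (e i))) T =
        2 * fd (\<lambda>y. G y (D (e i)) T) y (D (e i)) - fd (\<lambda>y. G y (D (e i)) (D (e i))) y T"
      using christoffel[OF GM yV, of "D (e i)" "D (e i)" T] by simp
    then show "1/2 * (fd (\<lambda>y. G y (D (e i)) (D (e i))) y T + 2 * G y (D2 (e i) (0, 1)) (D (e i))) =
        fd (\<lambda>y. G y (D (e i)) T) y (D (e i)) + G y (D2 (e i) (e i, 0)) T + G y (D (e i)) (D2 (e i) (0, 1)) -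
          G y (D (\<Gamma> (e i) (e i))) T -
        (G y (D2 (e i) (e i, 0)) T + G y (christoffel G y (D (e i)) (D (e i))) T - G y (D (\<Gamma> (e i) (e i))) T)"
      using Gsym[of "D (e i)" "D2 (e i) (0, 1)"] by (simp add: algebra_simps)
  qed
qed

text \<open>When velocity equals tension, integrating the pointwise identity leaves minus the
  integral of the squared velocity. Nonnegativity of that integral permits undoing the square root
  in \<open>L2_norm\<close>.\<close>

lemma energy_flow_DERIV:
  assumes t: "t > 0" and eq: "\<And>p. velocity B f t p = tension A g B h (f t) p"
  shows "((\<lambda>s. energy A g B h (f s)) has_real_derivative - (L2_norm A g h (f t) (velocity B f t))\<^sup>2) (at t)"
proof -
  have i: "integrable M.vol (M.divergence (omega t))"
    by (rule M.integrable_vol_continuous[OF M.continuous_divergence[OF C1_omega[OF t]]])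
  have hv: "h (f t p) (velocity B f t p) (velocity B f t p) = M.divergence (omega t) p - energy_density' t p" for p
    using first_variation_pointwise[OF t, of p] eq[of p] by simp
  have nn: "0 \<le> h (f t p) (velocity B f t p) (velocity B f t p)" for p
    using inner_product_pos[OF N.inner_product_g, of "velocity B f t p" "f t p"]
      bilinear_lzero[OF inner_product_bilinear[OF N.inner_product_g]]
    by (cases "velocity B f t p = 0") (auto simp: less_imp_le)
  have "(\<integral>p. h (f t p) (velocity B f t p) (velocity B f t p) \<partial>M.vol) = - (\<integral>p. energy_density' t p \<partial>M.vol)"
    unfolding hv using i energy_DERIV(1)[OF t] by (simp add: M.integral_divergence[OF C1_omega[OF t]])
  moreover have "0 \<le> (\<integral>p. h (f t p) (velocity B f t p) (velocity B f t p) \<partial>M.vol)"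
    by (rule integral_nonneg_AE) (use nn in auto)
  ultimately have "(L2_norm A g h (f t) (velocity B f t))\<^sup>2 = - (\<integral>p. energy_density' t p \<partial>M.vol)"
    by (simp add: L2_norm_def L2_inner_def)
  then show ?thesis using energy_DERIV(2)[OF t] by simp
qed

end

section \<open>Convergence of the energy\<close>

text \<open>\<open>H\<close> is merely continuous on the open set \<open>U\<close>. A compact
  thickening of the limit image inside \<open>U\<close> makes it uniformly continuous where the
  approximating values eventually lie.\<close>

lemma uniform_limit_compose_open:
  fixes y :: "'i \<Rightarrow> 'a::topological_space \<Rightarrow> 'b::euclidean_space" and H :: "'b \<Rightarrow> 'c::metric_space"
  assumes K: "compact K" and y0: "continuous_on K y0" "y0 ` K \<subseteq> U" and U: "open U"
    and H: "continuous_on U H" and lim: "uniform_limit K y y0 F"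
  shows "uniform_limit K (\<lambda>t x. H (y t x)) (\<lambda>x. H (y0 x)) F"
proof -
  have C: "compact (y0 ` K)" by (rule compact_continuous_image[OF y0(1) K])
  obtain e where e: "e > 0" "(\<Union>z\<in>y0 ` K. cball z e) \<subseteq> U"
    by (rule compact_subset_open_imp_cball_epsilon_subset[OF C U y0(2)])
  \<comment> \<open>The sum of a compact set and a closed ball is compact, and \<open>e\<close> was
    chosen so that it stays inside \<open>U\<close>.\<close>
  define L where "L = {u + v | u v. u \<in> y0 ` K \<and> v \<in> cball 0 e}"
  have L: "compact L" unfolding L_def by (rule compact_sums[OF C compact_cball])
  have "L \<subseteq> U" using e(2) by (force simp: L_def dist_norm)
  then have uc: "uniformly_continuous_on L H"
    using L H compact_uniformly_continuous continuous_on_subset by blast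
  have inL: "w \<in> L" if "x \<in> K" "dist w (y0 x) < e" for w x
  proof -
    have "w = y0 x + (w - y0 x) \<and> y0 x \<in> y0 ` K \<and> w - y0 x \<in> cball 0 e"
      using that by (auto simp: dist_norm norm_minus_commute)
    then show ?thesis unfolding L_def by blast
  qed
  show ?thesis
    unfolding uniform_limit_iff
  proof (intro allI impI)
    fix \<epsilon> :: real assume "\<epsilon> > 0"
    then obtain \<delta> where \<delta>: "\<delta> > 0" "\<And>z w. z \<in> L \<Longrightarrow> w \<in> L \<Longrightarrow> dist w z < \<delta> \<Longrightarrow> dist (H w) (H z) < \<epsilon>"
      using uc unfolding uniformly_continuous_on_def by metis
    have "\<forall>\<^sub>F t in F. \<forall>x\<in>K. dist (y t x) (y0 x) < min \<delta> e"
      by (rule uniform_limitD[OF lim]) (use \<delta>(1) e(1) in simp)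
    then show "\<forall>\<^sub>F t in F. \<forall>x\<in>K. dist (H (y t x)) (H (y0 x)) < \<epsilon>"
    proof eventually_elim
      case (elim t)
      show ?case
      proof
        fix x assume x: "x \<in> K"
        show "dist (H (y t x)) (H (y0 x)) < \<epsilon>"
          by (rule \<delta>(2)[OF inL[OF x] inL[OF x]]) (use elim x e(1) in auto)
      qed
    qed
  qed
qed

lemma uniform_limit_mult_compact:
  fixes u w :: "'i \<Rightarrow> 'a::topological_space \<Rightarrow> real"
  assumes K: "compact K" and u: "uniform_limit K u u0 F" "continuous_on K u0"
    and w: "uniform_limit K w w0 F" "continuous_on K w0"
  shows "uniform_limit K (\<lambda>t x. u t x * w t x) (\<lambda>x. u0 x * w0 x) F"
  by (rule uniform_lim_mult[OF u(1) w(1)])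
    (use compact_imp_bounded[OF compact_continuous_image[OF _ K]] u(2) w(2) in blast)+

lemma uniform_limit_sum_real:
  fixes u :: "'j \<Rightarrow> 'i \<Rightarrow> 'a \<Rightarrow> real"
  assumes "\<And>j. j \<in> J \<Longrightarrow> uniform_limit K (u j) (u0 j) F"
  shows "uniform_limit K (\<lambda>t x. \<Sum>j\<in>J. u j t x) (\<lambda>x. \<Sum>j\<in>J. u0 j x) F"
  using assms by (induction J rule: infinite_finite_induct) (auto intro!: uniform_limit_intros)

context flow begin

text \<open>On a compact coordinate ball the density is a polynomial in the first derivatives of the
  coordinate expression, with coefficients from the two metrics. All factors converge uniformly to
  continuous, hence bounded, limits, so the products do as well.\<close>

lemma energy_density_locally_uniform_limit:
  assumes f0: "C1_map f0" and conv: "Ck_convergent 1 A B f f0"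
  shows "\<exists>U. open U \<and> p \<in> U \<and> uniform_limit U (\<lambda>t. energy_density (f t)) (energy_density f0) at_top"
proof -
  let ?c = "chart_at A p" and ?d = "chart_at B (f0 p)"
  have c: "?c \<in> A" "p \<in> fst ?c" and d: "?d \<in> B" "f0 p \<in> fst ?d" by (rule M.chart_at N.chart_at)+
  let ?V = "snd ?c ` (fst ?c \<inter> f0 -` fst ?d)" and ?G = "metric_in B h ?d"
  have V: "open ?V" by (rule open_chart_image[OF M.is_chart[OF c(1)] open_preimage[OF f0 N.chart(1)[OF d(1)]]])
  have "snd ?c p \<in> ?V" using c d by blast
  then obtain r where r: "r > 0" "cball (snd ?c p) r \<subseteq> ?V" using V open_contains_cball by blast
  define X where "X = cball (snd ?c p) r"
  have X: "compact X" "X \<subseteq> ?V" "X \<subseteq> cdom ?c" using r by (auto simp: X_def)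
  define K where "K = chart_inv ?c ` X"
  have K: "compact K"
    unfolding K_def by (rule compact_continuous_image[OF continuous_on_subset[OF M.chart(4)[OF c(1)] X(3)] X(1)])
  have Kc: "K \<subseteq> fst ?c" using X(3) M.chart(6)[OF c(1)] unfolding K_def by blast
  have Kd: "f0 ` K \<subseteq> fst ?d"
    using X(2) M.chart(5)[OF c(1)] unfolding K_def by fastforce
  have KX: "snd ?c ` K = X"
    unfolding K_def image_image using X(3) M.chart(7)[OF c(1)] by (force simp: image_iff)
  have ev: "\<forall>\<^sub>F t in at_top. f t ` K \<subseteq> fst ?d"
    and ul: "length vs \<le> 1 \<Longrightarrow> uniform_limit X (\<lambda>t. iterated_derivative vs (rep ?c ?d (f t)))
      (iterated_derivative vs (rep ?c ?d f0)) at_top" for vs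
    using conv c(1) d(1) K Kc Kd unfolding Ck_convergent_def rep_def KX[symmetric] by blast+
  have u0: "uniform_limit X (\<lambda>t. rep ?c ?d (f t)) (rep ?c ?d f0) at_top" using ul[of "[]"] by simp
  have u1: "uniform_limit X (\<lambda>t x. fd (rep ?c ?d (f t)) x v) (\<lambda>x. fd (rep ?c ?d f0) x v) at_top" for v
    using ul[of "[v]"] by simp
  note C = C1_on_subset[OF C1_mapD(2)[OF f0 c(1) d(1)] X(2)]
  have c0: "continuous_on X (rep ?c ?d f0)" and c1: "continuous_on X (\<lambda>x. fd (rep ?c ?d f0) x v)" for v
    using C1_on_continuous_on[OF C] C1_on_continuous_fd[OF C] by auto
  have im: "rep ?c ?d f0 ` X \<subseteq> cdom ?d" using X(2) rep_snd[OF c(1), of _ ?d f0] by auto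
  have cG: "continuous_on (cdom ?d) (\<lambda>y. ?G y u v)" for u v
    by (rule C1_on_continuous_on[OF C1_metricD(3)[OF N.C1_metric_in[OF d(1)]]])
  have uG: "uniform_limit X (\<lambda>t x. ?G (rep ?c ?d (f t) x) u v) (\<lambda>x. ?G (rep ?c ?d f0 x) u v) at_top" for u v
    by (rule uniform_limit_compose_open[OF X(1) c0 im N.chart(2)[OF d(1)] cG u0])
  have cG0: "continuous_on X (\<lambda>x. ?G (rep ?c ?d f0 x) u v)" for u v
    by (rule continuous_on_compose2[OF cG c0 im])
  have u1i: "uniform_limit X (\<lambda>t x. fd (rep ?c ?d (f t)) x v $ i) (\<lambda>x. fd (rep ?c ?d f0) x v $ i) at_top" for v i
    by (rule bounded_linear.uniform_limit[OF bounded_linear_vec_nth u1])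
  have c1i: "continuous_on X (\<lambda>x. fd (rep ?c ?d f0) x v $ i)" for v i
    by (intro continuous_intros c1)
  have cm: "continuous_on X (\<lambda>x. cometric ?c x a b)" for a b
    by (rule continuous_on_subset[OF C1_on_continuous_on[OF C1_cometric[OF c(1)]] X(3)])
  \<comment> \<open>The density with the target metric expanded into components as well, so that
    only sums and products of scalar uniform limits remain.\<close>
  define E where "E = (\<lambda>F x. 1/2 * (\<Sum>a\<in>UNIV. \<Sum>b\<in>UNIV. cometric ?c x a b * (\<Sum>i\<in>UNIV. \<Sum>j\<in>UNIV.
     (fd (rep ?c ?d F) x (axis a 1) $ i * fd (rep ?c ?d F) x (axis b 1) $ j) * ?G (rep ?c ?d F x) (axis i 1) (axis j 1))))"
  have uE: "uniform_limit X (\<lambda>t. E (f t)) (E f0) at_top"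
    unfolding E_def
    by (intro uniform_limit_mult_compact[OF X(1)] uniform_limit_sum_real uniform_limit_const continuous_on_const
        continuous_on_sum continuous_on_mult u1i c1i uG cG0 cm)
  have eE: "energy_density F q = E F (snd ?c q)" if F: "C1_map F" and q: "q \<in> fst ?c" "F q \<in> fst ?d" for F q
  proof -
    have y: "snd ?d (F q) \<in> cdom ?d" using q by blast
    show ?thesis
      unfolding energy_density_chart[OF F c(1) q(1) d(1) q(2)] chart_density_def E_def rep_snd[OF c(1) q(1)]
      by (subst bilinear_axis[OF C1_metricD(4)[OF N.C1_metric_in[OF d(1)] y]]) simp
  qed
  let ?U = "fst ?c \<inter> snd ?c -` ball (snd ?c p) r"
  have UK: "q \<in> K" "snd ?c q \<in> X" if "q \<in> ?U" for q
    using that M.chart(5)[OF c(1), of q] by (auto simp: K_def X_def image_iff intro!: bexI[of _ "snd ?c q"])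
  have "uniform_limit ?U (\<lambda>t. energy_density (f t)) (energy_density f0) at_top"
    unfolding uniform_limit_iff
  proof (intro allI impI)
    fix \<epsilon> :: real assume "\<epsilon> > 0"
    then have "\<forall>\<^sub>F t in at_top. \<forall>x\<in>X. dist (E (f t) x) (E f0 x) < \<epsilon>" using uE unfolding uniform_limit_iff by blast
    then show "\<forall>\<^sub>F t in at_top. \<forall>q\<in>?U. dist (energy_density (f t) q) (energy_density f0 q) < \<epsilon>"
      using ev eventually_gt_at_top[of 0]
    proof eventually_elim
      case (elim t)
      show ?case
      proof
        fix q assume q: "q \<in> ?U"
        have "f t q \<in> fst ?d" "f0 q \<in> fst ?d" using UK(1)[OF q] elim(2) Kd by auto
        then show "dist (energy_density (f t) q) (energy_density f0 q) < \<epsilon>"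
          using eE[OF C1_map_f[OF elim(3)], of q] eE[OF f0, of q] q elim(1) UK(2)[OF q] by simp
      qed
    qed
  qed
  moreover have "open ?U" by (rule open_chart_preimage[OF M.is_chart[OF c(1)]]) simp
  moreover have "p \<in> ?U" using c r by simp
  ultimately show ?thesis by blast
qed

text \<open>Finitely many of the neighbourhoods cover the manifold, so the density converges
  uniformly, and the volume is finite.\<close>

lemma energy_tendsto:
  assumes f0: "C1_map f0" and conv: "Ck_convergent 1 A B f f0"
  shows "((\<lambda>t. energy A g B h (f t)) \<longlongrightarrow> energy A g B h f0) at_top"
proof (rule tendstoI)
  fix \<epsilon> :: real assume \<epsilon>: "\<epsilon> > 0"
  obtain U where U: "\<And>p. open (U p)" "\<And>p. p \<in> U p"
    "\<And>p. uniform_limit (U p) (\<lambda>t. energy_density (f t)) (energy_density f0) at_top"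
    using energy_density_locally_uniform_limit[OF assms] by metis
  have "UNIV \<subseteq> (\<Union>p\<in>UNIV. U p)" using U(2) by blast
  then obtain P where P: "finite P" "UNIV \<subseteq> (\<Union>p\<in>P. U p)"
    using compactE_image[OF M.compact, of UNIV U] U(1) by metis
  define m where "m = measure M.vol UNIV"
  \<comment> \<open>Multiplied by the total volume \<open>m\<close> this stays below
    \<open>\<epsilon> / 2\<close>; adding 1 avoids dividing by zero when the volume
    vanishes.\<close>
  define e where "e = \<epsilon> / (2 * (m + 1))"
  have m: "m \<ge> 0" by (simp add: m_def)
  then have e: "e > 0" using \<epsilon> by (simp add: e_def)
  have "\<forall>\<^sub>F t in at_top. \<forall>p\<in>P. \<forall>q\<in>U p. dist (energy_density (f t) q) (energy_density f0 q) < e"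
    using U(3) e P(1) by (simp add: eventually_ball_finite_distrib uniform_limit_iff)
  then show "\<forall>\<^sub>F t in at_top. dist (energy A g B h (f t)) (energy A g B h f0) < \<epsilon>"
    using eventually_gt_at_top[of 0]
  proof eventually_elim
    case (elim t)
    have d: "\<bar>energy_density (f t) q - energy_density f0 q\<bar> \<le> e" for q
    proof -
      obtain p where "p \<in> P" "q \<in> U p" using P(2) by blast
      then have "dist (energy_density (f t) q) (energy_density f0 q) < e" using elim(1) by blast
      then show ?thesis by (simp add: dist_real_def)
    qed
    have i: "integrable M.vol (energy_density (f t))" "integrable M.vol (energy_density f0)"
      by (intro M.integrable_vol_continuous continuous_energy_density C1_map_f elim(2) f0)+
    have "\<bar>energy A g B h (f t) - energy A g B h f0\<bar> = \<bar>\<integral>q. energy_density (f t) q - energy_density f0 q \<partial>M.vol\<bar>"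
      using i by (simp add: energy_eq)
    also have "\<dots> \<le> (\<integral>q. \<bar>energy_density (f t) q - energy_density f0 q\<bar> \<partial>M.vol)"
      by (rule integral_abs_bound)
    also have "\<dots> \<le> (\<integral>q. e \<partial>M.vol)"
      by (rule integral_mono) (use i d M.integrable_vol_bounded[of "\<lambda>_. e" e] e in auto)
    also have "\<dots> = m * e" by (simp add: m_def)
    also have "\<dots> \<le> (m + 1) * e" using e by (simp add: algebra_simps)
    also have "\<dots> = \<epsilon> / 2" unfolding e_def using m by (simp add: field_simps)
    also have "\<dots> < \<epsilon>" using \<epsilon> by simp
    finally show ?case by (simp add: dist_real_def)
  qed
qed

lemma L2_norm_nonneg: "0 \<le> L2_norm A g h F s"
proof -
  have "0 \<le> h (F p) (s p) (s p)" for p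
    using inner_product_pos[OF N.inner_product_g, of "s p" "F p"]
      bilinear_lzero[OF inner_product_bilinear[OF N.inner_product_g]]
    by (cases "s p = 0") (auto simp: less_imp_le)
  then have "0 \<le> L2_inner A g h F s s" unfolding L2_inner_def by (intro integral_nonneg_AE) auto
  then show ?thesis by (simp add: L2_norm_def)
qed

lemma C1_map_smooth:
  assumes F: "smooth_map A B F"
  shows "C1_map F"
proof -
  have cont: "continuous_on UNIV F" using F by (simp add: smooth_map_def)
  have "C1_on (snd c ` (fst c \<inter> F -` fst d)) (rep c d F)" if c: "c \<in> A" and d: "d \<in> B" for c d
    unfolding rep_def
    by (rule smooth_on_imp_C1_on[OF _ open_chart_image[OF M.is_chart[OF c]] subset_refl])
      (use F c d open_vimage[OF N.chart(1)[OF d] cont] in \<open>auto simp: smooth_map_def\<close>)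
  then show ?thesis using cont by (simp add: C1_map_def)
qed

end

text \<open>For \<open>K = a\<^sup>2 / (2 b)\<close>, the function \<open>E t - K * exp (- 2 b t)\<close> is nondecreasing, whereas \<open>E\<close> is
  nonincreasing.\<close>

lemma exponential_decay:
  fixes E v :: "real \<Rightarrow> real"
  assumes E: "\<And>t. t > 0 \<Longrightarrow> (E has_real_derivative - (v t)\<^sup>2) (at t)"
    and v: "\<And>t. t > 0 \<Longrightarrow> 0 \<le> v t" "\<And>t. t > 0 \<Longrightarrow> v t \<le> a * exp (- b * t)"
    and b: "b > 0" and lim: "(E \<longlongrightarrow> L) at_top" and t: "t > 0"
  shows "\<bar>E t - L\<bar> \<le> a\<^sup>2 / (2 * b) * exp (- 2 * b * t)"
proof -
  define K where "K = a\<^sup>2 / (2 * b)"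
  have K: "K \<ge> 0" using b by (simp add: K_def)
  have mono: "E s \<le> E t" "E t - K * exp (- 2 * b * t) \<le> E s - K * exp (- 2 * b * s)" if s: "t \<le> s" for s
  proof -
    show "E s \<le> E t"
    proof (rule DERIV_nonpos_imp_nonincreasing[OF s])
      fix x assume "t \<le> x"
      then show "\<exists>y. (E has_real_derivative y) (at x) \<and> y \<le> 0"
        using E[of x] t by (intro exI[of _ "- (v x)\<^sup>2"]) auto
    qed
    show "E t - K * exp (- 2 * b * t) \<le> E s - K * exp (- 2 * b * s)"
    proof (rule DERIV_nonneg_imp_nondecreasing[OF s])
      fix x assume x: "t \<le> x" "x \<le> s"
      have x0: "x > 0" using t x by simp
      have "((\<lambda>x. E x - K * exp (- 2 * b * x)) has_real_derivative - (v x)\<^sup>2 + K * (2 * b * exp (- 2 * b * x))) (at x)"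
        by (rule derivative_eq_intros E[OF x0] refl | simp)+
      moreover have "(v x)\<^sup>2 \<le> (a * exp (- b * x))\<^sup>2" by (rule power_mono) (use v x0 in auto)
      \<comment> \<open>This equality fixes the constant \<open>K\<close>: differentiating the
        exponential term gives exactly the upper bound for the square of \<open>v x\<close>.\<close>
      moreover have "(a * exp (- b * x))\<^sup>2 = K * (2 * b * exp (- 2 * b * x))"
        using b by (simp add: K_def power_mult_distrib exp_double[symmetric] algebra_simps)
      ultimately show "\<exists>y. ((\<lambda>x. E x - K * exp (- 2 * b * x)) has_real_derivative y) (at x) \<and> 0 \<le> y"
        by (intro exI conjI) (assumption, simp)
    qed
  qed
  have "L \<le> E t"
    by (rule tendsto_upperbound[OF lim eventually_mono[OF eventually_ge_at_top[of t] mono(1)]]) simp_all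
  moreover have "E t - K * exp (- 2 * b * t) \<le> L"
  proof (rule tendsto_lowerbound[OF lim])
    show "\<forall>\<^sub>F s in at_top. E t - K * exp (- 2 * b * t) \<le> E s"
      using eventually_ge_at_top[of t]
    proof eventually_elim
      case (elim s)
      have "0 \<le> K * exp (- 2 * b * s)" using K by simp
      then show ?case using mono(2)[OF elim] by linarith
    qed
  qed simp
  ultimately show ?thesis unfolding K_def by linarith
qed

theorem corollary1p2:
  fixes A :: "('p::{t2_space,second_countable_topology}, 'm::finite) chart set"
    and g :: "'p \<Rightarrow> real ^ 'm \<Rightarrow> real ^ 'm \<Rightarrow> real"
    and B :: "('q::{t2_space,second_countable_topology}, 'n::finite) chart set"
    and h :: "'q \<Rightarrow> real ^ 'n \<Rightarrow> real ^ 'n \<Rightarrow> real"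
    and f :: "real \<Rightarrow> 'p \<Rightarrow> 'q"
    and f_inf :: "'p \<Rightarrow> 'q"
    and b :: real
  assumes "riemannian_manifold A g"
    and "compact (UNIV :: 'p set)"
    and "riemannian_manifold B h"
    and "complete_riemannian B h"
    and "nonpositively_curved B h"
    and "harmonic_heat_flow A g B h f"
    and "\<forall>k. Ck_convergent k A B f f_inf"
    and "harmonic A g B h f_inf"
    and "nondegenerate_critical_point A g B h f_inf"
    and "b > 0"
    and "\<exists>a>0. \<forall>t\<ge>0. L2_norm A g h (f t) (velocity B f t) \<le> a * exp (- b * t)"
  shows "\<exists>a'>0. \<forall>t\<ge>0. \<bar>energy A g B h (f t) - energy A g B h f_inf\<bar> \<le> a' * exp (- 2 * b * t)"
proof -
  interpret flow A g B h f
    using assms(1-3,6)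
    by unfold_locales (auto simp: riemannian_manifold_def harmonic_heat_flow_def)
  obtain a where a: "a > 0" "\<And>t. t \<ge> 0 \<Longrightarrow> L2_norm A g h (f t) (velocity B f t) \<le> a * exp (- b * t)"
    using assms(11) by blast
  have eq: "velocity B f t p = tension A g B h (f t) p" if "t > 0" for t p
    using assms(6) that by (simp add: harmonic_heat_flow_def)
  have "C1_map f_inf" using C1_map_smooth assms(8) by (simp add: harmonic_def)
  then have lim: "((\<lambda>t. energy A g B h (f t)) \<longlongrightarrow> energy A g B h f_inf) at_top"
    using energy_tendsto assms(7) by blast
  define K where "K = a\<^sup>2 / (2 * b)"
  have decay: "\<bar>energy A g B h (f t) - energy A g B h f_inf\<bar> \<le> K * exp (- 2 * b * t)" if "t > 0" for t
    unfolding K_def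
    by (rule exponential_decay[where E = "\<lambda>t. energy A g B h (f t)" and v = "\<lambda>t. L2_norm A g h (f t) (velocity B f t)",
          OF energy_flow_DERIV[OF _ eq] L2_norm_nonneg a(2) assms(10) lim that]) auto
  \<comment> \<open>At time 0 the exponential equals 1, so the second summand covers that time
    alone; positivity of the sum comes from \<open>K\<close>, that is, from a > 0 and b > 0.\<close>
  define a' where "a' = K + \<bar>energy A g B h (f 0) - energy A g B h f_inf\<bar>"
  have "K > 0" using a(1) assms(10) by (simp add: K_def)
  moreover have "\<bar>energy A g B h (f t) - energy A g B h f_inf\<bar> \<le> a' * exp (- 2 * b * t)" if "t \<ge> 0" for t
  proof (cases "t = 0")
    case True
    then show ?thesis using \<open>K > 0\<close> by (simp add: a'_def)
  next
    case False
    then have "\<bar>energy A g B h (f t) - energy A g B h f_inf\<bar> \<le> K * exp (- 2 * b * t)" using decay that by simp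
    also have "\<dots> \<le> a' * exp (- 2 * b * t)" by (intro mult_right_mono) (simp_all add: a'_def)
    finally show ?thesis .
  qed
  ultimately show ?thesis by (intro exI[of _ a']) (auto simp: a'_def)
qed

end
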